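(* Suppose that $X$ is a countable linear order. Then $X$ is left-absorbing if and only if there is a countable, minimal collection $\{I_k\}$ of non-empty countable linear orders, and two countable orders $L$ and $R$, such that $X = L + \mathbb{Q}[I_k] + R$ and exactly one of the following eight conditions holds: (1) $L = R = \emptyset$; (2) there is an index $k$ such that $L \cong I_k$, and $R = \emptyset$; (3) there is an index $k$ such that $R \cong I_k$, and $L = \emptyset$; (4) there are indices $k_1, k_2$ such that $L \cong I_{k_1}$ and $R \cong I_{k_2}$, but there is no index $k$ such that $R + L \cong I_k$; (5) there is an index $k_0$ such that $R + L \cong I_{k_0}$, but no index $k$ such that $L \cong I_k$ and no index $k$ such that $R \cong I_k$; (6) there is an index $k_0$ such that $R + L \cong I_{k_0}$ and an index $k_1$ such that $L \cong I_{k_1}$, but no index $k$ such that $R \cong I_k$; (7) there is an index $k_0$ such that $R + L \cong I_{k_0}$ and an index $k_1$ such that $R \cong I_{k_1}$, but no index $k$ such that $L \cong I_k$; (8) there are indices $k_0, k_1, k_2$ such that $R + L \cong I_{k_0}$, $L \cong I_{k_1}$, and $R \cong I_{k_2}$. Moreover, suppose that $X$ is left-absorbing (represented as $X = L + \mathbb{Q}[I_k] + R$ as just described) and $A$ is a countable order. Whether $AX \cong X$ is determined by which of the eight conditions (1)–(8) $X$ satisfies, as follows: (i) if (1), then $AX \cong X$ for every countable order $A$; (ii) if (2), then $AX \cong X$ iff $A$ has a left endpoint; (iii) if (3), then $AX \cong X$ iff $A$ has a right endpoint; (iv) if (4), then $AX \cong X$ iff $A \cong 1 + \mathbb{Q}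 + 1$ or $A \cong 1$; (v) if (5), then $AX \cong X$ iff $A$ has a left and right endpoint, every point of $A$ other than the right endpoint has a successor, and every point of $A$ other than the left endpoint has a predecessor; (vi) if (6), then $AX \cong X$ iff $A$ has a left and right endpoint and every point of $A$ other than the right endpoint has a successor; (vii) if (7), then $AX \cong X$ iff $A$ has a left and right endpoint and every point of $A$ other than the left endpoint has a predecessor; (viii) if (8), then $AX \cong X$ iff $A$ has a left and right endpoint.
   Context: All orders are linear orders; $AX$ denotes the lexicographic product (replace each point of $A$ by a copy of $X$). An order $X$ is left-absorbing if there is an order $A$ with at least two points such that $AX \cong X$. $Y + Z$ denotes the ordered sum. For $N$ either a natural number $n \geq 1$ or $\mathbb{N}$, a shuffle $\mathbb{Q}[I_k]$ of orders $\{I_k\}_{k \in N}$ is obtained by partitioning $\mathbb{Q} = \bigcup_{k\in N} Q_k$ into subsets each dense in $\mathbb{Q}$ and replacing each $q \in Q_k$ by a copy of $I_k$ (unique up to isomorphism). A convex copy of an order $Y$ inside an order is an interval isomorphic to $Y$. A countable collection $\{I_k\}$ of countable orders is minimal if none of the $I_k$ contains a convex copy of the shuffle $\mathbb{Q}[I_k]$. $1$ denotes the one-point order.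
   Formalization: X is assumed non-empty, A non-empty in (i), R non-empty in (6) and L non-empty in (7): literally (2) implies (6) and (3) implies (7), so "exactly one" fails for X = 1 + Q. In the first equivalence the I_k, L, R are orders on sets of natural numbers. *)

theory Defs
  imports Complex_Main "HOL-Library.Countable_Set"
begin

text \<open>
  A linear order is a reflexive relation \<^term>\<open>r\<close> with \<^term>\<open>Linear_order r\<close>, carried by
  \<^term>\<open>Field r\<close>; the empty order is \<^term>\<open>{}\<close>.
\<close>

definition order_isomorphic :: "'a rel \<Rightarrow> 'b rel \<Rightarrow> bool" (infix "\<cong>" 50) where
  "r \<cong> s \<longleftrightarrow> (\<exists>f. iso r s f)"

definition countable_order :: "'a rel \<Rightarrow> bool" where
  "countable_order r \<longleftrightarrow> Linear_order r \<and> countable (Field r)"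

definition order_sum :: "'a rel \<Rightarrow> 'b rel \<Rightarrow> ('a + 'b) rel" (infixr "\<^bold>+" 65) where
  "r \<^bold>+ s = map_prod Inl Inl ` r \<union> map_prod Inr Inr ` s \<union> (Inl ` Field r) \<times> (Inr ` Field s)"

text \<open>Each point \<open>a\<close> of the index order is replaced by a copy of \<open>J a\<close>.\<close>

definition replace_points :: "'i rel \<Rightarrow> ('i \<Rightarrow> 'a rel) \<Rightarrow> ('i \<times> 'a) rel" where
  "replace_points r J =
     {((a, x), (b, y)). a \<in> Field r \<and> b \<in> Field r \<and> x \<in> Field (J a) \<and> y \<in> Field (J b) \<and>
        ((a \<noteq> b \<and> (a, b) \<in> r) \<or> (a = b \<and> (x, y) \<in> J a))}"

definition lex_product :: "'a rel \<Rightarrow> 'b rel \<Rightarrow> ('a \<times> 'b) rel" (infixr "\<^bold>*" 70) where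
  "A \<^bold>* X = replace_points A (\<lambda>_. X)"

text \<open>
  The order \<open>A\<close> ranges over orders on the type of \<open>X\<close>.  For non-empty \<open>X\<close> this loses nothing,
  since \<open>A\<close> embeds into \<open>A \<^bold>* X \<cong> X\<close>; see \<open>left_absorbingI\<close> below.
\<close>

definition left_absorbing :: "'a rel \<Rightarrow> bool" where
  "left_absorbing X \<longleftrightarrow>
     (\<exists>A :: 'a rel. Linear_order A \<and> (\<exists>a\<in>Field A. \<exists>b\<in>Field A. a \<noteq> b) \<and> A \<^bold>* X \<cong> X)"

lemma left_absorbingI:
  fixes A :: "'b rel" and X :: "'a rel"
  assumes "Linear_order A" and "a \<in> Field A" "b \<in> Field A" "a \<noteq> b"
    and "A \<^bold>* X \<cong> X" and "Linear_order X" and "X \<noteq> {}"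
  shows "left_absorbing X"
proof -
  obtain x0 where x0: "x0 \<in> Field X"
    using \<open>X \<noteq> {}\<close> by (auto simp: Field_def)
  have refl: "(x, x) \<in> X" if "x \<in> Field X" for x
    using that assms(6) by (auto simp: order_on_defs refl_on_def)
  have reflA: "(x, x) \<in> A" if "x \<in> Field A" for x
    using that assms(1) by (auto simp: order_on_defs refl_on_def)
  have fld: "Field (B \<^bold>* X) = Field B \<times> Field X" for B :: "'c rel"
    using refl by (fastforce simp: Field_def lex_product_def replace_points_def)
  obtain f where f: "iso (A \<^bold>* X) X f"
    using assms(5) by (auto simp: order_isomorphic_def)
  then have bij: "bij_betw f (Field A \<times> Field X) (Field X)"
    and ord: "\<And>p q. p \<in> Field A \<times> Field X \<Longrightarrow> q \<in> Field A \<times> Field X \<Longrightarrow>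
                (p, q) \<in> A \<^bold>* X \<longleftrightarrow> (f p, f q) \<in> X"
    by (auto simp: iso_iff2 fld)
  define g where "g = (\<lambda>a. f (a, x0))"
  have inj: "inj_on g (Field A)"
    using bij x0 by (auto simp: g_def inj_on_def bij_betw_def)
  define B where "B = dir_image A g"
  have linB: "Linear_order B"
    unfolding B_def by (rule Linear_order_dir_image[OF assms(1) inj])
  have fldB: "Field B = g ` Field A"
    unfolding B_def by (rule dir_image_Field)
  have B_iff: "(g x, g y) \<in> B \<longleftrightarrow> (x, y) \<in> A" if "x \<in> Field A" "y \<in> Field A" for x y
  proof
    assume "(g x, g y) \<in> B"
    then obtain u v where uv: "(u, v) \<in> A" "g x = g u" "g y = g v"
      by (auto simp: B_def dir_image_def)
    then have "u \<in> Field A" "v \<in> Field A" by (auto simp: Field_def)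
    with uv inj that show "(x, y) \<in> A" by (metis inj_onD)
  next
    assume "(x, y) \<in> A" then show "(g x, g y) \<in> B" by (auto simp: B_def dir_image_def)
  qed
  define h where "h = inv_into (Field A) g"
  have h: "h (g x) = x" if "x \<in> Field A" for x
    using inj that by (simp add: h_def)
  have bij1: "bij_betw (map_prod h id) (Field B \<times> Field X) (Field A \<times> Field X)"
    by (rule bij_betw_byWitness[where f' = "map_prod g id"]) (auto simp: fldB h)
  have "iso (B \<^bold>* X) X (f \<circ> map_prod h id)"
    unfolding iso_iff2 fld
  proof (intro conjI ballI)
    show "bij_betw (f \<circ> map_prod h id) (Field B \<times> Field X) (Field X)"
      using bij1 bij by (rule bij_betw_trans)
  next
    fix p q assume p: "p \<in> Field B \<times> Field X" and q: "q \<in> Field B \<times> Field X"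
    obtain u x where p': "p = (g u, x)" "u \<in> Field A" "x \<in> Field X" using p fldB by auto
    obtain v y where q': "q = (g v, y)" "v \<in> Field A" "y \<in> Field X" using q fldB by auto
    have "g u = g v \<longleftrightarrow> u = v" using inj p' q' by (auto simp: inj_on_def)
    then have "(p, q) \<in> B \<^bold>* X \<longleftrightarrow> ((u, x), (v, y)) \<in> A \<^bold>* X"
      using p' q' B_iff by (auto simp: lex_product_def replace_points_def fldB)
    also have "\<dots> \<longleftrightarrow> (f (u, x), f (v, y)) \<in> X"
      using p' q' by (intro ord) auto
    finally show "(p, q) \<in> B \<^bold>* X \<longleftrightarrow> ((f \<circ> map_prod h id) p, (f \<circ> map_prod h id) q) \<in> X"
      using p' q' h by simp
  qed
  moreover have "g a \<noteq> g b" "g a \<in> Field B" "g b \<in> Field B"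
    using inj assms(2-4) by (auto simp: inj_on_def fldB)
  ultimately show ?thesis
    using linB unfolding left_absorbing_def order_isomorphic_def by blast
qed

definition order_one :: "unit rel" ("\<^bold>1") where
  "\<^bold>1 = {((), ())}"

definition order_rat :: "rat rel" ("\<^bold>Q") where
  "\<^bold>Q = {(p, q). p \<le> q}"

text \<open>The index sets \<open>n \<ge> 1\<close> (as \<open>{0, \<dots>, n - 1}\<close>) and \<open>\<nat>\<close> of a countable collection.\<close>

definition index_set :: "nat set \<Rightarrow> bool" where
  "index_set N \<longleftrightarrow> (\<exists>n\<ge>1. N = {..<n}) \<or> N = UNIV"

text \<open>The partition of the rationals is given by its colouring \<open>c\<close>, that is \<open>Q\<^sub>k = c -` {k}\<close>.\<close>

definition dense_partition :: "nat set \<Rightarrow> (rat \<Rightarrow> nat) \<Rightarrow> bool" where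
  "dense_partition N c \<longleftrightarrow>
     range c \<subseteq> N \<and> (\<forall>k\<in>N. \<forall>a b. a < b \<longrightarrow> (\<exists>q. a < q \<and> q < b \<and> c q = k))"

lemma dense_partition_exists:
  assumes "index_set N"
  shows "\<exists>c. dense_partition N c"
proof -
  define P where "P = (\<lambda>(q::rat) j. \<exists>(m::int) (n::int). odd n \<and> q * (2 ^ j * of_int n) = of_int m)"
  define d where "d = (\<lambda>q. LEAST j. P q j)"
  have d_dense: "\<exists>q. a < q \<and> q < b \<and> d q = k" if "a < b" for a b :: rat and k
  proof -
    obtain t :: nat where t: "2 / (b - a) < of_nat t"
      using reals_Archimedean2 by blast
    define n :: int where "n = 2 * int t + 1"
    define D :: rat where "D = 2 ^ k * of_int n"
    have n: "odd n" "n > 0" by (auto simp: n_def)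
    have nt: "of_nat t < (of_int n :: rat)" by (simp add: n_def)
    have "D \<ge> 1 * of_int n"
      unfolding D_def using n by (intro mult_right_mono) auto
    then have Dt: "2 / (b - a) < D" using t nt by linarith
    then have D0: "D > 0" using that by (smt (verit) diff_gt_0_iff_gt divide_pos_pos less_trans zero_less_numeral)
    have gap: "2 < (b - a) * D" using Dt that by (simp add: field_simps)
    define m :: int where "m = 2 * \<lfloor>(a * D + 1) / 2\<rfloor> + 1"
    have m: "a * D < of_int m" "of_int m \<le> a * D + 2"
      using floor_correct[of "(a * D + 1) / 2"] by (simp_all add: m_def field_simps)
    have mb: "of_int m < b * D" using m gap by (simp add: algebra_simps)
    define q where "q = of_int m / D"
    have ab: "a < q" "q < b" using m mb D0 by (auto simp: q_def field_simps)
    have qD: "q * (2 ^ k * of_int n) = of_int m" using n by (simp add: q_def D_def)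
    have "d q = k"
      unfolding d_def
    proof (rule Least_equality)
      show "P q k" unfolding P_def using n qD by blast
    next
      fix j assume "P q j"
      then obtain m' n' where j: "odd n'" "q * (2 ^ j * of_int n') = of_int m'"
        unfolding P_def by blast
      show "k \<le> j"
      proof (rule ccontr)
        assume "\<not> k \<le> j"
        then obtain i where i: "k = j + Suc i" by (metis less_iff_Suc_add not_le add_Suc_right)
        have "of_int (m * n') = q * (2 ^ k * of_int n) * of_int n'" using qD by simp
        also have "\<dots> = q * (2 ^ j * of_int n') * (2 ^ Suc i * of_int n)"
          by (simp add: i power_add algebra_simps)
        also have "\<dots> = of_int (m' * (2 ^ Suc i * n))" using j by simp
        finally have "m * n' = m' * (2 ^ Suc i * n)" by (simp only: of_int_eq_iff)
        moreover have "odd (m * n')" using j by (simp add: m_def)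
        ultimately show False by simp
      qed
    qed
    with ab show ?thesis by blast
  qed
  show ?thesis
  proof (cases "N = UNIV")
    case True
    then show ?thesis using d_dense by (intro exI[of _ d]) (simp add: dense_partition_def)
  next
    case False
    then obtain n where n: "n \<ge> 1" "N = {..<n}" using assms by (auto simp: index_set_def)
    have "dense_partition N (\<lambda>q. if d q < n then d q else 0)"
      unfolding dense_partition_def
    proof (intro conjI ballI allI impI)
      show "range (\<lambda>q. if d q < n then d q else 0) \<subseteq> N" using n by auto
    next
      fix k a b assume "k \<in> N" "(a :: rat) < b"
      then obtain q where "a < q" "q < b" "d q = k" using d_dense by blast
      then show "\<exists>q>a. q < b \<and> (if d q < n then d q else 0) = k"
        using \<open>k \<in> N\<close> n by (intro exI[of _ q]) auto
    qed
    then show ?thesis by blast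
  qed
qed

text \<open>
  The shuffle does not depend, up to isomorphism, on the partition, so an arbitrary one is chosen.
\<close>

definition shuffle :: "nat set \<Rightarrow> (nat \<Rightarrow> 'a rel) \<Rightarrow> (rat \<times> 'a) rel" where
  "shuffle N I = (let c = (SOME c. dense_partition N c) in replace_points \<^bold>Q (\<lambda>q. I (c q)))"

definition has_convex_copy :: "'a rel \<Rightarrow> 'b rel \<Rightarrow> bool" where
  "has_convex_copy Z Y \<longleftrightarrow>
     (\<exists>S\<subseteq>Field Z. (\<forall>x\<in>S. \<forall>y\<in>S. \<forall>z. (x, z) \<in> Z \<and> (z, y) \<in> Z \<longrightarrow> z \<in> S) \<and> Y \<cong> Restr Z S)"

definition minimal_collection :: "nat set \<Rightarrow> (nat \<Rightarrow> 'a rel) \<Rightarrow> bool" where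
  "minimal_collection N I \<longleftrightarrow> (\<forall>k\<in>N. \<not> has_convex_copy (I k) (shuffle N I))"

definition shuffle_representation ::
    "'x rel \<Rightarrow> nat set \<Rightarrow> (nat \<Rightarrow> 'i rel) \<Rightarrow> 'l rel \<Rightarrow> 'r rel \<Rightarrow> bool" where
  "shuffle_representation X N I L R \<longleftrightarrow>
     index_set N \<and> (\<forall>k\<in>N. countable_order (I k) \<and> I k \<noteq> {}) \<and> minimal_collection N I \<and>
     countable_order L \<and> countable_order R \<and> X \<cong> L \<^bold>+ shuffle N I \<^bold>+ R"

datatype end_type = C1 | C2 | C3 | C4 | C5 | C6 | C7 | C8

text \<open>
  The clauses \<open>R \<noteq> {}\<close> in \<open>C6\<close> and \<open>L \<noteq> {}\<close> in \<open>C7\<close> keep these conditions apart from \<open>C2\<close> and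
  \<open>C3\<close>: if \<open>R\<close> is empty then \<open>R \<^bold>+ L \<cong> L\<close>, and \<open>R\<close> is isomorphic to no (non-empty) \<open>I k\<close>.
  In \<open>C4\<close>, \<open>C5\<close> and \<open>C8\<close> both \<open>L\<close> and \<open>R\<close> are automatically non-empty.
\<close>

primrec end_condition ::
    "end_type \<Rightarrow> nat set \<Rightarrow> (nat \<Rightarrow> 'i rel) \<Rightarrow> 'l rel \<Rightarrow> 'r rel \<Rightarrow> bool" where
  "end_condition C1 N I L R \<longleftrightarrow> L = {} \<and> R = {}"
| "end_condition C2 N I L R \<longleftrightarrow> (\<exists>k\<in>N. L \<cong> I k) \<and> R = {}"
| "end_condition C3 N I L R \<longleftrightarrow> (\<exists>k\<in>N. R \<cong> I k) \<and> L = {}"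
| "end_condition C4 N I L R \<longleftrightarrow>
     (\<exists>k\<^sub>1\<in>N. \<exists>k\<^sub>2\<in>N. L \<cong> I k\<^sub>1 \<and> R \<cong> I k\<^sub>2) \<and> \<not> (\<exists>k\<in>N. R \<^bold>+ L \<cong> I k)"
| "end_condition C5 N I L R \<longleftrightarrow>
     (\<exists>k\<^sub>0\<in>N. R \<^bold>+ L \<cong> I k\<^sub>0) \<and> \<not> (\<exists>k\<in>N. L \<cong> I k) \<and> \<not> (\<exists>k\<in>N. R \<cong> I k)"
| "end_condition C6 N I L R \<longleftrightarrow>
     (\<exists>k\<^sub>0\<in>N. R \<^bold>+ L \<cong> I k\<^sub>0) \<and> (\<exists>k\<^sub>1\<in>N. L \<cong> I k\<^sub>1) \<and> \<not> (\<exists>k\<in>N. R \<cong> I k) \<and> R \<noteq> {}"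
| "end_condition C7 N I L R \<longleftrightarrow>
     (\<exists>k\<^sub>0\<in>N. R \<^bold>+ L \<cong> I k\<^sub>0) \<and> (\<exists>k\<^sub>1\<in>N. R \<cong> I k\<^sub>1) \<and> \<not> (\<exists>k\<in>N. L \<cong> I k) \<and> L \<noteq> {}"
| "end_condition C8 N I L R \<longleftrightarrow>
     (\<exists>k\<^sub>0\<in>N. \<exists>k\<^sub>1\<in>N. \<exists>k\<^sub>2\<in>N. R \<^bold>+ L \<cong> I k\<^sub>0 \<and> L \<cong> I k\<^sub>1 \<and> R \<cong> I k\<^sub>2)"

definition is_left_endpoint :: "'a rel \<Rightarrow> 'a \<Rightarrow> bool" where
  "is_left_endpoint A a \<longleftrightarrow> a \<in> Field A \<and> (\<forall>b\<in>Field A. (a, b) \<in> A)"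

definition is_right_endpoint :: "'a rel \<Rightarrow> 'a \<Rightarrow> bool" where
  "is_right_endpoint A a \<longleftrightarrow> a \<in> Field A \<and> (\<forall>b\<in>Field A. (b, a) \<in> A)"

definition is_successor :: "'a rel \<Rightarrow> 'a \<Rightarrow> 'a \<Rightarrow> bool" where
  "is_successor A a b \<longleftrightarrow>
     (a, b) \<in> A \<and> a \<noteq> b \<and> (\<forall>z. (a, z) \<in> A \<and> (z, b) \<in> A \<longrightarrow> z = a \<or> z = b)"

definition has_left_endpoint :: "'a rel \<Rightarrow> bool" where
  "has_left_endpoint A \<longleftrightarrow> (\<exists>a. is_left_endpoint A a)"

definition has_right_endpoint :: "'a rel \<Rightarrow> bool" where
  "has_right_endpoint A \<longleftrightarrow> (\<exists>a. is_right_endpoint A a)"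

definition all_have_successors :: "'a rel \<Rightarrow> bool" where
  "all_have_successors A \<longleftrightarrow>
     (\<forall>a\<in>Field A. \<not> is_right_endpoint A a \<longrightarrow> (\<exists>b. is_successor A a b))"

definition all_have_predecessors :: "'a rel \<Rightarrow> bool" where
  "all_have_predecessors A \<longleftrightarrow>
     (\<forall>a\<in>Field A. \<not> is_left_endpoint A a \<longrightarrow> (\<exists>b. is_successor A b a))"

end

theory Submission
  imports Defs "HOL-Library.Product_Lexorder"
begin

text \<open>
  If \<open>A \<^bold>* X \<cong> X\<close> for some \<open>A\<close> with at least two points, then any cut of \<open>X\<close> leaves a convex copy
  of \<open>X\<close> on one side.  Hence ``no convex copy of \<open>X\<close> lies between \<open>x\<close> and \<open>y\<close>'' is an equivalence
  relation with convex classes; the classes are densely ordered, and every type of class that is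
  neither first nor last occurs between any two of them.  By back and forth, \<open>X\<close> is a shuffle of
  these classes between its first class \<open>L\<close> and its last class \<open>R\<close> (either may be missing).
  Conversely, in \<open>L \<^bold>+ shuffle N I \<^bold>+ R\<close> with \<open>I\<close> minimal, the classes defined in the same way by
  convex copies of the shuffle are exactly \<open>L\<close>, \<open>R\<close> and the blocks \<open>I k\<close>.

  In \<open>A \<^bold>* X\<close> the last class of the copy of \<open>X\<close> at \<open>a\<close> merges with the first class of the copy at \<open>b\<close>
  if \<open>b\<close> is the successor of \<open>a\<close>, and no other classes merge.  So \<open>A \<^bold>* X \<cong> X\<close> holds if and only if \<open>A\<close>
  has the endpoints that \<open>L\<close> and \<open>R\<close> require and the new inner classes, \<open>R \<^bold>+ L\<close> at successor pairs,
  \<open>L\<close> at non-first points without predecessor and \<open>R\<close> at non-last points without successor, are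
  empty or occur among the \<open>I k\<close>.
\<close>

section \<open>Isomorphism of orders\<close>

text \<open>Two choices shape the argument. Abstract relations are moved into subsets of
  \<open>rat\<close>, where convexity, cuts and intervals become inequalities and a lexicographic
  product becomes a Cartesian product. And separation is defined for an arbitrary non-empty pattern
  \<open>P\<close>, of which it is only required that it contains two convex copies of itself, one
  below the other. To find a representation, the pattern is \<open>X\<close> itself, with copies at
  two points of \<open>A\<close>; to study a given representation, it is the shuffle, with copies
  over two intervals of rationals. One theory of components serves both directions.

  The obstacle lies at the edges: a class at the end of a convex part may continue outside that
  part. Only classes with separated points on both sides are intrinsic, so types are transferred
  between a copy and its surroundings only for the middle. Minimality is what keeps blocks and ends
  from being split. A collection of components has it because the middle of \<open>X\<close>
  contains a copy of \<open>X\<close> whereas no component does.\<close>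

lemma order_isomorphicI:
  assumes "bij_betw f (Field r) (Field s)"
    and "\<And>a b. a \<in> Field r \<Longrightarrow> b \<in> Field r \<Longrightarrow> (a, b) \<in> r \<longleftrightarrow> (f a, f b) \<in> s"
  shows "r \<cong> s"
  using assms by (auto simp: order_isomorphic_def iso_iff2)

lemma order_isomorphicE:
  assumes "r \<cong> s"
  obtains f where "bij_betw f (Field r) (Field s)"
    and "\<And>a b. a \<in> Field r \<Longrightarrow> b \<in> Field r \<Longrightarrow> (a, b) \<in> r \<longleftrightarrow> (f a, f b) \<in> s"
  using assms by (auto simp: order_isomorphic_def iso_iff2)

lemma order_isomorphic_refl [simp]: "r \<cong> r"
  by (rule order_isomorphicI[of id]) auto

lemma order_isomorphic_empty [simp]: "{} \<cong> {}"
  by (rule order_isomorphicI) (auto simp: bij_betw_def)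

lemma order_isomorphic_sym:
  assumes "r \<cong> s"
  shows "s \<cong> r"
proof -
  from assms obtain f where f: "bij_betw f (Field r) (Field s)"
    "\<And>a b. a \<in> Field r \<Longrightarrow> b \<in> Field r \<Longrightarrow> (a, b) \<in> r \<longleftrightarrow> (f a, f b) \<in> s"
    by (rule order_isomorphicE) blast
  show ?thesis
  proof (rule order_isomorphicI)
    show "bij_betw (inv_into (Field r) f) (Field s) (Field r)"
      using f(1) by (rule bij_betw_inv_into)
  next
    fix a b assume "a \<in> Field s" "b \<in> Field s"
    moreover from this have "inv_into (Field r) f a \<in> Field r" "inv_into (Field r) f b \<in> Field r"
      "f (inv_into (Field r) f a) = a" "f (inv_into (Field r) f b) = b"
      using f(1) by (auto simp: bij_betw_def intro: inv_into_into f_inv_into_f)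
    ultimately show "(a, b) \<in> s \<longleftrightarrow> (inv_into (Field r) f a, inv_into (Field r) f b) \<in> r"
      using f(2) by simp
  qed
qed

lemma order_isomorphic_commute: "r \<cong> s \<longleftrightarrow> s \<cong> r"
  by (rule iffI; erule order_isomorphic_sym)

lemma order_isomorphic_trans [trans]:
  assumes "r \<cong> s" "s \<cong> t"
  shows "r \<cong> t"
proof -
  from assms(1) obtain f where f: "bij_betw f (Field r) (Field s)"
    "\<And>a b. a \<in> Field r \<Longrightarrow> b \<in> Field r \<Longrightarrow> (a, b) \<in> r \<longleftrightarrow> (f a, f b) \<in> s"
    by (rule order_isomorphicE) blast
  from assms(2) obtain g where g: "bij_betw g (Field s) (Field t)"
    "\<And>a b. a \<in> Field s \<Longrightarrow> b \<in> Field s \<Longrightarrow> (a, b) \<in> s \<longleftrightarrow> (g a, g b) \<in> t"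
    by (rule order_isomorphicE) blast
  show ?thesis
  proof (rule order_isomorphicI)
    show "bij_betw (g \<circ> f) (Field r) (Field t)" using f(1) g(1) by (rule bij_betw_trans)
  next
    fix a b assume "a \<in> Field r" "b \<in> Field r"
    then show "(a, b) \<in> r \<longleftrightarrow> ((g \<circ> f) a, (g \<circ> f) b) \<in> t"
      using f(2)[of a b] g(2)[of "f a" "f b"] bij_betwE[OF f(1)] by simp
  qed
qed

lemma order_isomorphic_cong: "r \<cong> r' \<Longrightarrow> s \<cong> s' \<Longrightarrow> r \<cong> s \<longleftrightarrow> r' \<cong> s'"
  by (meson order_isomorphic_sym order_isomorphic_trans)

lemma Field_empty_iff: "Field r = {} \<longleftrightarrow> r = {}"
  by (auto simp: Field_def)

lemma order_isomorphic_empty_iff: "r \<cong> s \<Longrightarrow> r = {} \<longleftrightarrow> s = {}"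
  by (erule order_isomorphicE) (metis Field_empty_iff bij_betw_empty1 bij_betw_empty2)

lemma Linear_orderD:
  assumes "Linear_order r"
  shows "\<And>a. a \<in> Field r \<Longrightarrow> (a, a) \<in> r"
    and "\<And>a b c. (a, b) \<in> r \<Longrightarrow> (b, c) \<in> r \<Longrightarrow> (a, c) \<in> r"
    and "\<And>a b. (a, b) \<in> r \<Longrightarrow> (b, a) \<in> r \<Longrightarrow> a = b"
    and "\<And>a b. a \<in> Field r \<Longrightarrow> b \<in> Field r \<Longrightarrow> (a, b) \<in> r \<or> (b, a) \<in> r"
  using assms unfolding order_on_defs refl_on_def trans_def antisym_def total_on_def by metis+

text \<open>All work on components is done on such relations: they are determined by their carrier,
  so a convex part is just a subset, and the ambient type may be \<open>rat\<close> or a type of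
  pairs.\<close>

definition suborder :: "'a::linorder set \<Rightarrow> 'a rel" where
  "suborder S = {(x, y). x \<in> S \<and> y \<in> S \<and> x \<le> y}"

lemma Field_suborder [simp]: "Field (suborder S) = S"
  by (auto simp: suborder_def Field_def)

lemma suborder_iff [simp]: "(x, y) \<in> suborder S \<longleftrightarrow> x \<in> S \<and> y \<in> S \<and> x \<le> y"
  by (simp add: suborder_def)

lemma suborder_empty_iff [simp]: "suborder S = {} \<longleftrightarrow> S = {}"
  by (metis Field_empty_iff Field_suborder)

lemma suborder_empty [simp]: "suborder {} = {}"
  by simp

lemma linear_order_on_suborder [simp]: "linear_order_on S (suborder S)"
  by (auto simp: order_on_defs refl_on_def trans_def antisym_def total_on_def)

lemma countable_order_suborder: "countable S \<Longrightarrow> countable_order (suborder S)"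
  by (simp add: countable_order_def)

lemma order_rat_eq: "\<^bold>Q = suborder UNIV"
  by (auto simp: order_rat_def suborder_def)

lemma suborder_image_iso: "strict_mono_on S f \<Longrightarrow> suborder S \<cong> suborder (f ` S)"
  by (rule order_isomorphicI[of f])
     (auto simp: bij_betw_def strict_mono_on_imp_inj_on strict_mono_on_leD
           dest: strict_mono_on_less_eq)

lemma suborder_isoE:
  assumes "suborder S \<cong> suborder T"
  obtains f where "strict_mono_on S f" "f ` S = T"
proof -
  from assms obtain f where f: "bij_betw f S T"
    "\<And>a b. a \<in> S \<Longrightarrow> b \<in> S \<Longrightarrow> a \<le> b \<longleftrightarrow> f a \<le> f b"
    by (rule order_isomorphicE) (auto simp: bij_betw_def)
  have "strict_mono_on S f"
    using f by (intro strict_mono_onI) (metis linorder_not_le)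
  moreover have "f ` S = T" using f by (simp add: bij_betw_def)
  ultimately show thesis by (rule that)
qed

section \<open>Back and forth\<close>

text \<open>A finite partial isomorphism given by its graph. Between linear orders the equivalence,
  read in both directions, already makes the graph single-valued and injective; and as a graph it
  can be reversed, so that going back is going forth for the converse.\<close>

definition partial_match :: "'a rel \<Rightarrow> 'b rel \<Rightarrow> ('a \<Rightarrow> 'b \<Rightarrow> bool) \<Rightarrow> ('a \<times> 'b) set \<Rightarrow> bool" where
  "partial_match r s Q F \<longleftrightarrow> finite F \<and>
     (\<forall>a b. (a, b) \<in> F \<longrightarrow> a \<in> Field r \<and> b \<in> Field s \<and> Q a b) \<and>
     (\<forall>a b a' b'. (a, b) \<in> F \<longrightarrow> (a', b') \<in> F \<longrightarrow> ((a, a') \<in> r \<longleftrightarrow> (b, b') \<in> s))"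

text \<open>Either set may be empty. One condition therefore combines density of the points with
  property \<open>Q\<close>, their occurrence beyond every point on both sides, and their
  existence.\<close>

definition fills_gaps :: "'b rel \<Rightarrow> ('b \<Rightarrow> bool) \<Rightarrow> bool" where
  "fills_gaps s Q \<longleftrightarrow>
     (\<forall>U V. finite U \<and> finite V \<and> U \<subseteq> Field s \<and> V \<subseteq> Field s \<and>
        (\<forall>u\<in>U. \<forall>v\<in>V. (u, v) \<in> s \<and> u \<noteq> v) \<longrightarrow>
        (\<exists>b\<in>Field s. Q b \<and> (\<forall>u\<in>U. (u, b) \<in> s \<and> u \<noteq> b) \<and> (\<forall>v\<in>V. (b, v) \<in> s \<and> b \<noteq> v)))"

lemma partial_match_extend:
  assumes r: "Linear_order r" and s: "Linear_order s" and F: "partial_match r s Q F"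
    and a: "a \<in> Field r" and gap: "fills_gaps s (Q a)"
  shows "\<exists>b. partial_match r s Q (insert (a, b) F)"
proof (cases "\<exists>b. (a, b) \<in> F")
  case True
  then show ?thesis using F by (metis insert_absorb)
next
  case False
  have F1: "finite F" and F2: "\<And>x y. (x, y) \<in> F \<Longrightarrow> x \<in> Field r \<and> y \<in> Field s \<and> Q x y"
    and F3: "\<And>x y x' y'. (x, y) \<in> F \<Longrightarrow> (x', y') \<in> F \<Longrightarrow> (x, x') \<in> r \<longleftrightarrow> (y, y') \<in> s"
    using F by (auto simp: partial_match_def)
  \<comment> \<open>The images of the matched points below and above \<open>a\<close>. Since
    \<open>a\<close> itself is unmatched, no point is counted on both sides.\<close>
  define U where "U = {y. \<exists>x. (x, y) \<in> F \<and> (x, a) \<in> r}"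
  define V where "V = {y. \<exists>x. (x, y) \<in> F \<and> (a, x) \<in> r}"
  have UV: "U \<subseteq> snd ` F" "V \<subseteq> snd ` F" by (force simp: U_def V_def)+
  have "(u, v) \<in> s \<and> u \<noteq> v" if "u \<in> U" "v \<in> V" for u v
  proof -
    obtain x y where x: "(x, u) \<in> F" "(x, a) \<in> r" and y: "(y, v) \<in> F" "(a, y) \<in> r"
      using \<open>u \<in> U\<close> \<open>v \<in> V\<close> by (auto simp: U_def V_def)
    have "x \<noteq> a" using x False by blast
    have "(x, y) \<in> r" using x y Linear_orderD(2)[OF r] by blast
    moreover have "(y, x) \<notin> r"
      using \<open>x \<noteq> a\<close> x y Linear_orderD(2,3)[OF r] by metis
    ultimately show ?thesis using F3[OF x(1) y(1)] F3[OF y(1) x(1)] by blast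
  qed
  moreover have "finite U" "finite V"
    using finite_subset[OF UV(1)] finite_subset[OF UV(2)] F1 by simp_all
  moreover have "U \<subseteq> Field s" "V \<subseteq> Field s"
    using F2 unfolding U_def V_def by blast+
  ultimately have "\<exists>b\<in>Field s. Q a b \<and> (\<forall>u\<in>U. (u, b) \<in> s \<and> u \<noteq> b) \<and> (\<forall>v\<in>V. (b, v) \<in> s \<and> b \<noteq> v)"
    by (intro gap[unfolded fills_gaps_def, rule_format] conjI ballI) simp_all
  then obtain b where b: "b \<in> Field s" "Q a b"
    and bU: "\<And>u. u \<in> U \<Longrightarrow> (u, b) \<in> s \<and> u \<noteq> b" and bV: "\<And>v. v \<in> V \<Longrightarrow> (b, v) \<in> s \<and> b \<noteq> v"
    by (elim bexE conjE) simp
  have new: "((x, a) \<in> r \<longleftrightarrow> (y, b) \<in> s) \<and> ((a, x) \<in> r \<longleftrightarrow> (b, y) \<in> s)" if xy: "(x, y) \<in> F" for x y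
  proof -
    have "x \<noteq> a" using False xy by blast
    show ?thesis
    proof (cases "(x, a) \<in> r")
      case True
      then have "y \<in> U" using xy by (auto simp: U_def)
      then have "(y, b) \<in> s" "(b, y) \<notin> s" using bU Linear_orderD(3)[OF s, of y b] by auto
      moreover have "(a, x) \<notin> r" using True \<open>x \<noteq> a\<close> Linear_orderD(3)[OF r, of x a] by blast
      ultimately show ?thesis using True by simp
    next
      case False
      then have ax: "(a, x) \<in> r" using Linear_orderD(4)[OF r, of x a] F2[OF xy] a by blast
      then have "y \<in> V" using xy by (auto simp: V_def)
      then have "(b, y) \<in> s" "(y, b) \<notin> s" using bV Linear_orderD(3)[OF s, of y b] by auto
      then show ?thesis using False ax by simp
    qed
  qed
  have refl: "(a, a) \<in> r" "(b, b) \<in> s"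
    using a b Linear_orderD(1)[OF r] Linear_orderD(1)[OF s] by simp_all
  have "(x, x') \<in> r \<longleftrightarrow> (y, y') \<in> s"
    if "(x, y) \<in> insert (a, b) F" "(x', y') \<in> insert (a, b) F" for x y x' y'
    using that new[of x y] new[of x' y'] refl F3[of x y x' y'] by blast
  then have "partial_match r s Q (insert (a, b) F)"
    using F1 F2 a b(1,2) unfolding partial_match_def by (intro conjI) simp_all
  then show ?thesis ..
qed

lemma partial_match_converse:
  "partial_match r s Q F \<longleftrightarrow> partial_match s r (\<lambda>b a. Q a b) (F\<inverse>)"
  by (simp add: partial_match_def) blast

text \<open>The bookkeeping shared by forth and back-and-forth arguments: an enumeration of
  \<open>T\<close> visits every task, and task \<open>n\<close> is settled in passing from stage
  \<open>n\<close> to stage \<open>n + 1\<close>.\<close>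

lemma chain_of_tasks:
  assumes "\<Phi> {}" and "countable T"
    and step: "\<And>F t. \<Phi> F \<Longrightarrow> t \<in> T \<Longrightarrow> \<exists>F'. \<Phi> F' \<and> F \<subseteq> F' \<and> ok t F'"
  shows "\<exists>F :: nat \<Rightarrow> 's set. incseq F \<and> (\<forall>n. \<Phi> (F n)) \<and> (\<forall>t\<in>T. \<exists>n. ok t (F n))"
proof (cases "T = {}")
  case True
  then show ?thesis using assms(1) by (intro exI[of _ "\<lambda>_. {}"]) (auto simp: incseq_def)
next
  case False
  have "\<exists>F. \<forall>n. \<Phi> (F n) \<and> (F n \<subseteq> F (Suc n) \<and> ok (from_nat_into T n) (F (Suc n)))"
    using assms(1) step from_nat_into[OF False] by (intro dependent_nat_choice) blast+
  then obtain F where F: "\<And>n. \<Phi> (F n)" "\<And>n. F n \<subseteq> F (Suc n)"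
    "\<And>n. ok (from_nat_into T n) (F (Suc n))"
    by blast
  have "\<exists>n. ok t (F n)" if "t \<in> T" for t
    using F(3) from_nat_into_to_nat_on[OF assms(2) that] by metis
  then show ?thesis using F incseq_SucI by blast
qed

lemma partial_match_incseq:
  assumes "incseq F" "\<And>n. partial_match r s Q (F n)" "(a, b) \<in> \<Union>(range F)" "(a', b') \<in> \<Union>(range F)"
  shows "((a, a') \<in> r \<longleftrightarrow> (b, b') \<in> s) \<and> a \<in> Field r \<and> b \<in> Field s \<and> Q a b"
proof -
  obtain m n where "(a, b) \<in> F m" "(a', b') \<in> F n" using assms by auto
  then have "(a, b) \<in> F (max m n)" "(a', b') \<in> F (max m n)"
    using assms(1) by (meson incseqD max.cobounded1 max.cobounded2 subsetD)+
  then show ?thesis using assms(2)[of "max m n"] by (auto simp: partial_match_def)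
qed

text \<open>Cantor's embedding argument, the forth half alone: only the points of \<open>r\<close>
  are tasks.\<close>

lemma countable_embedding:
  assumes r: "Linear_order r" and s: "Linear_order s" and "countable (Field r)"
    and gap: "fills_gaps s (\<lambda>_. True)"
  shows "\<exists>f. f ` Field r \<subseteq> Field s \<and> (\<forall>a\<in>Field r. \<forall>b\<in>Field r. (a, b) \<in> r \<longleftrightarrow> (f a, f b) \<in> s)"
proof -
  have "\<exists>F. incseq F \<and> (\<forall>n. partial_match r s (\<lambda>_ _. True) (F n)) \<and> (\<forall>a\<in>Field r. \<exists>n. \<exists>b. (a, b) \<in> F n)"
  proof (rule chain_of_tasks)
    show "partial_match r s (\<lambda>_ _. True) {}" by (simp add: partial_match_def)
    show "countable (Field r)" by fact
  next
    fix F a assume "partial_match r s (\<lambda>_ _. True) F" "a \<in> Field r"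
    then obtain b where "partial_match r s (\<lambda>_ _. True) (insert (a, b) F)"
      using partial_match_extend[OF r s _ _ gap] by meson
    then show "\<exists>F'. partial_match r s (\<lambda>_ _. True) F' \<and> F \<subseteq> F' \<and> (\<exists>b. (a, b) \<in> F')" by blast
  qed
  then obtain F where F: "incseq F" "\<And>n. partial_match r s (\<lambda>_ _. True) (F n)"
    and G: "\<forall>a\<in>Field r. \<exists>n b. (a, b) \<in> F n"
    by (elim exE conjE) simp
  from G have "\<forall>a\<in>Field r. \<exists>b. (a, b) \<in> \<Union>(range F)" by blast
  from bchoice[OF this] obtain f where f: "\<And>a. a \<in> Field r \<Longrightarrow> (a, f a) \<in> \<Union>(range F)" by blast
  have "((a, b) \<in> r \<longleftrightarrow> (f a, f b) \<in> s) \<and> f a \<in> Field s"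
    if "a \<in> Field r" "b \<in> Field r" for a b
    using partial_match_incseq[OF F f[OF that(1)] f[OF that(2)]] by simp
  then show ?thesis by (intro exI[of _ f]) blast
qed

text \<open>The relation \<open>Q\<close> carries the types: in the applications to shuffles it says
  that two blocks are isomorphic or that two rationals have the same colour. Tasks from
  \<open>Field s\<close> are settled by the same extension step, applied to the converse of the
  match.\<close>

lemma back_and_forth:
  fixes r :: "'a rel" and s :: "'b rel"
  assumes r: "Linear_order r" and s: "Linear_order s"
    and "countable (Field r)" "countable (Field s)"
    and gap: "\<And>a. a \<in> Field r \<Longrightarrow> fills_gaps s (Q a)"
    and gap': "\<And>b. b \<in> Field s \<Longrightarrow> fills_gaps r (\<lambda>a. Q a b)"
  shows "\<exists>f. bij_betw f (Field r) (Field s) \<and>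
    (\<forall>a\<in>Field r. \<forall>b\<in>Field r. (a, b) \<in> r \<longleftrightarrow> (f a, f b) \<in> s) \<and> (\<forall>a\<in>Field r. Q a (f a))"
proof -
  define ok where "ok = (\<lambda>(t :: 'a + 'b) (F :: ('a \<times> 'b) set). case t of Inl a \<Rightarrow> \<exists>b. (a, b) \<in> F | Inr b \<Rightarrow> \<exists>a. (a, b) \<in> F)"
  have "\<exists>F. incseq F \<and> (\<forall>n. partial_match r s Q (F n)) \<and>
      (\<forall>t\<in>Field r <+> Field s. \<exists>n. ok t (F n))"
  proof (rule chain_of_tasks)
    show "partial_match r s Q {}" by (simp add: partial_match_def)
    show "countable (Field r <+> Field s)" using assms by simp
  next
    fix F t assume F: "partial_match r s Q F" and t: "t \<in> Field r <+> Field s"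
    from t show "\<exists>F'. partial_match r s Q F' \<and> F \<subseteq> F' \<and> ok t F'"
    proof
      fix a assume "t = Inl a" "a \<in> Field r"
      moreover from this obtain b where "partial_match r s Q (insert (a, b) F)"
        using partial_match_extend[OF r s F] gap by meson
      ultimately show ?thesis by (intro exI[of _ "insert (a, b) F"]) (auto simp: ok_def)
    next
      fix b assume "t = Inr b" "b \<in> Field s"
      moreover from this obtain a where
        "partial_match s r (\<lambda>b a. Q a b) (insert (b, a) (F\<inverse>))"
        using partial_match_extend[OF s r] gap' F partial_match_converse by metis
      moreover have "insert (b, a) (F\<inverse>) = (insert (a, b) F)\<inverse>" by auto
      ultimately show ?thesis
        by (intro exI[of _ "insert (a, b) F"]) (auto simp: ok_def partial_match_converse[of r])
    qed
  qed
  then obtain F where F: "incseq F" "\<And>n. partial_match r s Q (F n)"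
    and ok: "\<And>t. t \<in> Field r <+> Field s \<Longrightarrow> \<exists>n. ok t (F n)"
    by (elim exE conjE) simp
  note G = partial_match_incseq[OF F]
  have "\<exists>b. (a, b) \<in> \<Union>(range F)" if "a \<in> Field r" for a
    using ok[of "Inl a"] that by (simp add: ok_def) blast
  then have "\<forall>a\<in>Field r. \<exists>b. (a, b) \<in> \<Union>(range F)" by blast
  from bchoice[OF this] obtain f where f: "\<And>a. a \<in> Field r \<Longrightarrow> (a, f a) \<in> \<Union>(range F)" by blast
  have ord: "((a, b) \<in> r \<longleftrightarrow> (f a, f b) \<in> s) \<and> f a \<in> Field s \<and> Q a (f a)"
    if "a \<in> Field r" "b \<in> Field r" for a b
    using G[OF f[OF that(1)] f[OF that(2)]] by simp
  have "inj_on f (Field r)"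
    using ord by (intro inj_onI) (metis Linear_orderD(1,3)[OF r])
  moreover have "b \<in> f ` Field r" if b: "b \<in> Field s" for b
  proof -
    obtain a where a: "(a, b) \<in> \<Union>(range F)"
      using ok[of "Inr b"] b by (simp add: ok_def) blast
    then have ar: "a \<in> Field r" using G[OF a a] by simp
    have "(b, f a) \<in> s \<and> (f a, b) \<in> s"
      using G[OF a f[OF ar]] G[OF f[OF ar] a] Linear_orderD(1)[OF r ar] by simp
    then have "b = f a" using Linear_orderD(3)[OF s] by blast
    with ar show ?thesis by blast
  qed
  ultimately have "bij_betw f (Field r) (Field s)"
    using ord unfolding bij_betw_def by blast
  then show ?thesis using ord by blast
qed

section \<open>Sums, replacements and shuffles\<close>

text \<open>Only the largest point of \<open>U\<close> and the smallest point of \<open>V\<close>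
  matter. A missing one is replaced by a point from \<open>up\<close> or \<open>down\<close>; that
  point may lack property \<open>Q\<close>, as density then finds one with \<open>Q\<close>
  inside.\<close>

lemma fills_gaps_suborder:
  fixes B :: "'a::linorder set"
  assumes dense: "\<And>x y. x \<in> B \<Longrightarrow> y \<in> B \<Longrightarrow> x < y \<Longrightarrow> \<exists>z\<in>B. Q z \<and> x < z \<and> z < y"
    and up: "\<And>x. x \<in> B \<Longrightarrow> \<exists>y\<in>B. x < y" and down: "\<And>x. x \<in> B \<Longrightarrow> \<exists>y\<in>B. y < x"
    and "B \<noteq> {}"
  shows "fills_gaps (suborder B) Q"
  unfolding fills_gaps_def
proof (intro allI impI)
  fix U V
  assume "finite U \<and> finite V \<and> U \<subseteq> Field (suborder B) \<and> V \<subseteq> Field (suborder B) \<and>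
    (\<forall>u\<in>U. \<forall>v\<in>V. (u, v) \<in> suborder B \<and> u \<noteq> v)"
  then have fin: "finite U" "finite V" and sub: "U \<subseteq> B" "V \<subseteq> B"
    and UV: "\<And>u v. u \<in> U \<Longrightarrow> v \<in> V \<Longrightarrow> u < v"
    by (simp_all add: order.strict_iff_order)
  obtain b0 where b0: "b0 \<in> B" using \<open>B \<noteq> {}\<close> by blast
  have "\<exists>x y. x \<in> B \<and> y \<in> B \<and> x < y \<and> (\<forall>u\<in>U. u \<le> x) \<and> (\<forall>v\<in>V. y \<le> v)"
  proof (cases "V = {}")
    case True
    define x where "x = (if U = {} then b0 else Max U)"
    have "x \<in> B" "\<forall>u\<in>U. u \<le> x" using b0 fin sub Max_in[of U] by (auto simp: x_def subsetD)
    moreover from this obtain y where "y \<in> B" "x < y" using up by blast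
    ultimately show ?thesis using True by blast
  next
    case False
    then have y: "Min V \<in> V" "\<forall>v\<in>V. Min V \<le> v" using fin by auto
    show ?thesis
    proof (cases "U = {}")
      case True
      then show ?thesis using y down[of "Min V"] sub by blast
    next
      case False
      then have "Max U \<in> U" "\<forall>u\<in>U. u \<le> Max U" using fin by auto
      then show ?thesis using y UV sub by blast
    qed
  qed
  then obtain x y where xy: "x \<in> B" "y \<in> B" "x < y" "\<And>u. u \<in> U \<Longrightarrow> u \<le> x" "\<And>v. v \<in> V \<Longrightarrow> y \<le> v"
    by blast
  obtain z where z: "z \<in> B" "Q z" "x < z" "z < y" using dense[OF xy(1-3)] by blast
  have "\<forall>u\<in>U. (u, z) \<in> suborder B \<and> u \<noteq> z" "\<forall>v\<in>V. (z, v) \<in> suborder B \<and> z \<noteq> v"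
    using xy(4,5) z sub by fastforce+
  then show "\<exists>b\<in>Field (suborder B). Q b \<and> (\<forall>u\<in>U. (u, b) \<in> suborder B \<and> u \<noteq> b) \<and>
      (\<forall>v\<in>V. (b, v) \<in> suborder B \<and> b \<noteq> v)"
    using z by auto
qed

text \<open>The entrance from abstract countable orders to sets of rationals, by Cantor's
  embedding.\<close>

lemma countable_order_rat_copy:
  assumes "countable_order X"
  obtains S :: "rat set" where "X \<cong> suborder S"
proof -
  have "fills_gaps (suborder (UNIV :: rat set)) (\<lambda>_. True)"
    by (rule fills_gaps_suborder) (auto intro: dense gt_ex lt_ex)
  then obtain f :: "_ \<Rightarrow> rat" where
    f: "\<And>a b. a \<in> Field X \<Longrightarrow> b \<in> Field X \<Longrightarrow> (a, b) \<in> X \<longleftrightarrow> f a \<le> f b"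
    using countable_embedding[of X "suborder (UNIV :: rat set)"] assms
    by (auto simp: countable_order_def)
  have X: "Linear_order X" using assms by (simp add: countable_order_def)
  have "X \<cong> suborder (f ` Field X)"
  proof (rule order_isomorphicI)
    have "inj_on f (Field X)"
      using f Linear_orderD(1,3)[OF X] by (intro inj_onI) (metis order_refl)
    then show "bij_betw f (Field X) (Field (suborder (f ` Field X)))"
      by (simp add: bij_betw_def)
  qed (use f in auto)
  then show thesis by (rule that)
qed

text \<open>The representation to be found has its blocks and ends on \<open>nat\<close>, so
  components living in \<open>rat\<close> are copied there.\<close>

lemma countable_order_nat_copy:
  assumes "countable_order r"
  obtains s :: "nat rel" where "countable_order s" "s \<cong> r"
proof -
  have r: "Linear_order r" and "countable (Field r)" using assms by (auto simp: countable_order_def)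
  define f where "f = to_nat_on (Field r)"
  have inj: "inj_on f (Field r)" unfolding f_def by (rule inj_on_to_nat_on) fact
  have "r \<cong> dir_image r f"
  proof (rule order_isomorphicI)
    show "bij_betw f (Field r) (Field (dir_image r f))"
      using inj by (simp add: bij_betw_def dir_image_Field)
  next
    fix a b assume ab: "a \<in> Field r" "b \<in> Field r"
    show "(a, b) \<in> r \<longleftrightarrow> (f a, f b) \<in> dir_image r f"
    proof
      assume "(f a, f b) \<in> dir_image r f"
      then obtain c d where "(c, d) \<in> r" "f a = f c" "f b = f d" by (auto simp: dir_image_def)
      moreover from this have "c \<in> Field r" "d \<in> Field r" by (auto simp: Field_def)
      ultimately show "(a, b) \<in> r" using ab inj by (metis inj_onD)
    qed (auto simp: dir_image_def)
  qed
  moreover have "countable_order (dir_image r f)"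
    using Linear_order_dir_image[OF r inj] by (simp add: countable_order_def)
  ultimately show thesis using that order_isomorphic_sym by blast
qed

section \<open>Replacing points and lexicographic products\<close>

lemma Field_replace_points:
  assumes "\<And>i. i \<in> Field r \<Longrightarrow> Linear_order (J i)"
  shows "Field (replace_points r J) = (SIGMA i:Field r. Field (J i))"
proof (intro equalityI subsetI)
  fix p assume "p \<in> (SIGMA i:Field r. Field (J i))"
  then have "(p, p) \<in> replace_points r J"
    using assms Linear_orderD(1) by (fastforce simp: replace_points_def)
  then show "p \<in> Field (replace_points r J)" by (auto simp: Field_def)
qed (auto simp: Field_def replace_points_def)

lemma replace_points_cong:
  assumes h: "bij_betw h (Field r) (Field s)"
    and ord: "\<And>a b. a \<in> Field r \<Longrightarrow> b \<in> Field r \<Longrightarrow> (a, b) \<in> r \<longleftrightarrow> (h a, h b) \<in> s"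
    and J: "\<And>i. i \<in> Field r \<Longrightarrow> Linear_order (J i)" and K: "\<And>i. i \<in> Field s \<Longrightarrow> Linear_order (K i)"
    and iso: "\<And>i. i \<in> Field r \<Longrightarrow> J i \<cong> K (h i)"
  shows "replace_points r J \<cong> replace_points s K"
proof -
  have "\<forall>i\<in>Field r. \<exists>g. bij_betw g (Field (J i)) (Field (K (h i))) \<and>
      (\<forall>x\<in>Field (J i). \<forall>y\<in>Field (J i). (x, y) \<in> J i \<longleftrightarrow> (g x, g y) \<in> K (h i))"
    using iso by (simp add: order_isomorphic_def iso_iff2)
  from bchoice[OF this] obtain g where
    g: "\<And>i. i \<in> Field r \<Longrightarrow> bij_betw (g i) (Field (J i)) (Field (K (h i)))"
    and g_ord: "\<And>i x y. i \<in> Field r \<Longrightarrow> x \<in> Field (J i) \<Longrightarrow> y \<in> Field (J i) \<Longrightarrow>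
      (x, y) \<in> J i \<longleftrightarrow> (g i x, g i y) \<in> K (h i)"
    by blast
  define f where "f = (\<lambda>(i, x). (h i, g i x))"
  have h_eq: "h i = h j \<longleftrightarrow> i = j" if "i \<in> Field r" "j \<in> Field r" for i j
    using h that by (auto simp: bij_betw_def inj_on_def)
  have hF: "h i \<in> Field s" if "i \<in> Field r" for i using h that by (rule bij_betwE[rule_format])
  have gF: "g i x \<in> Field (K (h i))" if "i \<in> Field r" "x \<in> Field (J i)" for i x
    using g that by (blast dest: bij_betwE)
  have g_eq: "g i x = g i y \<longleftrightarrow> x = y" if "i \<in> Field r" "x \<in> Field (J i)" "y \<in> Field (J i)" for i x y
    using g that by (auto simp: bij_betw_def inj_on_def)
  show ?thesis
  proof (rule order_isomorphicI)
    have "inj_on f (SIGMA i:Field r. Field (J i))"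
      by (rule inj_onI) (auto simp: f_def h_eq g_eq)
    moreover have "f ` (SIGMA i:Field r. Field (J i)) = (SIGMA i:Field s. Field (K i))"
    proof (intro equalityI subsetI)
      fix p assume "p \<in> (SIGMA i:Field s. Field (K i))"
      then obtain j y where p: "p = (j, y)" "j \<in> Field s" "y \<in> Field (K j)" by blast
      moreover obtain i where i: "i \<in> Field r" "j = h i" using h p by (auto simp: bij_betw_def)
      moreover obtain x where "x \<in> Field (J i)" "y = g i x"
        using g[of i] p i by (auto simp: bij_betw_def)
      ultimately show "p \<in> f ` (SIGMA i:Field r. Field (J i))"
        by (intro image_eqI[of _ _ "(i, x)"]) (auto simp: f_def)
    qed (auto simp: f_def hF gF)
    ultimately show "bij_betw f (Field (replace_points r J)) (Field (replace_points s K))"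
      by (simp add: bij_betw_def Field_replace_points J K)
  next
    fix p q assume "p \<in> Field (replace_points r J)" "q \<in> Field (replace_points r J)"
    then obtain i x j y where pq: "p = (i, x)" "q = (j, y)" and i: "i \<in> Field r" "x \<in> Field (J i)"
      and j: "j \<in> Field r" "y \<in> Field (J j)"
      by (auto simp: Field_replace_points J)
    show "(p, q) \<in> replace_points r J \<longleftrightarrow> (f p, f q) \<in> replace_points s K"
    proof (cases "i = j")
      case True
      then show ?thesis
        using i j g_ord[of i x y] hF gF by (simp add: pq f_def replace_points_def)
    next
      case False
      then show ?thesis
        using i j ord[of i j] hF gF h_eq[of i j] by (simp add: pq f_def replace_points_def)
    qed
  qed
qed

text \<open>The blocks already lie in the right order inside one type, so forgetting the index, by
  \<open>snd\<close>, loses nothing.\<close>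

lemma replace_points_suborder:
  assumes r: "Linear_order r"
    and D: "\<And>i j x y. i \<noteq> j \<Longrightarrow> (i, j) \<in> r \<Longrightarrow> x \<in> D i \<Longrightarrow> y \<in> D j \<Longrightarrow> x < y"
  shows "replace_points r (\<lambda>i. suborder (D i)) \<cong> suborder (\<Union>i\<in>Field r. D i)"
proof (rule order_isomorphicI)
  have cmp: "i = j \<or> x < y \<and> (i, j) \<in> r \<or> y < x \<and> (j, i) \<in> r"
    if "i \<in> Field r" "j \<in> Field r" "x \<in> D i" "y \<in> D j" for i j x y
    using that D[of i j x y] D[of j i y x] Linear_orderD(4)[OF r] by blast
  have F: "Field (replace_points r (\<lambda>i. suborder (D i))) = (SIGMA i:Field r. D i)"
    by (simp add: Field_replace_points)
  have "inj_on snd (SIGMA i:Field r. D i)"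
    by (rule inj_onI) (use cmp in fastforce)
  moreover have "snd ` (SIGMA i:Field r. D i) = (\<Union>i\<in>Field r. D i)" by force
  ultimately show "bij_betw snd (Field (replace_points r (\<lambda>i. suborder (D i))))
      (Field (suborder (\<Union>i\<in>Field r. D i)))"
    unfolding F by (simp add: bij_betw_def)
  fix p q assume "p \<in> Field (replace_points r (\<lambda>i. suborder (D i)))"
    "q \<in> Field (replace_points r (\<lambda>i. suborder (D i)))"
  then obtain i x j y where pq: "p = (i, x)" "q = (j, y)" and i: "i \<in> Field r" "x \<in> D i"
      and j: "j \<in> Field r" "y \<in> D j"
    unfolding F by auto
  have "i = j \<or> ((i, j) \<in> r \<longleftrightarrow> x \<le> y)"
    using cmp[OF i(1) j(1) i(2) j(2)] D[of i j x y] D[of j i y x] i j by fastforce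
  then show "(p, q) \<in> replace_points r (\<lambda>i. suborder (D i)) \<longleftrightarrow>
      (snd p, snd q) \<in> suborder (\<Union>i\<in>Field r. D i)"
    using i j by (auto simp: pq replace_points_def)
qed

text \<open>An equality and not merely an isomorphism, because pairs are ordered lexicographically
  here. Components of a product can thus be computed with intervals of pairs.\<close>

lemma lex_product_suborder: "suborder A \<^bold>* suborder S = suborder (A \<times> S)"
  by (auto simp: lex_product_def replace_points_def)

lemma lex_product_cong:
  assumes "A \<cong> B" "X \<cong> Y" "Linear_order X" "Linear_order Y"
  shows "A \<^bold>* X \<cong> B \<^bold>* Y"
  using assms(1) unfolding lex_product_def
  by (rule order_isomorphicE) (rule replace_points_cong; use assms in simp)

section \<open>Ordered sums\<close>

lemma order_sum_iff [simp]:
  "(Inl a, Inl b) \<in> r \<^bold>+ s \<longleftrightarrow> (a, b) \<in> r"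
  "(Inr c, Inr d) \<in> r \<^bold>+ s \<longleftrightarrow> (c, d) \<in> s"
  "(Inl a, Inr d) \<in> r \<^bold>+ s \<longleftrightarrow> a \<in> Field r \<and> d \<in> Field s"
  "(Inr c, Inl b) \<notin> r \<^bold>+ s"
  by (auto simp: order_sum_def)

lemma Field_order_sum: "Field (r \<^bold>+ s) = Inl ` Field r \<union> Inr ` Field s"
proof (intro equalityI subsetI)
  fix p assume "p \<in> Inl ` Field r \<union> Inr ` Field s"
  then obtain q where "(p, q) \<in> r \<^bold>+ s \<or> (q, p) \<in> r \<^bold>+ s"
    by (auto simp: Field_def) (meson order_sum_iff)+
  then show "p \<in> Field (r \<^bold>+ s)" by (auto simp: Field_def)
qed (auto simp: order_sum_def Field_def)

lemma order_sum_cong: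
  assumes "r \<cong> r'" "s \<cong> s'"
  shows "r \<^bold>+ s \<cong> r' \<^bold>+ s'"
proof -
  from assms(1) obtain f where f: "bij_betw f (Field r) (Field r')"
    "\<And>a b. a \<in> Field r \<Longrightarrow> b \<in> Field r \<Longrightarrow> (a, b) \<in> r \<longleftrightarrow> (f a, f b) \<in> r'"
    by (rule order_isomorphicE) blast
  from assms(2) obtain g where g: "bij_betw g (Field s) (Field s')"
    "\<And>a b. a \<in> Field s \<Longrightarrow> b \<in> Field s \<Longrightarrow> (a, b) \<in> s \<longleftrightarrow> (g a, g b) \<in> s'"
    by (rule order_isomorphicE) blast
  show ?thesis
  proof (rule order_isomorphicI)
    have "inj_on f (Field r)" "inj_on g (Field s)" using f(1) g(1) by (simp_all add: bij_betw_def)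
    then have "inj_on (map_sum f g) (Inl ` Field r \<union> Inr ` Field s)"
      by (intro inj_onI) (elim UnE imageE; simp add: inj_on_eq_iff)
    moreover have "map_sum f g ` (Inl ` Field r \<union> Inr ` Field s) = Inl ` Field r' \<union> Inr ` Field s'"
      using f(1) g(1) by (auto simp: bij_betw_def image_Un image_image)
    ultimately show "bij_betw (map_sum f g) (Field (r \<^bold>+ s)) (Field (r' \<^bold>+ s'))"
      by (simp add: bij_betw_def Field_order_sum)
  next
    fix p q assume "p \<in> Field (r \<^bold>+ s)" "q \<in> Field (r \<^bold>+ s)"
    then show "(p, q) \<in> r \<^bold>+ s \<longleftrightarrow> (map_sum f g p, map_sum f g q) \<in> r' \<^bold>+ s'"
      using f(2) g(2) bij_betwE[OF f(1)] bij_betwE[OF g(1)] by (auto simp: Field_order_sum)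
  qed
qed

lemma suborder_Un_iso:
  assumes "\<And>x y. x \<in> S \<Longrightarrow> y \<in> T \<Longrightarrow> x < y"
  shows "suborder S \<^bold>+ suborder T \<cong> suborder (S \<union> T)"
proof (rule order_isomorphicI)
  have "inj_on (case_sum id id) (Inl ` S \<union> Inr ` T)"
    using assms by (fastforce simp: inj_on_def)
  then show "bij_betw (case_sum id id) (Field (suborder S \<^bold>+ suborder T)) (Field (suborder (S \<union> T)))"
    by (simp add: bij_betw_def Field_order_sum image_Un image_image)
next
  fix p q assume "p \<in> Field (suborder S \<^bold>+ suborder T)" "q \<in> Field (suborder S \<^bold>+ suborder T)"
  then show "(p, q) \<in> suborder S \<^bold>+ suborder T \<longleftrightarrow>
      (case_sum id id p, case_sum id id q) \<in> suborder (S \<union> T)"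
    using assms by (fastforce simp: Field_order_sum)
qed

lemma suborder_iso_order_sumE:
  assumes "r \<^bold>+ s \<cong> suborder S"
  obtains S1 S2 where "S = S1 \<union> S2" "\<And>x y. x \<in> S1 \<Longrightarrow> y \<in> S2 \<Longrightarrow> x < y"
    "r \<cong> suborder S1" "s \<cong> suborder S2"
proof -
  from assms obtain f where f: "bij_betw f (Field (r \<^bold>+ s)) S"
    and ord: "\<And>p q. p \<in> Field (r \<^bold>+ s) \<Longrightarrow> q \<in> Field (r \<^bold>+ s) \<Longrightarrow>
      (p, q) \<in> r \<^bold>+ s \<longleftrightarrow> (f p, f q) \<in> suborder S"
    by (rule order_isomorphicE) (simp only: Field_suborder)
  have inj: "inj_on f (Inl ` Field r \<union> Inr ` Field s)" and img: "f ` (Inl ` Field r \<union> Inr ` Field s) = S"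
    using f by (simp_all add: bij_betw_def Field_order_sum)
  show thesis
  proof
    show "S = (\<lambda>x. f (Inl x)) ` Field r \<union> (\<lambda>x. f (Inr x)) ` Field s"
      using img by (simp add: image_Un image_image)
  next
    fix x y assume "x \<in> (\<lambda>x. f (Inl x)) ` Field r" "y \<in> (\<lambda>x. f (Inr x)) ` Field s"
    then obtain a b where ab: "a \<in> Field r" "b \<in> Field s" "x = f (Inl a)" "y = f (Inr b)" by blast
    have "(f (Inr b), f (Inl a)) \<notin> suborder S" using ord[of "Inr b" "Inl a"] ab
      by (simp add: Field_order_sum)
    moreover have "f (Inr b) \<in> S" "f (Inl a) \<in> S" using ab img by auto
    ultimately show "x < y" using ab by simp
  next
    show "r \<cong> suborder ((\<lambda>x. f (Inl x)) ` Field r)"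
    proof (rule order_isomorphicI)
      show "bij_betw (\<lambda>x. f (Inl x)) (Field r) (Field (suborder ((\<lambda>x. f (Inl x)) ` Field r)))"
        using inj by (auto simp: bij_betw_def inj_on_def)
    next
      fix a b assume "a \<in> Field r" "b \<in> Field r"
      then show "(a, b) \<in> r \<longleftrightarrow> (f (Inl a), f (Inl b)) \<in> suborder ((\<lambda>x. f (Inl x)) ` Field r)"
        using ord[of "Inl a" "Inl b"] img by (auto simp: Field_order_sum)
    qed
  next
    show "s \<cong> suborder ((\<lambda>x. f (Inr x)) ` Field s)"
    proof (rule order_isomorphicI)
      show "bij_betw (\<lambda>x. f (Inr x)) (Field s) (Field (suborder ((\<lambda>x. f (Inr x)) ` Field s)))"
        using inj by (auto simp: bij_betw_def inj_on_def)
    next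
      fix a b assume "a \<in> Field s" "b \<in> Field s"
      then show "(a, b) \<in> s \<longleftrightarrow> (f (Inr a), f (Inr b)) \<in> suborder ((\<lambda>x. f (Inr x)) ` Field s)"
        using ord[of "Inr a" "Inr b"] img by (auto simp: Field_order_sum)
    qed
  qed
qed

lemma order_sum_empty_left: "{} \<^bold>+ r \<cong> r"
  by (rule order_isomorphic_sym, rule order_isomorphicI[of Inr]) (auto simp: Field_order_sum bij_betw_def)

lemma order_sum_empty_right: "r \<^bold>+ {} \<cong> r"
  by (rule order_isomorphic_sym, rule order_isomorphicI[of Inl]) (auto simp: Field_order_sum bij_betw_def)

text \<open>The second statement is the source of the self-similarity of shuffles: over an open
  interval the colouring looks as it does over all rationals.\<close>

lemma dense_partition_fills_gaps:
  assumes "dense_partition N c" "k \<in> N"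
  shows "fills_gaps (suborder UNIV) (\<lambda>q. c q = k)"
    and "p < q \<Longrightarrow> fills_gaps (suborder {p<..<q}) (\<lambda>q. c q = k)"
proof -
  have dense: "\<exists>z. x < z \<and> z < y \<and> c z = k" if "x < y" for x y
    using assms that by (auto simp: dense_partition_def)
  then show "fills_gaps (suborder UNIV) (\<lambda>q. c q = k)"
    by (intro fills_gaps_suborder) (auto intro: gt_ex lt_ex)
  assume "p < q"
  show "fills_gaps (suborder {p<..<q}) (\<lambda>q. c q = k)"
  proof (rule fills_gaps_suborder)
    fix x y assume "x \<in> {p<..<q}" "y \<in> {p<..<q}" "x < y"
    then show "\<exists>z\<in>{p<..<q}. c z = k \<and> x < z \<and> z < y"
      using dense[of x y] by (auto 4 3 dest: less_trans)
  next
    show "{p<..<q} \<noteq> {}" using \<open>p < q\<close> Rats_dense_in_real dense by auto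
  next
    fix x assume "x \<in> {p<..<q}"
    then show "\<exists>y\<in>{p<..<q}. x < y" "\<exists>y\<in>{p<..<q}. y < x"
      using dense[of x q] dense[of p x] by (auto 4 3 dest: less_trans)
  qed
qed

lemma shuffle_eq:
  assumes "index_set N"
  obtains c where "dense_partition N c" "shuffle N I = replace_points (suborder UNIV) (\<lambda>q. I (c q))"
proof
  show "dense_partition N (SOME c. dense_partition N c)"
    using dense_partition_exists[OF assms] by (rule someI_ex)
  show "shuffle N I = replace_points (suborder UNIV) (\<lambda>q. I ((SOME c. dense_partition N c) q))"
    by (simp add: shuffle_def Let_def order_rat_eq)
qed

section \<open>Convex copies of a pattern\<close>

definition convex_in :: "'a::linorder set \<Rightarrow> 'a set \<Rightarrow> bool" where
  "convex_in C S \<longleftrightarrow> C \<subseteq> S \<and> (\<forall>x\<in>C. \<forall>y\<in>C. \<forall>z\<in>S. x \<le> z \<longrightarrow> z \<le> y \<longrightarrow> z \<in> C)"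

text \<open>The pattern has a type of its own, since the same \<open>P\<close> is looked for in
  \<open>P\<close>, in \<open>S\<close> and in the product \<open>A \<times> S\<close>.\<close>

definition contains_copy :: "'p::linorder set \<Rightarrow> 'a::linorder set \<Rightarrow> bool" where
  "contains_copy P S \<longleftrightarrow> (\<exists>C. convex_in C S \<and> suborder P \<cong> suborder C)"

lemma convex_inI:
  "C \<subseteq> S \<Longrightarrow> (\<And>x y z. x \<in> C \<Longrightarrow> y \<in> C \<Longrightarrow> z \<in> S \<Longrightarrow> x \<le> z \<Longrightarrow> z \<le> y \<Longrightarrow> z \<in> C) \<Longrightarrow> convex_in C S"
  unfolding convex_in_def by blast

lemma convex_in_imp_subset: "convex_in C S \<Longrightarrow> C \<subseteq> S"
  by (simp add: convex_in_def)

lemma convex_in_between: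
  "convex_in C S \<Longrightarrow> x \<in> C \<Longrightarrow> y \<in> C \<Longrightarrow> z \<in> S \<Longrightarrow> x \<le> z \<Longrightarrow> z \<le> y \<Longrightarrow> z \<in> C"
  unfolding convex_in_def by blast

lemma convex_in_self [simp]: "convex_in S S"
  by (simp add: convex_in_def)

lemma convex_in_trans: "convex_in C D \<Longrightarrow> convex_in D S \<Longrightarrow> convex_in C S"
  unfolding convex_in_def by (meson subset_iff)

lemma convex_in_subset: "convex_in C S \<Longrightarrow> C \<subseteq> D \<Longrightarrow> D \<subseteq> S \<Longrightarrow> convex_in C D"
  unfolding convex_in_def by blast

lemma convex_in_interval: "convex_in (S \<inter> {x..y}) S"
  by (auto simp: convex_in_def)

lemma convex_in_image:
  assumes f: "strict_mono_on S f" and C: "convex_in C S"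
  shows "convex_in (f ` C) (f ` S)"
proof (rule convex_inI)
  note CS = convex_in_imp_subset[OF C]
  show "f ` C \<subseteq> f ` S" using CS by blast
  fix x y z assume "x \<in> f ` C" "y \<in> f ` C" "z \<in> f ` S" "x \<le> z" "z \<le> y"
  then obtain a b c where "a \<in> C" "b \<in> C" "c \<in> S" "x = f a" "y = f b" "z = f c" "f a \<le> f c" "f c \<le> f b"
    by blast
  moreover from this have "a \<le> c" "c \<le> b" using CS strict_mono_on_less_eq[OF f] by blast+
  ultimately show "z \<in> f ` C" using convex_in_between[OF C] by blast
qed

lemma contains_copy_refl [simp]: "contains_copy P P"
  unfolding contains_copy_def by (intro exI[of _ P]) simp

lemma contains_copy_mono: "convex_in T S \<Longrightarrow> contains_copy P T \<Longrightarrow> contains_copy P S"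
  unfolding contains_copy_def by (meson convex_in_trans)

lemma contains_copy_trans:
  assumes "contains_copy P T" "contains_copy T S"
  shows "contains_copy P S"
proof -
  obtain C where C: "convex_in C T" "suborder P \<cong> suborder C"
    using assms(1) by (auto simp: contains_copy_def)
  obtain D where D: "convex_in D S" "suborder T \<cong> suborder D"
    using assms(2) by (auto simp: contains_copy_def)
  obtain f where f: "strict_mono_on T f" "f ` T = D"
    using D(2) by (rule suborder_isoE)
  have "strict_mono_on C f"
    using f(1) convex_in_imp_subset[OF C(1)] by (rule monotone_on_subset)
  then have "suborder P \<cong> suborder (f ` C)"
    using C(2) suborder_image_iso order_isomorphic_trans by blast
  moreover have "convex_in (f ` C) S"
    using convex_in_image[OF f(1) C(1)] f(2) D(1) convex_in_trans by blast
  ultimately show ?thesis by (auto simp: contains_copy_def)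
qed

lemma contains_copy_iso:
  assumes "suborder S \<cong> suborder T" "contains_copy P S"
  shows "contains_copy P T"
proof (rule contains_copy_trans[OF assms(2)])
  show "contains_copy S T"
    unfolding contains_copy_def using assms(1) by (intro exI[of _ T]) simp
qed

lemma contains_copy_image:
  assumes "strict_mono_on S f"
  shows "contains_copy P (f ` S) \<longleftrightarrow> contains_copy P S"
  using contains_copy_iso suborder_image_iso[OF assms] order_isomorphic_sym by metis

text \<open>The bridge from minimality, which speaks of restrictions of relations, to copies of a
  pattern in subsets of a linear type.\<close>

lemma has_convex_copy_iff_contains_copy:
  assumes Z: "Z \<cong> suborder S" and Y: "Y \<cong> suborder P" and lin: "Linear_order Z"
  shows "has_convex_copy Z Y \<longleftrightarrow> contains_copy P S"
proof -
  from Z obtain f where f: "bij_betw f (Field Z) S"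
    and ord: "\<And>a b. a \<in> Field Z \<Longrightarrow> b \<in> Field Z \<Longrightarrow> (a, b) \<in> Z \<longleftrightarrow> f a \<le> f b"
    by (rule order_isomorphicE) (auto simp: bij_betw_def)
  have inj: "inj_on f (Field Z)" and img: "f ` Field Z = S" using f by (auto simp: bij_betw_def)
  have Restr: "Restr Z C \<cong> suborder (f ` C)" if C: "C \<subseteq> Field Z" for C
  proof (rule order_isomorphicI)
    have "Field (Restr Z C) \<subseteq> C" by (auto simp: Field_def)
    moreover have "x \<in> Field (Restr Z C)" if "x \<in> C" for x
      using that C Linear_orderD(1)[OF lin] by (intro FieldI1[of x x]) auto
    ultimately have "Field (Restr Z C) = C" by blast
    then show "bij_betw f (Field (Restr Z C)) (Field (suborder (f ` C)))"
      using C inj by (auto simp: bij_betw_def intro: inj_on_subset)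
  next
    fix a b assume "a \<in> Field (Restr Z C)" "b \<in> Field (Restr Z C)"
    then show "(a, b) \<in> Restr Z C \<longleftrightarrow> (f a, f b) \<in> suborder (f ` C)"
      using ord C by (auto simp: Field_def)
  qed
  have convex: "(\<forall>x\<in>C. \<forall>y\<in>C. \<forall>z. (x, z) \<in> Z \<and> (z, y) \<in> Z \<longrightarrow> z \<in> C) \<longleftrightarrow> convex_in (f ` C) S"
    if C: "C \<subseteq> Field Z" for C
  proof -
    have mem: "f z \<in> f ` C \<longleftrightarrow> z \<in> C" if "z \<in> Field Z" for z
      using that C inj by (simp add: inj_on_image_mem_iff)
    have fld: "(x, y) \<in> Z \<Longrightarrow> x \<in> Field Z \<and> y \<in> Field Z" for x y by (auto simp: Field_def)
    have "convex_in (f ` C) S \<longleftrightarrow>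
        (\<forall>x\<in>C. \<forall>y\<in>C. \<forall>z\<in>Field Z. f x \<le> f z \<longrightarrow> f z \<le> f y \<longrightarrow> z \<in> C)"
      using C mem unfolding convex_in_def img[symmetric] by (simp add: image_mono)
    also have "\<dots> \<longleftrightarrow> (\<forall>x\<in>C. \<forall>y\<in>C. \<forall>z. (x, z) \<in> Z \<and> (z, y) \<in> Z \<longrightarrow> z \<in> C)"
      using ord fld C by (meson subsetD)
    finally show ?thesis ..
  qed
  show ?thesis
  proof
    assume "has_convex_copy Z Y"
    then obtain C where C: "C \<subseteq> Field Z" "convex_in (f ` C) S" "Y \<cong> Restr Z C"
      unfolding has_convex_copy_def using convex by blast
    have "suborder P \<cong> Restr Z C"
      using order_isomorphic_sym[OF Y] C(3) by (rule order_isomorphic_trans)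
    then have "suborder P \<cong> suborder (f ` C)"
      using Restr[OF C(1)] by (rule order_isomorphic_trans)
    then show "contains_copy P S" using C(2) by (auto simp: contains_copy_def)
  next
    assume "contains_copy P S"
    then obtain D where D: "convex_in D S" "suborder P \<cong> suborder D"
      by (auto simp: contains_copy_def)
    obtain C where C: "C \<subseteq> Field Z" "D = f ` C"
      using D(1) img unfolding convex_in_def by (meson subset_image_iff)
    have "Y \<cong> suborder (f ` C)" using Y D(2) unfolding C(2) by (rule order_isomorphic_trans)
    then have "Y \<cong> Restr Z C"
      using order_isomorphic_sym[OF Restr[OF C(1)]] by (rule order_isomorphic_trans)
    moreover have "\<forall>x\<in>C. \<forall>y\<in>C. \<forall>z. (x, z) \<in> Z \<and> (z, y) \<in> Z \<longrightarrow> z \<in> C"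
      using D(1) unfolding C(2) by (rule convex[OF C(1), THEN iffD2])
    ultimately show "has_convex_copy Z Y"
      unfolding has_convex_copy_def using C(1) by (intro exI conjI)
  qed
qed

section \<open>Separation by copies of a pattern, and the resulting classes\<close>

definition separated :: "'p::linorder set \<Rightarrow> 'a::linorder set \<Rightarrow> 'a \<Rightarrow> 'a \<Rightarrow> bool" where
  "separated P S x y \<longleftrightarrow> contains_copy P (S \<inter> {x..y})"

definition component :: "'p::linorder set \<Rightarrow> 'a::linorder set \<Rightarrow> 'a \<Rightarrow> 'a set" where
  "component P S x = {y \<in> S. \<not> separated P S x y \<and> \<not> separated P S y x}"

text \<open>For a doubling pattern this is the first class if there is one and empty otherwise, so
  that a missing \<open>L\<close> is not a separate case. Likewise for
  \<open>upper_end\<close>.\<close>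

definition lower_end :: "'p::linorder set \<Rightarrow> 'a::linorder set \<Rightarrow> 'a set" where
  "lower_end P S = {x \<in> S. \<forall>y\<in>S. \<not> separated P S y x}"

definition upper_end :: "'p::linorder set \<Rightarrow> 'a::linorder set \<Rightarrow> 'a set" where
  "upper_end P S = {x \<in> S. \<forall>y\<in>S. \<not> separated P S x y}"

definition middle :: "'p::linorder set \<Rightarrow> 'a::linorder set \<Rightarrow> 'a set" where
  "middle P S = {x \<in> S. (\<exists>y\<in>S. separated P S y x) \<and> (\<exists>y\<in>S. separated P S x y)}"

lemma separated_mono:
  assumes "x' \<le> x" "separated P S x y" "y \<le> y'"
  shows "separated P S x' y'"
  unfolding separated_def
proof (rule contains_copy_mono)
  show "convex_in (S \<inter> {x..y}) (S \<inter> {x'..y'})"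
    using assms(1,3) by (intro convex_inI) auto
  show "contains_copy P (S \<inter> {x..y})"
    using assms(2) by (simp add: separated_def)
qed

lemma separated_convex:
  assumes "convex_in C S" "x \<in> C" "y \<in> C"
  shows "separated P C x y \<longleftrightarrow> separated P S x y"
proof -
  have "C \<inter> {x..y} = S \<inter> {x..y}"
    using convex_in_imp_subset[OF assms(1)] convex_in_between[OF assms]
    unfolding set_eq_iff Int_iff atLeastAtMost_iff by blast
  then show ?thesis by (simp add: separated_def)
qed

lemma separated_image:
  assumes f: "strict_mono_on S f" and "x \<in> S" "y \<in> S"
  shows "separated P (f ` S) (f x) (f y) \<longleftrightarrow> separated P S x y"
proof -
  have "f ` S \<inter> {f x..f y} = f ` (S \<inter> {x..y})"
    using assms by (auto simp: strict_mono_on_less_eq[OF f])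
  moreover have "strict_mono_on (S \<inter> {x..y}) f" using f by (auto simp: monotone_on_def)
  ultimately show ?thesis by (simp add: separated_def contains_copy_image)
qed

lemma component_image:
  "strict_mono_on S f \<Longrightarrow> x \<in> S \<Longrightarrow> component P (f ` S) (f x) = f ` component P S x"
  by (auto simp: component_def separated_image)

lemma lower_end_image: "strict_mono_on S f \<Longrightarrow> lower_end P (f ` S) = f ` lower_end P S"
  by (auto simp: lower_end_def separated_image)

lemma upper_end_image: "strict_mono_on S f \<Longrightarrow> upper_end P (f ` S) = f ` upper_end P S"
  by (auto simp: upper_end_def separated_image)

lemma middle_image: "strict_mono_on S f \<Longrightarrow> middle P (f ` S) = f ` middle P S"
  unfolding middle_def by (auto simp: separated_image intro!: imageI)

lemma component_subset: "component P S x \<subseteq> S"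
  by (auto simp: component_def)

lemma component_iso_image:
  assumes "strict_mono_on S f" "x \<in> S"
  shows "suborder (component P S x) \<cong> suborder (component P (f ` S) (f x))"
proof -
  have "strict_mono_on (component P S x) f"
    using assms(1) component_subset by (rule monotone_on_subset)
  then show ?thesis using component_image[OF assms] suborder_image_iso by metis
qed

text \<open>
  Of two disjoint convex copies of \<open>P\<close> inside a copy of \<open>P\<close>, any cut leaves one on one side;
  this makes separation a strict weak order, so that components are convex classes.
\<close>

locale doubling =
  fixes P :: "'p::linorder set"
  assumes nonempty: "P \<noteq> {}"
    and doubling: "\<exists>C D. convex_in C P \<and> convex_in D P \<and> (\<forall>x\<in>C. \<forall>y\<in>D. x < y) \<and>
      suborder P \<cong> suborder C \<and> suborder P \<cong> suborder D"
begin

lemma two_copies: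
  assumes "contains_copy P S"
  obtains C D where "convex_in C S" "convex_in D S" "\<And>x y. x \<in> C \<Longrightarrow> y \<in> D \<Longrightarrow> x < y"
    "suborder P \<cong> suborder C" "suborder P \<cong> suborder D"
proof -
  obtain E where E: "convex_in E S" "suborder P \<cong> suborder E"
    using assms by (auto simp: contains_copy_def)
  obtain f where f: "strict_mono_on P f" "f ` P = E" using E(2) by (rule suborder_isoE)
  obtain C D where CD: "convex_in C P" "convex_in D P" "\<And>x y. x \<in> C \<Longrightarrow> y \<in> D \<Longrightarrow> x < y"
    "suborder P \<cong> suborder C" "suborder P \<cong> suborder D"
    using doubling by blast
  have sub: "C \<subseteq> P" "D \<subseteq> P" using CD convex_in_imp_subset by blast+
  show thesis
  proof
    show "convex_in (f ` C) S" "convex_in (f ` D) S"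
      using convex_in_image[OF f(1)] CD f(2) E(1) convex_in_trans by blast+
    show "suborder P \<cong> suborder (f ` C)" "suborder P \<cong> suborder (f ` D)"
      using CD suborder_image_iso order_isomorphic_trans monotone_on_subset[OF f(1)] sub by blast+
    fix x y assume "x \<in> f ` C" "y \<in> f ` D"
    then obtain a b where "a \<in> C" "b \<in> D" "x = f a" "y = f b" by blast
    then show "x < y" using CD(3) sub strict_mono_onD[OF f(1)] by blast
  qed
qed

lemma copy_nonempty: "suborder P \<cong> suborder C \<Longrightarrow> C \<noteq> {}"
  using order_isomorphic_empty_iff[of "suborder P" "suborder C"] nonempty by simp

lemma contains_copyI: "convex_in C S \<Longrightarrow> suborder P \<cong> suborder C \<Longrightarrow> contains_copy P S"
  by (auto simp: contains_copy_def)

lemma contains_copy_Un: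
  assumes "contains_copy P (S \<union> T)" and ST: "\<And>x y. x \<in> S \<Longrightarrow> y \<in> T \<Longrightarrow> x < y"
  shows "contains_copy P S \<or> contains_copy P T"
proof -
  obtain C D where CD: "convex_in C (S \<union> T)" "convex_in D (S \<union> T)"
    "\<And>x y. x \<in> C \<Longrightarrow> y \<in> D \<Longrightarrow> x < y" "suborder P \<cong> suborder C" "suborder P \<cong> suborder D"
    using assms(1) by (rule two_copies) blast
  show ?thesis
  proof (cases "C \<subseteq> S")
    case True
    then show ?thesis using CD(1,4) contains_copyI convex_in_subset by blast
  next
    case False
    then obtain x where x: "x \<in> C" "x \<in> T" using CD(1) convex_in_imp_subset by blast
    have "D \<subseteq> T"
    proof
      fix y assume y: "y \<in> D"
      then have "x < y" using CD(3) x by blast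
      then have "y \<notin> S" using ST x(2) by (metis less_asym)
      then show "y \<in> T" using y CD(2) convex_in_imp_subset by blast
    qed
    then show ?thesis using CD(2,5) contains_copyI convex_in_subset by blast
  qed
qed

text \<open>Three consecutive copies are needed: the outer two provide \<open>x\<close> and
  \<open>y\<close>, and the one between them, here \<open>C''\<close>, then lies entirely inside the
  interval. Hence the pattern is doubled twice.\<close>

lemma separated_exists:
  assumes "contains_copy P S"
  obtains x y where "x \<in> S" "y \<in> S" "x < y" "separated P S x y"
proof -
  obtain C D where CD: "convex_in C S" "convex_in D S"
    "\<And>x y. x \<in> C \<Longrightarrow> y \<in> D \<Longrightarrow> x < y" "suborder P \<cong> suborder C" "suborder P \<cong> suborder D"
    using assms by (rule two_copies) blast
  have "contains_copy P C" using CD(4) contains_copyI[OF convex_in_self] by blast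
  then obtain C' C'' where C: "convex_in C' C" "convex_in C'' C"
    "\<And>x y. x \<in> C' \<Longrightarrow> y \<in> C'' \<Longrightarrow> x < y" "suborder P \<cong> suborder C'" "suborder P \<cong> suborder C''"
    by (rule two_copies) blast
  obtain x z y where xyz: "x \<in> C'" "z \<in> C''" "y \<in> D" 
    using copy_nonempty[OF C(4)] copy_nonempty[OF C(5)] copy_nonempty[OF CD(5)] by blast
  then have mem: "x \<in> C" "z \<in> C" "x \<in> S" "y \<in> S"
    using C(1,2) CD(1,2) convex_in_imp_subset by blast+
  have lt: "x < y" using CD(3) mem xyz by blast
  have "C'' \<subseteq> S \<inter> {x..y}"
  proof
    fix w assume w: "w \<in> C''"
    then have "w \<in> C" "w \<in> S" using C(2) CD(1) convex_in_imp_subset by blast+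
    then show "w \<in> S \<inter> {x..y}" using C(3)[OF xyz(1) w] CD(3)[of w y] xyz by auto
  qed
  then have "convex_in C'' (S \<inter> {x..y})"
    by (rule convex_in_subset[OF convex_in_trans[OF C(2) CD(1)]]) simp
  then have "separated P S x y"
    unfolding separated_def using C(5) by (rule contains_copyI)
  then show thesis using that mem lt by blast
qed

lemma separated_less: "separated P S x y \<Longrightarrow> x < y"
  by (auto simp: separated_def elim!: separated_exists)

lemma separated_irrefl [simp]: "\<not> separated P S x x"
  using separated_less by blast

text \<open>Negative transitivity; with \<open>separated_less\<close> it makes separation a strict
  weak order. If \<open>y\<close> is outside the interval, one of the two new intervals contains the
  old one; if inside, cut the interval after \<open>y\<close>.\<close>

lemma separated_split:
  assumes "separated P S x z"
  shows "separated P S x y \<or> separated P S y z"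
proof -
  consider "y < x" | "z < y" | "x \<le> y" "y \<le> z" by fastforce
  then show ?thesis
  proof cases
    case 1
    then show ?thesis using assms separated_mono by (metis less_imp_le order_refl)
  next
    case 2
    then show ?thesis using assms separated_mono by (metis less_imp_le order_refl)
  next
    case 3
    then have "S \<inter> {x..z} = S \<inter> {x..y} \<union> S \<inter> {y<..z}" by auto
    then have "contains_copy P (S \<inter> {x..y}) \<or> contains_copy P (S \<inter> {y<..z})"
      using assms by (intro contains_copy_Un) (auto simp: separated_def)
    moreover have "convex_in (S \<inter> {y<..z}) (S \<inter> {y..z})" by (rule convex_inI) auto
    ultimately show ?thesis unfolding separated_def using contains_copy_mono by blast
  qed
qed

text \<open>Double the copy in the interval and choose a separated pair in each half. The upper
  point \<open>v\<close> of the lower pair serves as \<open>z\<close>: one pair lies between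
  \<open>x\<close> and \<open>v\<close>, the other between \<open>v\<close> and
  \<open>y\<close>.\<close>

lemma separated_dense:
  assumes "separated P S x y"
  obtains z where "z \<in> S" "separated P S x z" "separated P S z y"
proof -
  obtain C D where CD: "convex_in C (S \<inter> {x..y})" "convex_in D (S \<inter> {x..y})"
    "\<And>x y. x \<in> C \<Longrightarrow> y \<in> D \<Longrightarrow> x < y" "suborder P \<cong> suborder C" "suborder P \<cong> suborder D"
    using assms unfolding separated_def by (rule two_copies) blast
  have conv: "convex_in C S" "convex_in D S"
    using CD(1,2) convex_in_interval convex_in_trans by blast+
  have "contains_copy P C" "contains_copy P D"
    using CD(4,5) contains_copyI[OF convex_in_self] by blast+
  then obtain u v u' v' where uv: "u \<in> C" "v \<in> C" "separated P C u v"
    and uv': "u' \<in> D" "v' \<in> D" "separated P D u' v'"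
    by (meson separated_exists)
  have sep: "separated P S u v" "separated P S u' v'"
    using uv uv' conv separated_convex by blast+
  have le: "x \<le> u" "v \<le> u'" "v' \<le> y" "v \<in> S"
    using uv(1,2) uv'(1,2) CD(3)[of v u'] convex_in_imp_subset[OF CD(1)] convex_in_imp_subset[OF CD(2)]
    by auto
  have "separated P S x v" "separated P S v y"
    using sep le separated_mono by (meson order_refl)+
  then show thesis using that le by blast
qed

lemma component_self: "x \<in> S \<Longrightarrow> x \<in> component P S x"
  by (simp add: component_def)

lemma separated_component:
  assumes "x' \<in> component P S x" "y' \<in> component P S y" "separated P S x y"
  shows "separated P S x' y'"
  using assms unfolding component_def by (blast dest: separated_split)

lemma component_eq: "y \<in> component P S x \<Longrightarrow> component P S y = component P S x"
  unfolding component_def by (blast dest: separated_split)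

lemma component_eqI:
  "x \<in> S \<Longrightarrow> y \<in> S \<Longrightarrow> \<not> separated P S x y \<Longrightarrow> \<not> separated P S y x \<Longrightarrow> component P S y = component P S x"
  by (rule component_eq) (simp add: component_def)

text \<open>A copy would contain a separated pair, and by convexity of the component this pair would
  be separated in \<open>S\<close> as well. Minimality of the collection of components rests on
  this.\<close>

lemma component_no_copy: "\<not> contains_copy P (component P S x)"
proof
  assume "contains_copy P (component P S x)"
  then obtain u v where uv: "u \<in> component P S x" "v \<in> component P S x"
    "separated P (component P S x) u v"
    by (rule separated_exists) blast
  moreover have "convex_in (component P S x) S"
    by (rule convex_inI) (auto simp: component_def, (meson separated_mono order_refl separated_split)+)
  ultimately have "separated P S u v" using separated_convex by blast
  then show False using uv(1,2) unfolding component_def by (blast dest: separated_split)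
qed

text \<open>A point not separated from \<open>x\<close> is trapped between the witnesses
  \<open>u\<close> and \<open>v\<close> on the two sides of \<open>x\<close>, hence lies in
  \<open>C\<close>. For a class at an end of \<open>C\<close> there is no such witness on that
  side.\<close>

lemma component_middle_convex:
  assumes C: "convex_in C S" and x: "x \<in> middle P C"
  shows "x \<in> middle P S" "component P S x = component P C x"
proof -
  obtain u v where uv: "u \<in> C" "v \<in> C" "separated P C u x" "separated P C x v" and xC: "x \<in> C"
    using x by (auto simp: middle_def)
  have CS: "C \<subseteq> S" using C by (simp add: convex_in_def)
  have sep: "separated P S u x" "separated P S x v" using uv xC separated_convex[OF C] by blast+
  then show "x \<in> middle P S" using uv xC CS by (auto simp: middle_def)
  have "y \<in> C" if y: "y \<in> S" "\<not> separated P S x y" "\<not> separated P S y x" for y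
  proof -
    have "separated P S u y" "separated P S y v" using sep y separated_split by blast+
    then have "u \<le> y" "y \<le> v" using separated_less less_imp_le by blast+
    then show ?thesis using convex_in_between[OF C uv(1,2) y(1)] by blast
  qed
  then show "component P S x = component P C x"
    unfolding component_def using CS separated_convex[OF C] xC by blast
qed

text \<open>Separation means that a copy of \<open>P\<close> lies in between, and with it a copy of
  every middle component of \<open>P\<close>, which by \<open>component_middle_convex\<close> is a
  full component of \<open>S\<close>. This is the density of each type that back and forth asks
  for.\<close>

lemma component_between:
  assumes "separated P S x y" and w: "w \<in> middle P P"
  obtains z where "z \<in> S" "separated P S x z" "separated P S z y"
    "suborder (component P P w) \<cong> suborder (component P S z)"
proof -
  obtain C where C: "convex_in C (S \<inter> {x..y})" "suborder P \<cong> suborder C"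
    using assms(1) by (auto simp: separated_def contains_copy_def)
  then have CS: "convex_in C S" using convex_in_interval convex_in_trans by blast
  obtain f where f: "strict_mono_on P f" "f ` P = C" using C(2) by (rule suborder_isoE)
  have z: "f w \<in> middle P C" using middle_image[OF f(1)] f(2) w by blast
  then obtain u v where uv: "u \<in> C" "v \<in> C" "separated P C u (f w)" "separated P C (f w) v"
    and zC: "f w \<in> C"
    by (auto simp: middle_def)
  have le: "x \<le> u" "v \<le> y" using uv(1,2) convex_in_imp_subset[OF C(1)] by auto
  have "separated P S u (f w)" "separated P S (f w) v" using uv zC separated_convex[OF CS] by blast+
  then have "separated P S x (f w)" "separated P S (f w) y" using le separated_mono by (meson order_refl)+
  moreover have "f w \<in> S" using zC convex_in_imp_subset[OF CS] by blast
  moreover have "suborder (component P P w) \<cong> suborder (component P S (f w))"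
    using component_iso_image[OF f(1)] f(2) w component_middle_convex(2)[OF CS z]
    by (auto simp: middle_def)
  ultimately show thesis using that by blast
qed

end

section \<open>Orders as shuffles of their components\<close>

lemma fills_gaps_mono:
  assumes s: "fills_gaps s Q" and Q: "\<And>b. Q b \<Longrightarrow> Q' b"
  shows "fills_gaps s Q'"
  unfolding fills_gaps_def
proof (intro allI impI)
  fix U V
  assume "finite U \<and> finite V \<and> U \<subseteq> Field s \<and> V \<subseteq> Field s \<and>
    (\<forall>u\<in>U. \<forall>v\<in>V. (u, v) \<in> s \<and> u \<noteq> v)"
  from s[unfolded fills_gaps_def, rule_format, OF this]
  show "\<exists>b\<in>Field s. Q' b \<and> (\<forall>u\<in>U. (u, b) \<in> s \<and> u \<noteq> b) \<and> (\<forall>v\<in>V. (b, v) \<in> s \<and> b \<noteq> v)"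
    by (elim bexE, intro bexI) (use Q in simp_all)
qed

context doubling
begin

section \<open>First, middle and last classes\<close>

lemma middle_eq: "middle P S = S - lower_end P S - upper_end P S"
  by (auto simp: middle_def lower_end_def upper_end_def)

lemma lower_end_separated: "x \<in> lower_end P S \<Longrightarrow> y \<in> S \<Longrightarrow> y \<notin> lower_end P S \<Longrightarrow> separated P S x y"
  unfolding lower_end_def using separated_split by blast

lemma upper_end_separated: "x \<in> S \<Longrightarrow> x \<notin> upper_end P S \<Longrightarrow> y \<in> upper_end P S \<Longrightarrow> separated P S x y"
  unfolding upper_end_def using separated_split by blast

lemma ends_disjoint:
  assumes "contains_copy P S"
  shows "lower_end P S \<inter> upper_end P S = {}"
proof -
  obtain u v where "u \<in> S" "v \<in> S" "separated P S u v"
    using assms by (rule separated_exists) blast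
  then show ?thesis
    unfolding lower_end_def upper_end_def using separated_split by blast
qed

lemma middle_separated:
  assumes "separated P S x z" "separated P S z y" "x \<in> S" "y \<in> S" "z \<in> S"
  shows "z \<in> middle P S"
  using assms by (auto simp: middle_def)

lemma middle_component: "x \<in> middle P S \<Longrightarrow> y \<in> component P S x \<Longrightarrow> y \<in> middle P S"
  unfolding middle_def component_def using separated_split by blast

text \<open>Together, \<open>types\<close> and \<open>occur\<close> say that the types of middle
  components of \<open>S\<close> are those listed by \<open>I\<close>: each middle component has a
  listed type, and each listed type occurs in the pattern, hence densely in \<open>S\<close>.
  Keeping \<open>S\<close> apart from \<open>P\<close> allows the use for a product
  \<open>A \<times> S\<close> with the same pattern and the same collection.\<close>

lemma shuffle_decomposition:
  assumes S: "contains_copy P S" "countable S" and N: "index_set N"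
    and lin: "\<And>k. k \<in> N \<Longrightarrow> Linear_order (I k)"
    and types: "\<And>x. x \<in> middle P S \<Longrightarrow> \<exists>k\<in>N. I k \<cong> suborder (component P S x)"
    and occur: "\<And>k. k \<in> N \<Longrightarrow> \<exists>w\<in>middle P P. I k \<cong> suborder (component P P w)"
  shows "shuffle N I \<cong> suborder (middle P S)"
    and "suborder S \<cong> suborder (lower_end P S) \<^bold>+ shuffle N I \<^bold>+ suborder (upper_end P S)"
proof -
  obtain c where c: "dense_partition N c"
    and shuffle: "shuffle N I = replace_points (suborder UNIV) (\<lambda>q. I (c q))"
    using N by (rule shuffle_eq)
  have cN: "c q \<in> N" for q using c by (auto simp: dense_partition_def)
  \<comment> \<open>The choice depends on \<open>x\<close> only through its component, so equal
    components get the same representative and \<open>B\<close> below is a transversal.\<close>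
  define rp where "rp x = (SOME y. y \<in> component P S x)" for x
  have rp: "rp x \<in> component P S x" if "x \<in> S" for x
    unfolding rp_def using component_self[OF that] by (rule someI)
  have mid_S: "x \<in> S" if "x \<in> middle P S" for x using that by (simp add: middle_def)
  define B where "B = rp ` middle P S"
  have B_mid: "b \<in> middle P S" if "b \<in> B" for b
    using that middle_component rp mid_S unfolding B_def by blast
  have B_S: "b \<in> S" if "b \<in> B" for b using that B_mid mid_S by blast
  have rp_B: "rp b = b" if "b \<in> B" for b
  proof -
    obtain x where x: "x \<in> middle P S" "b = rp x" using \<open>b \<in> B\<close> by (auto simp: B_def)
    then have "component P S b = component P S x" using component_eq rp mid_S by blast
    then show ?thesis using x(2) by (simp add: rp_def)
  qed
  \<comment> \<open>Distinct representatives belong to distinct components, so on \<open>B\<close>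
    being smaller and being separated coincide.\<close>
  have B_sep: "separated P S x y" if "x \<in> B" "y \<in> B" "x < y" for x y
  proof (rule ccontr)
    assume "\<not> separated P S x y"
    moreover have "\<not> separated P S y x" using that(3) separated_less by (metis less_asym)
    ultimately have "component P S y = component P S x" using component_eqI that B_S by blast
    then have "rp x = rp y" by (simp add: rp_def)
    then show False using rp_B that by simp
  qed
  have rp_between: "rp z \<in> B \<and> component P S (rp z) = component P S z \<and> x < rp z \<and> rp z < y"
    if "x \<in> S" "y \<in> S" "z \<in> S" "separated P S x z" "separated P S z y" for x y z
  proof (intro conjI)
    show "rp z \<in> B" unfolding B_def using middle_separated that by blast
    show "component P S (rp z) = component P S z" using component_eq rp that by blast
    show "x < rp z" "rp z < y"
      using that rp component_self separated_component separated_less by meson+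
  qed
  have step: "\<exists>z\<in>B. x < z \<and> z < y" if "x \<in> S" "y \<in> S" "separated P S x y" for x y
    using that(3) by (rule separated_dense) (use rp_between that in blast)
  have B_up: "\<exists>y\<in>B. x < y" "\<exists>y\<in>B. y < x" if x: "x \<in> B" for x
    using B_mid[OF x] B_S[OF x] step unfolding middle_def by blast+
  have "B \<noteq> {}"
    using S(1) by (rule separated_exists) (use step in blast)
  \<comment> \<open>Coloured rationals are matched with representatives in such a way that the
    colour of \<open>q\<close> names the type of the component of \<open>h q\<close>.\<close>
  have "\<exists>h. bij_betw h (Field (suborder UNIV)) (Field (suborder B)) \<and>
    (\<forall>a\<in>Field (suborder UNIV). \<forall>b\<in>Field (suborder UNIV).
       (a, b) \<in> suborder UNIV \<longleftrightarrow> (h a, h b) \<in> suborder B) \<and>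
    (\<forall>q\<in>Field (suborder UNIV). I (c q) \<cong> suborder (component P S (h q)))"
  proof (rule back_and_forth)
    show "countable (Field (suborder B))"
      using B_S S(2) by (auto intro: countable_subset)
  next
    fix q :: rat
    obtain w where w: "w \<in> middle P P" "I (c q) \<cong> suborder (component P P w)"
      using occur cN by blast
    show "fills_gaps (suborder B) (\<lambda>b. I (c q) \<cong> suborder (component P S b))"
    proof (rule fills_gaps_suborder)
      fix x y assume xy: "x \<in> B" "y \<in> B" "x < y"
      then obtain z where z: "z \<in> S" "separated P S x z" "separated P S z y"
        "suborder (component P P w) \<cong> suborder (component P S z)"
        using component_between[OF B_sep w(1)] by blast
      have "I (c q) \<cong> suborder (component P S z)" using w(2) z(4) by (rule order_isomorphic_trans)
      then show "\<exists>z\<in>B. I (c q) \<cong> suborder (component P S z) \<and> x < z \<and> z < y"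
        using rp_between[OF _ _ z(1-3)] B_S xy by (intro bexI[of _ "rp z"]) simp_all
    qed (use B_up \<open>B \<noteq> {}\<close> in auto)
  next
    fix b assume "b \<in> Field (suborder B)"
    then obtain k where k: "k \<in> N" "I k \<cong> suborder (component P S b)"
      using types B_mid by auto
    show "fills_gaps (suborder UNIV) (\<lambda>q. I (c q) \<cong> suborder (component P S b))"
      using dense_partition_fills_gaps(1)[OF c k(1)] by (rule fills_gaps_mono) (use k in simp)
  qed simp_all
  then obtain h where bij: "bij_betw h UNIV B" and ord: "\<And>p q. p \<le> q \<longleftrightarrow> h p \<le> h q"
    and iso: "\<And>q. I (c q) \<cong> suborder (component P S (h q))"
    by (auto simp: bij_betw_def)
  have hB: "h q \<in> B" for q using bij by (auto simp: bij_betw_def)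
  have "(\<Union>q. component P S (h q)) = middle P S"
  proof (intro equalityI subsetI)
    fix x assume x: "x \<in> middle P S"
    then obtain q where q: "rp x = h q" using bij by (auto simp: bij_betw_def B_def)
    have "component P S (h q) = component P S x" using component_eq rp mid_S x q by metis
    then show "x \<in> (\<Union>q. component P S (h q))" using component_self mid_S x by blast
  qed (use hB B_mid middle_component in blast)
  moreover have "replace_points (suborder UNIV) (\<lambda>q. suborder (component P S (h q)))
      \<cong> suborder (\<Union>q\<in>Field (suborder UNIV). component P S (h q))"
  proof (rule replace_points_suborder)
    fix p q x y
    assume "p \<noteq> q" "(p, q) \<in> suborder UNIV" and xy: "x \<in> component P S (h p)" "y \<in> component P S (h q)"
    then have "p < q" by simp
    then have "h p < h q" using ord by (metis linorder_not_le)
    then have "separated P S (h p) (h q)" using B_sep hB by blast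
    then show "x < y" using separated_component xy separated_less by blast
  qed simp
  moreover have "shuffle N I \<cong> replace_points (suborder UNIV) (\<lambda>q. suborder (component P S (h q)))"
    unfolding shuffle by (rule replace_points_cong[where h = id]) (use iso lin cN in simp_all)
  ultimately show shuffle_mid: "shuffle N I \<cong> suborder (middle P S)"
    using order_isomorphic_trans by fastforce
  have disj: "lower_end P S \<inter> upper_end P S = {}" using S(1) by (rule ends_disjoint)
  have S_eq: "lower_end P S \<union> (middle P S \<union> upper_end P S) = S"
    unfolding middle_eq by (auto simp: lower_end_def upper_end_def)
  have "shuffle N I \<^bold>+ suborder (upper_end P S) \<cong> suborder (middle P S) \<^bold>+ suborder (upper_end P S)"
    by (rule order_sum_cong[OF shuffle_mid order_isomorphic_refl])
  also have "\<dots> \<cong> suborder (middle P S \<union> upper_end P S)"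
  proof (rule suborder_Un_iso)
    fix x y assume "x \<in> middle P S" "y \<in> upper_end P S"
    then have "separated P S x y" by (intro upper_end_separated) (simp_all add: middle_eq)
    then show "x < y" by (rule separated_less)
  qed
  finally have "suborder (lower_end P S) \<^bold>+ shuffle N I \<^bold>+ suborder (upper_end P S) \<cong>
      suborder (lower_end P S) \<^bold>+ suborder (middle P S \<union> upper_end P S)"
    by (rule order_sum_cong[OF order_isomorphic_refl])
  also have "\<dots> \<cong> suborder (lower_end P S \<union> (middle P S \<union> upper_end P S))"
  proof (rule suborder_Un_iso)
    fix x y assume "x \<in> lower_end P S" and y: "y \<in> middle P S \<union> upper_end P S"
    moreover have "y \<in> S" using y by (auto simp: middle_def upper_end_def)
    moreover have "y \<notin> lower_end P S" using y disj by (auto simp: middle_eq)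
    ultimately show "x < y" using lower_end_separated separated_less by blast
  qed
  finally show "suborder S \<cong> suborder (lower_end P S) \<^bold>+ shuffle N I \<^bold>+ suborder (upper_end P S)"
    unfolding S_eq by (rule order_isomorphic_sym)
qed

end

section \<open>Components of a lexicographic product\<close>

lemma strict_mono_on_Pair: "strict_mono_on S (Pair (a :: 'b::linorder))"
  by (auto simp: monotone_on_def)

lemma Pair_image: "Pair a ` S = {a} \<times> S"
  by auto

lemma suborder_fibre_iso: "suborder S \<cong> suborder ({a} \<times> S)"
  using suborder_image_iso[OF strict_mono_on_Pair] by (metis Pair_image)

lemma contains_copy_fibre: "contains_copy P ({a} \<times> S) \<longleftrightarrow> contains_copy P S"
  using contains_copy_image[OF strict_mono_on_Pair] by (metis Pair_image)

lemma convex_in_fibre: "a \<in> A \<Longrightarrow> convex_in ({a} \<times> S) (A \<times> S)"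
  by (rule convex_inI) auto

lemma suborder_two_fibres_iso:
  assumes "a < b"
  shows "suborder R \<^bold>+ suborder L \<cong> suborder ({a} \<times> R \<union> {b} \<times> L)"
proof -
  have "suborder R \<^bold>+ suborder L \<cong> suborder ({a} \<times> R) \<^bold>+ suborder ({b} \<times> L)"
    by (intro order_sum_cong suborder_fibre_iso)
  also have "\<dots> \<cong> suborder ({a} \<times> R \<union> {b} \<times> L)"
    by (rule suborder_Un_iso) (use assms in auto)
  finally show ?thesis .
qed

context doubling
begin

lemma separated_fibre:
  assumes "a \<in> A" "x \<in> S" "y \<in> S"
  shows "separated P (A \<times> S) (a, x) (a, y) \<longleftrightarrow> separated P S x y"
proof -
  have "separated P (A \<times> S) (a, x) (a, y) \<longleftrightarrow> separated P ({a} \<times> S) (a, x) (a, y)"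
    using separated_convex[OF convex_in_fibre[OF assms(1)]] assms by blast
  also have "\<dots> \<longleftrightarrow> separated P S x y"
    using separated_image[OF strict_mono_on_Pair] assms by (metis Pair_image)
  finally show ?thesis .
qed

text \<open>A fibre strictly in between contains the pattern outright. Without one, the interval
  consists of a final piece of the fibre at \<open>a\<close> and an initial piece of the fibre at
  \<open>b\<close>; a copy straddling the junction yields one on a single side, so \<open>x\<close>
  is not in the last class or \<open>y\<close> not in the first.\<close>

lemma separated_lex:
  assumes S: "contains_copy P S" and A: "a \<in> A" "b \<in> A" and xy: "x \<in> S" "y \<in> S" and "a < b"
  shows "separated P (A \<times> S) (a, x) (b, y) \<longleftrightarrow>
    (\<exists>c\<in>A. a < c \<and> c < b) \<or> x \<notin> upper_end P S \<or> y \<notin> lower_end P S"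
proof (intro iffI; (elim disjE)?)
  assume "\<exists>c\<in>A. a < c \<and> c < b"
  then obtain c where c: "c \<in> A" "a < c" "c < b" by blast
  have "convex_in ({c} \<times> S) (A \<times> S \<inter> {(a, x)..(b, y)})"
    using convex_in_fibre[OF c(1)] by (rule convex_in_subset) (use c in auto)
  moreover have "contains_copy P ({c} \<times> S)" using S by (simp add: contains_copy_fibre)
  ultimately show "separated P (A \<times> S) (a, x) (b, y)"
    unfolding separated_def by (rule contains_copy_mono)
next
  assume "x \<notin> upper_end P S"
  then obtain x' where "x' \<in> S" "separated P S x x'" using xy by (auto simp: upper_end_def)
  then have "separated P (A \<times> S) (a, x) (a, x')" using A xy by (simp add: separated_fibre)
  then show "separated P (A \<times> S) (a, x) (b, y)"
    by (rule separated_mono[rotated]) (use \<open>a < b\<close> in auto)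
next
  assume "y \<notin> lower_end P S"
  then obtain y' where "y' \<in> S" "separated P S y' y" using xy by (auto simp: lower_end_def)
  then have "separated P (A \<times> S) (b, y') (b, y)" using A xy by (simp add: separated_fibre)
  then show "separated P (A \<times> S) (a, x) (b, y)"
    by (rule separated_mono[rotated]) (use \<open>a < b\<close> in auto)
next
  assume sep: "separated P (A \<times> S) (a, x) (b, y)"
  show "(\<exists>c\<in>A. a < c \<and> c < b) \<or> x \<notin> upper_end P S \<or> y \<notin> lower_end P S"
  proof (rule ccontr)
    assume "\<not> ?thesis"
    then have adj: "\<And>c. c \<in> A \<Longrightarrow> \<not> (a < c \<and> c < b)"
      and x: "x \<in> upper_end P S" and y: "y \<in> lower_end P S" by blast+
    have "A \<times> S \<inter> {(a, x)..(b, y)} = {a} \<times> (S \<inter> {x..}) \<union> {b} \<times> (S \<inter> {..y})"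
      using A adj \<open>a < b\<close> by (auto simp: order.order_iff_strict)
    then have "contains_copy P ({a} \<times> (S \<inter> {x..})) \<or> contains_copy P ({b} \<times> (S \<inter> {..y}))"
      using sep \<open>a < b\<close> by (intro contains_copy_Un) (auto simp: separated_def)
    then show False
      unfolding contains_copy_fibre
    proof
      assume "contains_copy P (S \<inter> {x..})"
      then obtain u v where uv: "u \<in> S \<inter> {x..}" "v \<in> S \<inter> {x..}" "separated P (S \<inter> {x..}) u v"
        by (rule separated_exists) blast
      moreover have "convex_in (S \<inter> {x..}) S" by (rule convex_inI) auto
      ultimately have "separated P S u v" using separated_convex by blast
      then have "separated P S x v" by (rule separated_mono[rotated]) (use uv in auto)
      then show False using x uv by (auto simp: upper_end_def)
    next
      assume "contains_copy P (S \<inter> {..y})"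
      then obtain u v where uv: "u \<in> S \<inter> {..y}" "v \<in> S \<inter> {..y}" "separated P (S \<inter> {..y}) u v"
        by (rule separated_exists) blast
      moreover have "convex_in (S \<inter> {..y}) S" by (rule convex_inI) auto
      ultimately have "separated P S u v" using separated_convex by blast
      then have "separated P S u y" by (rule separated_mono[rotated]) (use uv in auto)
      then show False using y uv by (auto simp: lower_end_def)
    qed
  qed
qed

end

section \<open>Endpoints of the index order and ends of the product\<close>

lemma is_left_endpoint_suborder: "is_left_endpoint (suborder A) a \<longleftrightarrow> a \<in> A \<and> (\<forall>b\<in>A. a \<le> b)"
  by (auto simp: is_left_endpoint_def)

lemma is_right_endpoint_suborder: "is_right_endpoint (suborder A) a \<longleftrightarrow> a \<in> A \<and> (\<forall>b\<in>A. b \<le> a)"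
  by (auto simp: is_right_endpoint_def)

lemma is_successor_suborder:
  "is_successor (suborder A) a b \<longleftrightarrow> a \<in> A \<and> b \<in> A \<and> a < b \<and> \<not> (\<exists>c\<in>A. a < c \<and> c < b)"
  unfolding is_successor_def suborder_iff by (metis order.strict_iff_order)

lemma subset_Times_eqI:
  assumes "\<And>b y. b \<in> A \<Longrightarrow> y \<in> S \<Longrightarrow> (b, y) \<in> C \<longleftrightarrow> (b, y) \<in> D" "C \<subseteq> A \<times> S" "D \<subseteq> A \<times> S"
  shows "C = D"
  using assms by blast

text \<open>In the third clause both ends must be empty for the successor pair to create nothing: if
  just one is empty, \<open>R + L\<close> is isomorphic to the other and still has to occur.\<close>

definition absorption_condition ::
    "'a rel \<Rightarrow> nat set \<Rightarrow> (nat \<Rightarrow> 'i rel) \<Rightarrow> 'l rel \<Rightarrow> 'r rel \<Rightarrow> bool" where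
  "absorption_condition A N I L R \<longleftrightarrow>
     (L \<noteq> {} \<longrightarrow> has_left_endpoint A) \<and> (R \<noteq> {} \<longrightarrow> has_right_endpoint A) \<and>
     ((\<exists>a b. is_successor A a b) \<longrightarrow> L = {} \<and> R = {} \<or> (\<exists>k\<in>N. R \<^bold>+ L \<cong> I k)) \<and>
     (all_have_predecessors A \<or> L = {} \<or> (\<exists>k\<in>N. L \<cong> I k)) \<and>
     (all_have_successors A \<or> R = {} \<or> (\<exists>k\<in>N. R \<cong> I k))"

context doubling
begin

text \<open>The set of left endpoints has at most one element; taking the product with this set
  covers an \<open>A\<close> without left endpoint, where the lower end of the product is
  empty.\<close>

lemma lower_end_lex:
  assumes S: "contains_copy P S"
  shows "lower_end P (A \<times> S) = {a. is_left_endpoint (suborder A) a} \<times> lower_end P S"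
proof (intro equalityI subsetI)
  \<comment> \<open>Every fibre contains \<open>u\<close>, which is not in the last class and hence
    is separated from all points of later fibres. So the lower end cannot meet a fibre that has
    another one below it.\<close>
  obtain u v where uv: "u \<in> S" "v \<in> S" "separated P S u v" using S by (rule separated_exists) blast
  then have u: "u \<notin> upper_end P S" by (auto simp: upper_end_def)
  fix p assume p: "p \<in> lower_end P (A \<times> S)"
  then obtain a x where ax: "p = (a, x)" "a \<in> A" "x \<in> S" by (auto simp: lower_end_def)
  have "a \<le> b" if "b \<in> A" for b
  proof (rule ccontr)
    assume "\<not> a \<le> b"
    then have "separated P (A \<times> S) (b, u) (a, x)" 
      using separated_lex[OF S, of b A a u x] ax that uv u by simp
    then show False using p ax uv that by (auto simp: lower_end_def)
  qed
  moreover have "x \<in> lower_end P S"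
    using p ax separated_fibre[of a A _ S x] by (auto simp: lower_end_def)
  ultimately show "p \<in> {a. is_left_endpoint (suborder A) a} \<times> lower_end P S"
    using ax by (simp add: is_left_endpoint_suborder)
next
  fix p assume "p \<in> {a. is_left_endpoint (suborder A) a} \<times> lower_end P S"
  then obtain a x where ax: "p = (a, x)" "a \<in> A" "\<And>b. b \<in> A \<Longrightarrow> a \<le> b" "x \<in> lower_end P S"
    by (auto simp: is_left_endpoint_suborder)
  then have x: "x \<in> S" by (simp add: lower_end_def)
  have "\<not> separated P (A \<times> S) (b, y) (a, x)" if "b \<in> A" "y \<in> S" for b y
  proof
    assume sep: "separated P (A \<times> S) (b, y) (a, x)"
    then have "b \<le> a" using separated_less by fastforce
    then have "b = a" using ax that by (simp add: order.antisym)
    then show False using sep separated_fibre[of a A y S x] ax x that by (auto simp: lower_end_def)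
  qed
  then show "p \<in> lower_end P (A \<times> S)" using ax x by (auto simp: lower_end_def)
qed

lemma upper_end_lex:
  assumes S: "contains_copy P S"
  shows "upper_end P (A \<times> S) = {a. is_right_endpoint (suborder A) a} \<times> upper_end P S"
proof (intro equalityI subsetI)
  obtain u v where uv: "u \<in> S" "v \<in> S" "separated P S u v" using S by (rule separated_exists) blast
  then have v: "v \<notin> lower_end P S" by (auto simp: lower_end_def)
  fix p assume p: "p \<in> upper_end P (A \<times> S)"
  then obtain a x where ax: "p = (a, x)" "a \<in> A" "x \<in> S" by (auto simp: upper_end_def)
  have "b \<le> a" if "b \<in> A" for b
  proof (rule ccontr)
    assume "\<not> b \<le> a"
    then have "separated P (A \<times> S) (a, x) (b, v)" 
      using separated_lex[OF S, of a A b x v] ax that uv v by simp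
    then show False using p ax uv that by (auto simp: upper_end_def)
  qed
  moreover have "x \<in> upper_end P S"
    using p ax separated_fibre[of a A x S] by (auto simp: upper_end_def)
  ultimately show "p \<in> {a. is_right_endpoint (suborder A) a} \<times> upper_end P S"
    using ax by (simp add: is_right_endpoint_suborder)
next
  fix p assume "p \<in> {a. is_right_endpoint (suborder A) a} \<times> upper_end P S"
  then obtain a x where ax: "p = (a, x)" "a \<in> A" "\<And>b. b \<in> A \<Longrightarrow> b \<le> a" "x \<in> upper_end P S"
    by (auto simp: is_right_endpoint_suborder)
  then have x: "x \<in> S" by (simp add: upper_end_def)
  have "\<not> separated P (A \<times> S) (a, x) (b, y)" if "b \<in> A" "y \<in> S" for b y
  proof
    assume sep: "separated P (A \<times> S) (a, x) (b, y)"
    then have "a \<le> b" using separated_less by fastforce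
    then have "b = a" using ax that by (simp add: order.antisym)
    then show False using sep separated_fibre[of a A x S y] ax x that by (auto simp: upper_end_def)
  qed
  then show "p \<in> upper_end P (A \<times> S)" using ax x by (auto simp: upper_end_def)
qed

section \<open>Components of the product\<close>

lemma component_lex_middle:
  assumes "a \<in> A" "x \<in> middle P S"
  shows "component P (A \<times> S) (a, x) = {a} \<times> component P S x"
proof -
  have "(a, x) \<in> middle P ({a} \<times> S)"
    using middle_image[OF strict_mono_on_Pair, of P a S] assms(2) by (auto simp: Pair_image)
  then have "component P (A \<times> S) (a, x) = component P ({a} \<times> S) (a, x)"
    using component_middle_convex(2) convex_in_fibre assms(1) by blast
  also have "\<dots> = {a} \<times> component P S x"
    using component_image[OF strict_mono_on_Pair, of x S P a] assms(2)
    by (simp add: Pair_image middle_def)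
  finally show ?thesis .
qed

lemma mem_component_lex:
  assumes "a \<in> A" "b \<in> A" "x \<in> S" "y \<in> S"
  shows "(b, y) \<in> component P (A \<times> S) (a, x) \<longleftrightarrow>
    (if a = b then y \<in> component P S x
     else if a < b then \<not> separated P (A \<times> S) (a, x) (b, y)
     else \<not> separated P (A \<times> S) (b, y) (a, x))"
proof -
  have "\<not> separated P (A \<times> S) (b, y) (a, x)" if "a < b"
    using that separated_less[of "A \<times> S" "(b, y)" "(a, x)"] by auto
  moreover have "\<not> separated P (A \<times> S) (a, x) (b, y)" if "b < a"
    using that separated_less[of "A \<times> S" "(a, x)" "(b, y)"] by auto
  ultimately show ?thesis
    using assms separated_fibre[of a A x S y] separated_fibre[of a A y S x]
    by (auto simp: component_def)
qed

lemma component_lower_end: "x \<in> lower_end P S \<Longrightarrow> component P S x = lower_end P S"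
  using lower_end_separated[of x S] by (fastforce simp: component_def lower_end_def)

lemma component_upper_end: "x \<in> upper_end P S \<Longrightarrow> component P S x = upper_end P S"
  using upper_end_separated[of _ S x] by (fastforce simp: component_def upper_end_def)

text \<open>By \<open>separated_lex\<close>, the last class of a fibre can only merge with the first
  class of the next one. The successors of \<open>a\<close> form an empty or one-element set, so
  that one equation covers both cases.\<close>

lemma component_lex_upper_end:
  assumes S: "contains_copy P S" and a: "a \<in> A" and x: "x \<in> upper_end P S"
  shows "component P (A \<times> S) (a, x) =
    {a} \<times> upper_end P S \<union> {b. is_successor (suborder A) a b} \<times> lower_end P S"
proof -
  have xS: "x \<in> S" and xl: "x \<notin> lower_end P S"
    using x ends_disjoint[OF S] by (auto simp: upper_end_def)
  have sub: "upper_end P S \<subseteq> S" "lower_end P S \<subseteq> S" by (auto simp: upper_end_def lower_end_def)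
  have "(b, y) \<in> component P (A \<times> S) (a, x) \<longleftrightarrow>
      (b, y) \<in> {a} \<times> upper_end P S \<union> {b. is_successor (suborder A) a b} \<times> lower_end P S"
    if b: "b \<in> A" and y: "y \<in> S" for b y
  proof (cases a b rule: linorder_cases)
    case less
    then show ?thesis
      using mem_component_lex[OF a b xS y] separated_lex[OF S a b xS y less] x a b
      by (auto simp: is_successor_suborder)
  next
    case equal
    then show ?thesis
      using mem_component_lex[OF a b xS y] component_upper_end[OF x]
      by (auto simp: is_successor_suborder)
  next
    case greater
    then show ?thesis
      using mem_component_lex[OF a b xS y] separated_lex[OF S b a y xS greater] xl
      by (auto simp: is_successor_suborder)
  qed
  moreover have "component P (A \<times> S) (a, x) \<subseteq> A \<times> S" by (rule component_subset)
  moreover have "{a} \<times> upper_end P S \<union> {b. is_successor (suborder A) a b} \<times> lower_end P S \<subseteq> A \<times> S"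
    using a sub by (auto simp: is_successor_suborder)
  ultimately show ?thesis by (intro subset_Times_eqI)
qed

lemma component_lex_lower_end:
  assumes S: "contains_copy P S" and a: "a \<in> A" and x: "x \<in> lower_end P S"
  shows "component P (A \<times> S) (a, x) =
    {b. is_successor (suborder A) b a} \<times> upper_end P S \<union> {a} \<times> lower_end P S"
proof -
  have xS: "x \<in> S" and xl: "x \<notin> upper_end P S"
    using x ends_disjoint[OF S] by (auto simp: lower_end_def)
  have sub: "upper_end P S \<subseteq> S" "lower_end P S \<subseteq> S" by (auto simp: upper_end_def lower_end_def)
  have "(b, y) \<in> component P (A \<times> S) (a, x) \<longleftrightarrow>
      (b, y) \<in> {b. is_successor (suborder A) b a} \<times> upper_end P S \<union> {a} \<times> lower_end P S"
    if b: "b \<in> A" and y: "y \<in> S" for b y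
  proof (cases a b rule: linorder_cases)
    case less
    then show ?thesis
      using mem_component_lex[OF a b xS y] separated_lex[OF S a b xS y less] xl
      by (auto simp: is_successor_suborder)
  next
    case equal
    then show ?thesis
      using mem_component_lex[OF a b xS y] component_lower_end[OF x]
      by (auto simp: is_successor_suborder)
  next
    case greater
    then show ?thesis
      using mem_component_lex[OF a b xS y] separated_lex[OF S b a y xS greater] x a b
      by (auto simp: is_successor_suborder)
  qed
  moreover have "component P (A \<times> S) (a, x) \<subseteq> A \<times> S" by (rule component_subset)
  moreover have "{b. is_successor (suborder A) b a} \<times> upper_end P S \<union> {a} \<times> lower_end P S \<subseteq> A \<times> S"
    using a sub by (auto simp: is_successor_suborder)
  ultimately show ?thesis by (intro subset_Times_eqI)
qed

text \<open>Forth: an isomorphism preserves ends and types of components, so every middle component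
  of the product has a type listed by \<open>I\<close>; this is evaluated at the newly created
  classes. Back: \<open>shuffle_decomposition\<close> applies to the product with the same
  collection, and the ends of the product are isomorphic to those of \<open>S\<close>, so both
  orders are isomorphic to the same sum.\<close>

theorem absorption_iff:
  assumes S: "contains_copy P S" "countable S" and A: "A \<noteq> {}" "countable A" and N: "index_set N"
    and lin: "\<And>k. k \<in> N \<Longrightarrow> Linear_order (I k)"
    and types: "\<And>x. x \<in> middle P S \<Longrightarrow> \<exists>k\<in>N. I k \<cong> suborder (component P S x)"
    and occur: "\<And>k. k \<in> N \<Longrightarrow> \<exists>w\<in>middle P P. I k \<cong> suborder (component P P w)"
  shows "suborder (A \<times> S) \<cong> suborder S \<longleftrightarrow>
    absorption_condition (suborder A) N I (suborder (lower_end P S)) (suborder (upper_end P S))"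
    (is "?iso \<longleftrightarrow> ?cond")
proof
  let ?L = "lower_end P S" and ?R = "upper_end P S"
  have disj: "?L \<inter> ?R = {}" using S(1) by (rule ends_disjoint)
  have sub: "?L \<subseteq> S" "?R \<subseteq> S" by (auto simp: upper_end_def lower_end_def)
  have two: "suborder ?R \<^bold>+ suborder ?L \<cong> suborder ({a} \<times> ?R \<union> {b} \<times> ?L)"
    if "is_successor (suborder A) a b" for a b
    by (rule suborder_two_fibres_iso) (use that in \<open>simp add: is_successor_suborder\<close>)
  have succ_eq: "{c. is_successor (suborder A) a c} = {b}" "{c. is_successor (suborder A) c b} = {a}"
    if "is_successor (suborder A) a b" for a b
    using that by (auto simp: is_successor_suborder) (meson linorder_neqE)+
  {
    assume ?iso
    then obtain f where f: "strict_mono_on (A \<times> S) f" "f ` (A \<times> S) = S" by (rule suborder_isoE)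
    have mid: "\<exists>k\<in>N. suborder (component P (A \<times> S) p) \<cong> I k" if p: "p \<in> middle P (A \<times> S)" for p
    proof -
      have "f p \<in> middle P S" using p middle_image[OF f(1)] f(2) by auto
      then obtain k where "k \<in> N" "I k \<cong> suborder (component P S (f p))" using types by blast
      moreover have "suborder (component P (A \<times> S) p) \<cong> suborder (component P S (f p))"
        using component_iso_image[OF f(1)] f(2) p by (auto simp: middle_def)
      ultimately show ?thesis using order_isomorphic_sym order_isomorphic_trans by blast
    qed
    have "has_left_endpoint (suborder A)" if "?L \<noteq> {}"
    proof -
      have "lower_end P (A \<times> S) \<noteq> {}" using that lower_end_image[OF f(1), of P] f(2) by auto
      then show ?thesis unfolding lower_end_lex[OF S(1)] by (auto simp: has_left_endpoint_def)
    qed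
    moreover have "has_right_endpoint (suborder A)" if "?R \<noteq> {}"
    proof -
      have "upper_end P (A \<times> S) \<noteq> {}" using that upper_end_image[OF f(1), of P] f(2) by auto
      then show ?thesis unfolding upper_end_lex[OF S(1)] by (auto simp: has_right_endpoint_def)
    qed
    moreover have "\<exists>k\<in>N. suborder ?R \<^bold>+ suborder ?L \<cong> I k"
      if ab: "is_successor (suborder A) a b" and ne: "\<not> (?L = {} \<and> ?R = {})" for a b
    proof -
      \<comment> \<open>One end may be empty, so the merged component is named from whichever side
        has a point.\<close>
      from ne consider x where "x \<in> ?R" | x where "x \<in> ?L" by blast
      then obtain p where "p \<in> middle P (A \<times> S)" "component P (A \<times> S) p = {a} \<times> ?R \<union> {b} \<times> ?L"
      proof cases
        case 1
        moreover have "a \<in> A" "\<not> is_right_endpoint (suborder A) a"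
          using ab by (auto simp: is_successor_suborder is_right_endpoint_suborder not_le)
        ultimately have "(a, x) \<in> middle P (A \<times> S)"
          using sub disj unfolding middle_eq lower_end_lex[OF S(1)] upper_end_lex[OF S(1)] by auto
        moreover have "component P (A \<times> S) (a, x) = {a} \<times> ?R \<union> {b} \<times> ?L"
          using component_lex_upper_end[OF S(1) _ 1, of a A] ab succ_eq[OF ab]
          by (simp add: is_successor_suborder)
        ultimately show thesis by (rule that)
      next
        case 2
        moreover have "b \<in> A" "\<not> is_left_endpoint (suborder A) b"
          using ab by (auto simp: is_successor_suborder is_left_endpoint_suborder not_le)
        ultimately have "(b, x) \<in> middle P (A \<times> S)"
          using sub disj unfolding middle_eq lower_end_lex[OF S(1)] upper_end_lex[OF S(1)] by auto
        moreover have "component P (A \<times> S) (b, x) = {a} \<times> ?R \<union> {b} \<times> ?L"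
          using component_lex_lower_end[OF S(1) _ 2, of b A] ab succ_eq[OF ab]
          by (simp add: is_successor_suborder)
        ultimately show thesis by (rule that)
      qed
      then show "\<exists>k\<in>N. suborder ?R \<^bold>+ suborder ?L \<cong> I k"
        using mid two[OF ab] order_isomorphic_trans by metis
    qed
    moreover have "\<exists>k\<in>N. suborder ?L \<cong> I k"
      if pre: "\<not> all_have_predecessors (suborder A)" and "?L \<noteq> {}"
    proof -
      obtain a where a: "a \<in> A" "\<not> is_left_endpoint (suborder A) a" "\<And>b. \<not> is_successor (suborder A) b a"
        using pre by (auto simp: all_have_predecessors_def)
      obtain x where x: "x \<in> ?L" using \<open>?L \<noteq> {}\<close> by blast
      have "(a, x) \<in> middle P (A \<times> S)"
        using a x sub disj unfolding middle_eq lower_end_lex[OF S(1)] upper_end_lex[OF S(1)] by auto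
      moreover have "component P (A \<times> S) (a, x) = {a} \<times> ?L"
        using component_lex_lower_end[OF S(1) a(1) x] a(3) by simp
      ultimately show ?thesis
        using mid suborder_fibre_iso[of ?L a] order_isomorphic_trans by metis
    qed
    moreover have "\<exists>k\<in>N. suborder ?R \<cong> I k"
      if suc: "\<not> all_have_successors (suborder A)" and "?R \<noteq> {}"
    proof -
      obtain a where a: "a \<in> A" "\<not> is_right_endpoint (suborder A) a" "\<And>b. \<not> is_successor (suborder A) a b"
        using suc by (auto simp: all_have_successors_def)
      obtain x where x: "x \<in> ?R" using \<open>?R \<noteq> {}\<close> by blast
      have "(a, x) \<in> middle P (A \<times> S)"
        using a x sub disj unfolding middle_eq lower_end_lex[OF S(1)] upper_end_lex[OF S(1)] by auto
      moreover have "component P (A \<times> S) (a, x) = {a} \<times> ?R"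
        using component_lex_upper_end[OF S(1) a(1) x] a(3) by simp
      ultimately show ?thesis
        using mid suborder_fibre_iso[of ?R a] order_isomorphic_trans by metis
    qed
    ultimately show ?cond unfolding absorption_condition_def suborder_empty_iff by blast
  next
    assume cond: ?cond
    have types': "\<exists>k\<in>N. I k \<cong> suborder (component P (A \<times> S) p)" if p: "p \<in> middle P (A \<times> S)" for p
    proof -
      obtain a x where ax: "p = (a, x)" "a \<in> A" "x \<in> S" using p by (auto simp: middle_def)
      \<comment> \<open>Since \<open>p\<close> lies in the middle, an absent neighbour of
        \<open>a\<close> cannot be excused by \<open>a\<close> being the endpoint on that
        side.\<close>
      have nL: "\<not> (is_left_endpoint (suborder A) a \<and> x \<in> ?L)"
        and nR: "\<not> (is_right_endpoint (suborder A) a \<and> x \<in> ?R)"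
        using p unfolding middle_eq lower_end_lex[OF S(1)] upper_end_lex[OF S(1)] ax by auto
      consider "x \<in> middle P S" | "x \<in> ?L" | "x \<in> ?R" using ax by (auto simp: middle_eq)
      then show ?thesis
      proof cases
        case 1
        then obtain k where "k \<in> N" "I k \<cong> suborder (component P S x)" using types by blast
        then show ?thesis
          using component_lex_middle[OF ax(2) 1] suborder_fibre_iso order_isomorphic_trans ax(1) by metis
      next
        case 2
        then have L: "?L \<noteq> {}" by blast
        show ?thesis
        proof (cases "\<exists>b. is_successor (suborder A) b a")
          case True
          then obtain b where b: "is_successor (suborder A) b a" by blast
          then obtain k where "k \<in> N" "suborder ?R \<^bold>+ suborder ?L \<cong> I k"
            using cond L unfolding absorption_condition_def suborder_empty_iff by blast
          moreover have "component P (A \<times> S) p = {b} \<times> ?R \<union> {a} \<times> ?L"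
            using component_lex_lower_end[OF S(1) ax(2) 2] succ_eq[OF b] ax(1) by simp
          ultimately show ?thesis
            using two[OF b] order_isomorphic_trans order_isomorphic_sym by metis
        next
          case False
          then have "\<not> all_have_predecessors (suborder A)"
            using nL 2 ax(2) by (auto simp: all_have_predecessors_def)
          then obtain k where "k \<in> N" "suborder ?L \<cong> I k"
            using cond L unfolding absorption_condition_def suborder_empty_iff by blast
          moreover have "component P (A \<times> S) p = {a} \<times> ?L"
            using component_lex_lower_end[OF S(1) ax(2) 2] False ax(1) by simp
          ultimately show ?thesis
            using suborder_fibre_iso[of ?L a] order_isomorphic_trans order_isomorphic_sym by metis
        qed
      next
        case 3
        then have R: "?R \<noteq> {}" by blast
        show ?thesis
        proof (cases "\<exists>b. is_successor (suborder A) a b")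
          case True
          then obtain b where b: "is_successor (suborder A) a b" by blast
          then obtain k where "k \<in> N" "suborder ?R \<^bold>+ suborder ?L \<cong> I k"
            using cond R unfolding absorption_condition_def suborder_empty_iff by blast
          moreover have "component P (A \<times> S) p = {a} \<times> ?R \<union> {b} \<times> ?L"
            using component_lex_upper_end[OF S(1) ax(2) 3] succ_eq[OF b] ax(1) by simp
          ultimately show ?thesis
            using two[OF b] order_isomorphic_trans order_isomorphic_sym by metis
        next
          case False
          then have "\<not> all_have_successors (suborder A)"
            using nR 3 ax(2) by (auto simp: all_have_successors_def)
          then obtain k where "k \<in> N" "suborder ?R \<cong> I k"
            using cond R unfolding absorption_condition_def suborder_empty_iff by blast
          moreover have "component P (A \<times> S) p = {a} \<times> ?R"
            using component_lex_upper_end[OF S(1) ax(2) 3] False ax(1) by simp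
          ultimately show ?thesis
            using suborder_fibre_iso[of ?R a] order_isomorphic_trans order_isomorphic_sym by metis
        qed
      qed
    qed
    have lower: "suborder (lower_end P (A \<times> S)) \<cong> suborder ?L"
    proof (cases "?L = {}")
      case True
      then show ?thesis unfolding lower_end_lex[OF S(1)] by simp
    next
      case False
      then have "has_left_endpoint (suborder A)" using cond by (simp add: absorption_condition_def)
      then obtain m where "is_left_endpoint (suborder A) m" by (auto simp: has_left_endpoint_def)
      then have "{a. is_left_endpoint (suborder A) a} = {m}"
        by (auto simp: is_left_endpoint_suborder intro: order.antisym)
      then show ?thesis
        unfolding lower_end_lex[OF S(1)] using suborder_fibre_iso order_isomorphic_sym by metis
    qed
    have upper: "suborder (upper_end P (A \<times> S)) \<cong> suborder ?R"
    proof (cases "?R = {}")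
      case True
      then show ?thesis unfolding upper_end_lex[OF S(1)] by simp
    next
      case False
      then have "has_right_endpoint (suborder A)" using cond by (simp add: absorption_condition_def)
      then obtain m where "is_right_endpoint (suborder A) m" by (auto simp: has_right_endpoint_def)
      then have "{a. is_right_endpoint (suborder A) a} = {m}"
        by (auto simp: is_right_endpoint_suborder intro: order.antisym)
      then show ?thesis
        unfolding upper_end_lex[OF S(1)] using suborder_fibre_iso order_isomorphic_sym by metis
    qed
    obtain a where "a \<in> A" using A by blast
    then have "contains_copy P (A \<times> S)"
      using contains_copy_mono[OF convex_in_fibre] contains_copy_fibre S(1) by metis
    then have "suborder (A \<times> S) \<cong>
        suborder (lower_end P (A \<times> S)) \<^bold>+ shuffle N I \<^bold>+ suborder (upper_end P (A \<times> S))"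
      by (rule shuffle_decomposition(2)) (use S A N lin types' occur in auto)
    also have "\<dots> \<cong> suborder ?L \<^bold>+ shuffle N I \<^bold>+ suborder ?R"
      by (intro order_sum_cong lower upper order_isomorphic_refl)
    also have "\<dots> \<cong> suborder S"
      by (rule order_isomorphic_sym, rule shuffle_decomposition(2)) (use S N lin types occur in auto)
    finally show ?iso .
  }
qed

end

section \<open>The components of a minimal shuffle\<close>

lemma replace_points_iso_suborderE:
  assumes iso: "replace_points r J \<cong> suborder M" and r: "Linear_order r"
    and J: "\<And>i. i \<in> Field r \<Longrightarrow> Linear_order (J i)"
  obtains D where "M = (\<Union>i\<in>Field r. D i)" "\<And>i. i \<in> Field r \<Longrightarrow> J i \<cong> suborder (D i)"
    "\<And>i j x y. (i, j) \<in> r \<Longrightarrow> i \<noteq> j \<Longrightarrow> x \<in> D i \<Longrightarrow> y \<in> D j \<Longrightarrow> x < y"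
proof -
  have F: "Field (replace_points r J) = (SIGMA i:Field r. Field (J i))"
    using J by (rule Field_replace_points)
  from iso obtain f where f: "bij_betw f (Field (replace_points r J)) M"
    and ord': "\<And>p q. p \<in> Field (replace_points r J) \<Longrightarrow> q \<in> Field (replace_points r J) \<Longrightarrow>
      (p, q) \<in> replace_points r J \<longleftrightarrow> (f p, f q) \<in> suborder M"
    by (rule order_isomorphicE) (simp only: Field_suborder)
  have fM: "f p \<in> M" if "p \<in> (SIGMA i:Field r. Field (J i))" for p
    using bij_betwE[OF f] that F by blast
  have ord: "(p, q) \<in> replace_points r J \<longleftrightarrow> f p \<le> f q"
    if "p \<in> (SIGMA i:Field r. Field (J i))" "q \<in> (SIGMA i:Field r. Field (J i))" for p q
    using ord'[of p q] fM that F by simp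
  have inj: "inj_on f (SIGMA i:Field r. Field (J i))" and img: "f ` (SIGMA i:Field r. Field (J i)) = M"
    using f F by (simp_all add: bij_betw_def)
  show thesis
  proof
    show "M = (\<Union>i\<in>Field r. (\<lambda>x. f (i, x)) ` Field (J i))"
      unfolding img[symmetric] by blast
  next
    fix i assume i: "i \<in> Field r"
    show "J i \<cong> suborder ((\<lambda>x. f (i, x)) ` Field (J i))"
    proof (rule order_isomorphicI)
      have "inj_on (\<lambda>x. f (i, x)) (Field (J i))"
        using i by (intro inj_onI) (auto dest: inj_onD[OF inj])
      then show "bij_betw (\<lambda>x. f (i, x)) (Field (J i)) (Field (suborder ((\<lambda>x. f (i, x)) ` Field (J i))))"
        by (simp add: bij_betw_def)
    next
      fix x y assume xy: "x \<in> Field (J i)" "y \<in> Field (J i)"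
      then show "(x, y) \<in> J i \<longleftrightarrow> (f (i, x), f (i, y)) \<in> suborder ((\<lambda>x. f (i, x)) ` Field (J i))"
        using ord[of "(i, x)" "(i, y)"] i by (simp add: replace_points_def)
    qed
  next
    fix i j u v assume ij: "(i, j) \<in> r" "i \<noteq> j"
      and "u \<in> (\<lambda>x. f (i, x)) ` Field (J i)" "v \<in> (\<lambda>x. f (j, x)) ` Field (J j)"
    then obtain x y where xy: "x \<in> Field (J i)" "y \<in> Field (J j)" "u = f (i, x)" "v = f (j, y)" by blast
    have "i \<in> Field r" "j \<in> Field r" using ij by (auto simp: Field_def)
    moreover have "(j, i) \<notin> r" using ij Linear_orderD(3)[OF r] by blast
    ultimately have "\<not> v \<le> u"
      using ord[of "(j, y)" "(i, x)"] xy ij(2) by (auto simp: replace_points_def)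
    then show "u < v" by simp
  qed
qed

text \<open>A copy of a shuffle inside a linear type, cut into its blocks. The colour fixes a block
  only up to isomorphism, so blocks of one colour are interchangeable.\<close>

locale shuffled =
  fixes N :: "nat set" and c :: "rat \<Rightarrow> nat" and I :: "nat \<Rightarrow> 'i rel" and D :: "rat \<Rightarrow> 'a::linorder set"
    and M :: "'a set"
  assumes partition: "dense_partition N c"
    and lin: "\<And>k. k \<in> N \<Longrightarrow> Linear_order (I k)"
    and block_type: "\<And>q. I (c q) \<cong> suborder (D q)"
    and block_nonempty: "\<And>q. D q \<noteq> {}"
    and block_less: "\<And>p q x y. p < q \<Longrightarrow> x \<in> D p \<Longrightarrow> y \<in> D q \<Longrightarrow> x < y"
    and M_eq: "M = (\<Union>q. D q)"
begin

lemma block_le: "x \<in> D p \<Longrightarrow> y \<in> D q \<Longrightarrow> x \<le> y \<Longrightarrow> p \<le> q"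
  using block_less by (meson leD leI)

lemma index_mem: "c q \<in> N"
  using partition by (auto simp: dense_partition_def)

text \<open>Back and forth gives a colour-preserving isomorphism from the open interval onto all
  rationals, and this lifts to the blocks.\<close>

lemma interval_copy:
  assumes "p < q"
  shows "suborder M \<cong> suborder (\<Union>r\<in>{p<..<q}. D r)"
proof -
  have "\<exists>h. bij_betw h (Field (suborder {p<..<q})) (Field (suborder UNIV)) \<and>
    (\<forall>a\<in>Field (suborder {p<..<q}). \<forall>b\<in>Field (suborder {p<..<q}).
       (a, b) \<in> suborder {p<..<q} \<longleftrightarrow> (h a, h b) \<in> suborder UNIV) \<and>
    (\<forall>r\<in>Field (suborder {p<..<q}). c (h r) = c r)"
    by (rule back_and_forth)
       (use dense_partition_fills_gaps[OF partition index_mem] assms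
        in \<open>auto intro: fills_gaps_mono simp: eq_commute\<close>)
  then obtain h where h: "bij_betw h (Field (suborder {p<..<q})) (Field (suborder UNIV))"
    "\<And>a b. a \<in> Field (suborder {p<..<q}) \<Longrightarrow> b \<in> Field (suborder {p<..<q}) \<Longrightarrow>
       (a, b) \<in> suborder {p<..<q} \<longleftrightarrow> (h a, h b) \<in> suborder UNIV"
    "\<And>r. r \<in> Field (suborder {p<..<q}) \<Longrightarrow> c (h r) = c r"
    by (elim exE conjE) simp
  have "replace_points (suborder {p<..<q}) (\<lambda>r. suborder (D r)) \<cong>
      suborder (\<Union>r\<in>Field (suborder {p<..<q}). D r)"
    by (rule replace_points_suborder) (auto intro: block_less[OF le_neq_trans])
  moreover have "replace_points (suborder UNIV) (\<lambda>r. suborder (D r)) \<cong>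
      suborder (\<Union>r\<in>Field (suborder UNIV). D r)"
    by (rule replace_points_suborder) (auto intro: block_less[OF le_neq_trans])
  moreover have "replace_points (suborder {p<..<q}) (\<lambda>r. suborder (D r)) \<cong>
      replace_points (suborder UNIV) (\<lambda>r. suborder (D r))"
  proof (rule replace_points_cong[OF h(1,2)])
    fix r assume "r \<in> Field (suborder {p<..<q})"
    then have "I (c r) \<cong> suborder (D (h r))" using block_type[of "h r"] h(3) by simp
    then show "suborder (D r) \<cong> suborder (D (h r))"
      using block_type[of r] order_isomorphic_sym order_isomorphic_trans by blast
  qed simp_all
  ultimately show ?thesis
    unfolding M_eq Field_suborder by (meson order_isomorphic_sym order_isomorphic_trans)
qed

lemma interval_convex: "convex_in (\<Union>r\<in>{p<..<q}. D r) M"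
proof (rule convex_inI)
  fix x y z assume "x \<in> (\<Union>r\<in>{p<..<q}. D r)" "y \<in> (\<Union>r\<in>{p<..<q}. D r)" "z \<in> M" "x \<le> z" "z \<le> y"
  then obtain r s t where "x \<in> D r" "y \<in> D s" "z \<in> D t" "p < r" "s < q" by (auto simp: M_eq)
  moreover from this have "r \<le> t" "t \<le> s" using block_le \<open>x \<le> z\<close> \<open>z \<le> y\<close> by blast+
  ultimately show "z \<in> (\<Union>r\<in>{p<..<q}. D r)" by auto
qed (auto simp: M_eq)

text \<open>Any two disjoint open intervals of rationals supply the two copies; \<open>0\<close>,
  \<open>1\<close> and \<open>2\<close> are an arbitrary choice.\<close>

sublocale doubling M
proof
  show "M \<noteq> {}" using block_nonempty by (auto simp: M_eq)
  have "\<forall>x\<in>\<Union>r\<in>{0<..<1}. D r. \<forall>y\<in>\<Union>r\<in>{1<..<2}. D r. x < y"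
    by (auto intro: block_less[OF less_trans[of _ 1]])
  then show "\<exists>C D. convex_in C M \<and> convex_in D M \<and> (\<forall>x\<in>C. \<forall>y\<in>D. x < y) \<and>
      suborder M \<cong> suborder C \<and> suborder M \<cong> suborder D"
    by (intro exI[of _ "\<Union>r\<in>{0<..<1}. D r"] exI[of _ "\<Union>r\<in>{1<..<2}. D r"] conjI
        interval_convex interval_copy) simp_all
qed

text \<open>Minimality enters as smallness: no block and neither end contains the pattern. With both
  ends empty the results also describe \<open>M\<close> within itself.\<close>

context
  fixes S Lo Ro :: "'a set"
  assumes S_eq: "S = Lo \<union> (M \<union> Ro)"
    and Lo_less: "\<And>x y. x \<in> Lo \<Longrightarrow> y \<in> M \<union> Ro \<Longrightarrow> x < y"
    and Ro_less: "\<And>x y. x \<in> M \<Longrightarrow> y \<in> Ro \<Longrightarrow> x < y"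
    and Lo_small: "\<not> contains_copy M Lo" and Ro_small: "\<not> contains_copy M Ro"
    and block_small: "\<And>q. \<not> contains_copy M (D q)"
begin

lemma M_convex: "convex_in M S"
  by (rule convex_inI) (use S_eq Lo_less Ro_less in fastforce)+

lemma separated_blocks:
  assumes "p < q" "x \<in> D p" "y \<in> D q"
  shows "separated M S x y"
  unfolding separated_def
proof (rule contains_copyI)
  show "suborder M \<cong> suborder (\<Union>r\<in>{p<..<q}. D r)" using assms(1) by (rule interval_copy)
  have "(\<Union>r\<in>{p<..<q}. D r) \<subseteq> S \<inter> {x..y}"
    using block_less assms by (fastforce simp: S_eq M_eq)
  then show "convex_in (\<Union>r\<in>{p<..<q}. D r) (S \<inter> {x..y})"
    by (rule convex_in_subset[OF convex_in_trans[OF interval_convex M_convex]]) simp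
qed

lemma separated_before:
  assumes "x \<in> Lo" "y \<in> M"
  shows "separated M S x y"
proof -
  obtain q where q: "y \<in> D q" using assms by (auto simp: M_eq)
  \<comment> \<open>There is no first block, so some block of \<open>M\<close> lies below that of
    \<open>y\<close>; separation from it is passed down to \<open>x\<close>.\<close>
  obtain x' where x': "x' \<in> D (q - 1)" using block_nonempty by blast
  have "separated M S x' y" by (rule separated_blocks[OF _ x' q]) simp
  moreover have "x < x'" using Lo_less assms x' by (auto simp: M_eq)
  ultimately show ?thesis using separated_mono by (meson less_imp_le order_refl)
qed

lemma separated_after:
  assumes "x \<in> M" "y \<in> Ro"
  shows "separated M S x y"
proof -
  obtain q where q: "x \<in> D q" using assms by (auto simp: M_eq)
  obtain y' where y': "y' \<in> D (q + 1)" using block_nonempty by blast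
  have "separated M S x y'" by (rule separated_blocks[OF _ q y']) simp
  moreover have "y' < y" using Ro_less assms y' by (auto simp: M_eq)
  ultimately show ?thesis using separated_mono by (meson less_imp_le order_refl)
qed

lemma small_not_separated:
  assumes "\<not> contains_copy M C" "convex_in C S" "x \<in> C" "y \<in> C"
  shows "\<not> separated M S x y"
proof
  assume "separated M S x y"
  then have "separated M C x y" using assms separated_convex by blast
  then show False using assms(1) convex_in_interval contains_copy_mono unfolding separated_def by blast
qed

lemma contains_M: "contains_copy M S"
  using M_convex by (rule contains_copyI) simp

lemma lower_end_eq: "lower_end M S = Lo"
proof (intro equalityI subsetI)
  fix x assume x: "x \<in> lower_end M S"
  show "x \<in> Lo"
  proof (rule ccontr)
    assume "x \<notin> Lo"
    then consider q where "x \<in> D q" | "x \<in> Ro" using x by (auto simp: S_eq M_eq lower_end_def)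
    then have "\<exists>y\<in>S. separated M S y x"
    proof cases
      case (1 q)
      obtain y where "y \<in> D (q - 1)" using block_nonempty by blast
      then show ?thesis using separated_blocks[of "q - 1" q y x] 1 by (auto simp: S_eq M_eq)
    next
      case 2
      obtain y where "y \<in> M" using nonempty by blast
      then show ?thesis using separated_after 2 by (auto simp: S_eq)
    qed
    then show False using x by (auto simp: lower_end_def)
  qed
next
  fix x assume x: "x \<in> Lo"
  have "convex_in Lo S"
    by (rule convex_inI) (use S_eq Lo_less in fastforce)+
  moreover have "y \<in> Lo" if "y \<in> S" "separated M S y x" for y
  proof -
    have "\<not> x < y" using separated_less that(2) by (metis less_asym)
    then show ?thesis using Lo_less x that(1) by (auto simp: S_eq)
  qed
  ultimately show "x \<in> lower_end M S"
    using small_not_separated[OF Lo_small] x by (auto simp: lower_end_def S_eq)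
qed

lemma upper_end_eq: "upper_end M S = Ro"
proof (intro equalityI subsetI)
  fix x assume x: "x \<in> upper_end M S"
  show "x \<in> Ro"
  proof (rule ccontr)
    assume "x \<notin> Ro"
    then consider q where "x \<in> D q" | "x \<in> Lo" using x by (auto simp: S_eq M_eq upper_end_def)
    then have "\<exists>y\<in>S. separated M S x y"
    proof cases
      case (1 q)
      obtain y where "y \<in> D (q + 1)" using block_nonempty by blast
      then show ?thesis using separated_blocks[of q "q + 1" x y] 1 by (auto simp: S_eq M_eq)
    next
      case 2
      obtain y where "y \<in> M" using nonempty by blast
      then show ?thesis using separated_before 2 by (auto simp: S_eq)
    qed
    then show False using x by (auto simp: upper_end_def)
  qed
next
  fix x assume x: "x \<in> Ro"
  have "convex_in Ro S"
    by (rule convex_inI) (use S_eq Ro_less Lo_less in fastforce)+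
  moreover have "y \<in> Ro" if "y \<in> S" "separated M S x y" for y
  proof -
    have "\<not> y < x" using separated_less that(2) by (metis less_asym)
    then show ?thesis using Lo_less Ro_less x that(1) by (auto simp: S_eq)
  qed
  ultimately show "x \<in> upper_end M S"
    using small_not_separated[OF Ro_small] x by (auto simp: upper_end_def S_eq)
qed

lemma middle_eq_M: "middle M S = M"
proof -
  have "x \<notin> Lo \<and> x \<notin> Ro" if "x \<in> M" for x
    using Lo_less[of x x] Ro_less[of x x] that by auto
  then show ?thesis unfolding middle_eq lower_end_eq upper_end_eq by (auto simp: S_eq)
qed

text \<open>Different blocks are separated by the blocks between them, and a convex set without a
  copy of the pattern has no separated pair. So blocks are neither merged nor split.\<close>

lemma component_eq_block:
  assumes x: "x \<in> D q"
  shows "component M S x = D q"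
proof (intro equalityI subsetI)
  have xM: "x \<in> M" using x by (auto simp: M_eq)
  fix y assume y: "y \<in> component M S x"
  then have "y \<notin> Lo" "y \<notin> Ro"
    using separated_before separated_after xM by (auto simp: component_def)
  then obtain r where r: "y \<in> D r" using y by (auto simp: component_def S_eq M_eq)
  have "\<not> q < r" "\<not> r < q" using y separated_blocks x r by (auto simp: component_def)
  then show "y \<in> D q" using r by (metis linorder_neqE)
next
  fix y assume y: "y \<in> D q"
  have "convex_in (D q) M"
  proof (rule convex_inI)
    fix u v z assume uv: "u \<in> D q" "v \<in> D q" "z \<in> M" "u \<le> z" "z \<le> v"
    then obtain r where "z \<in> D r" by (auto simp: M_eq)
    moreover from this have "r = q" using block_le uv by (meson order.antisym)
    ultimately show "z \<in> D q" by simp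
  qed (auto simp: M_eq)
  then have "convex_in (D q) S" using M_convex convex_in_trans by blast
  then show "y \<in> component M S x"
    using small_not_separated[OF block_small] x y by (auto simp: component_def S_eq M_eq)
qed

end

end

section \<open>Invariance under isomorphism\<close>

lemma order_isomorphic_endpointsE:
  assumes "A \<cong> B"
  obtains f where "f ` Field A = Field B"
    "\<And>a. a \<in> Field A \<Longrightarrow> is_left_endpoint B (f a) \<longleftrightarrow> is_left_endpoint A a"
    "\<And>a. a \<in> Field A \<Longrightarrow> is_right_endpoint B (f a) \<longleftrightarrow> is_right_endpoint A a"
    "\<And>a b. a \<in> Field A \<Longrightarrow> b \<in> Field A \<Longrightarrow> is_successor B (f a) (f b) \<longleftrightarrow> is_successor A a b"
proof -
  from assms obtain f where f: "bij_betw f (Field A) (Field B)"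
    and ord: "\<And>a b. a \<in> Field A \<Longrightarrow> b \<in> Field A \<Longrightarrow> (a, b) \<in> A \<longleftrightarrow> (f a, f b) \<in> B"
    by (rule order_isomorphicE) blast
  have img: "f ` Field A = Field B" and inj: "inj_on f (Field A)" using f by (simp_all add: bij_betw_def)
  have fB: "a \<in> Field A \<Longrightarrow> f a \<in> Field B" for a using img by blast
  have eq: "f a = f b \<longleftrightarrow> a = b" if "a \<in> Field A" "b \<in> Field A" for a b
    using inj that by (rule inj_on_eq_iff)
  show thesis
  proof
    show "f ` Field A = Field B" by fact
    fix a assume a: "a \<in> Field A"
    show "is_left_endpoint B (f a) \<longleftrightarrow> is_left_endpoint A a"
      "is_right_endpoint B (f a) \<longleftrightarrow> is_right_endpoint A a"
      using a ord fB
      unfolding is_left_endpoint_def is_right_endpoint_def img[symmetric] by simp_all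
    fix b assume b: "b \<in> Field A"
    have "(\<forall>z. (f a, z) \<in> B \<and> (z, f b) \<in> B \<longrightarrow> z = f a \<or> z = f b) \<longleftrightarrow>
        (\<forall>z\<in>Field B. (f a, z) \<in> B \<and> (z, f b) \<in> B \<longrightarrow> z = f a \<or> z = f b)"
      by (meson FieldI2)
    also have "\<dots> \<longleftrightarrow> (\<forall>z\<in>Field A. (a, z) \<in> A \<and> (z, b) \<in> A \<longrightarrow> z = a \<or> z = b)"
      unfolding img[symmetric] using a b ord eq by simp
    also have "\<dots> \<longleftrightarrow> (\<forall>z. (a, z) \<in> A \<and> (z, b) \<in> A \<longrightarrow> z = a \<or> z = b)"
      by (meson FieldI2)
    finally show "is_successor B (f a) (f b) \<longleftrightarrow> is_successor A a b"
      unfolding is_successor_def using a b ord eq by simp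
  qed
qed

lemma is_successor_Field: "is_successor A a b \<Longrightarrow> a \<in> Field A \<and> b \<in> Field A"
  by (auto simp: is_successor_def Field_def)

lemma is_endpoint_Field:
  "is_left_endpoint A a \<Longrightarrow> a \<in> Field A" "is_right_endpoint A a \<Longrightarrow> a \<in> Field A"
  by (auto simp: is_left_endpoint_def is_right_endpoint_def)

lemma endpoint_properties_iso:
  assumes "A \<cong> B"
  shows "has_left_endpoint A \<longleftrightarrow> has_left_endpoint B"
    and "has_right_endpoint A \<longleftrightarrow> has_right_endpoint B"
    and "(\<exists>a b. is_successor A a b) \<longleftrightarrow> (\<exists>a b. is_successor B a b)"
    and "all_have_successors A \<longleftrightarrow> all_have_successors B"
    and "all_have_predecessors A \<longleftrightarrow> all_have_predecessors B"
proof -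
  from assms obtain f where img: "f ` Field A = Field B"
    and left: "\<And>a. a \<in> Field A \<Longrightarrow> is_left_endpoint B (f a) \<longleftrightarrow> is_left_endpoint A a"
    and right: "\<And>a. a \<in> Field A \<Longrightarrow> is_right_endpoint B (f a) \<longleftrightarrow> is_right_endpoint A a"
    and succ: "\<And>a b. a \<in> Field A \<Longrightarrow> b \<in> Field A \<Longrightarrow> is_successor B (f a) (f b) \<longleftrightarrow> is_successor A a b"
    by (rule order_isomorphic_endpointsE) blast
  have bex: "(\<exists>b. Q b) \<longleftrightarrow> (\<exists>a\<in>Field A. Q (f a))" if "\<And>b. Q b \<Longrightarrow> b \<in> Field B" for Q
  proof -
    have "(\<exists>b. Q b) \<longleftrightarrow> (\<exists>b\<in>Field B. Q b)" using that by (auto simp: Bex_def)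
    then show ?thesis unfolding img[symmetric] by simp
  qed
  have "has_left_endpoint B \<longleftrightarrow> (\<exists>a\<in>Field A. is_left_endpoint B (f a))"
    unfolding has_left_endpoint_def by (rule bex) (erule is_endpoint_Field)
  also have "\<dots> \<longleftrightarrow> (\<exists>a\<in>Field A. is_left_endpoint A a)" using left by simp
  also have "\<dots> \<longleftrightarrow> has_left_endpoint A"
    unfolding has_left_endpoint_def by (auto dest: is_endpoint_Field)
  finally show "has_left_endpoint A \<longleftrightarrow> has_left_endpoint B" ..
  have "has_right_endpoint B \<longleftrightarrow> (\<exists>a\<in>Field A. is_right_endpoint B (f a))"
    unfolding has_right_endpoint_def by (rule bex) (erule is_endpoint_Field)
  also have "\<dots> \<longleftrightarrow> (\<exists>a\<in>Field A. is_right_endpoint A a)" using right by simp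
  also have "\<dots> \<longleftrightarrow> has_right_endpoint A"
    unfolding has_right_endpoint_def by (auto dest: is_endpoint_Field)
  finally show "has_right_endpoint A \<longleftrightarrow> has_right_endpoint B" ..
  have ex_succ: "(\<exists>b. is_successor B (f a) b) \<longleftrightarrow> (\<exists>b. is_successor A a b)"
    and ex_pred: "(\<exists>b. is_successor B b (f a)) \<longleftrightarrow> (\<exists>b. is_successor A b a)"
    if a: "a \<in> Field A" for a
  proof -
    have "(\<exists>b. is_successor B (f a) b) \<longleftrightarrow> (\<exists>b\<in>Field A. is_successor B (f a) (f b))"
      by (rule bex) (simp add: is_successor_Field)
    also have "\<dots> \<longleftrightarrow> (\<exists>b. is_successor A a b)"
      using a by (auto simp: succ dest: is_successor_Field)
    finally show "(\<exists>b. is_successor B (f a) b) \<longleftrightarrow> (\<exists>b. is_successor A a b)" .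
    have "(\<exists>b. is_successor B b (f a)) \<longleftrightarrow> (\<exists>b\<in>Field A. is_successor B (f b) (f a))"
      by (rule bex) (simp add: is_successor_Field)
    also have "\<dots> \<longleftrightarrow> (\<exists>b. is_successor A b a)"
      using a by (auto simp: succ dest: is_successor_Field)
    finally show "(\<exists>b. is_successor B b (f a)) \<longleftrightarrow> (\<exists>b. is_successor A b a)" .
  qed
  have "(\<exists>b c. is_successor B b c) \<longleftrightarrow> (\<exists>a\<in>Field A. \<exists>c. is_successor B (f a) c)"
    by (rule bex) (auto simp: is_successor_Field)
  also have "\<dots> \<longleftrightarrow> (\<exists>a b. is_successor A a b)"
    by (auto simp: ex_succ dest: is_successor_Field)
  finally show "(\<exists>a b. is_successor A a b) \<longleftrightarrow> (\<exists>a b. is_successor B a b)" ..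
  show "all_have_successors A \<longleftrightarrow> all_have_successors B"
    unfolding all_have_successors_def img[symmetric] using right ex_succ by simp
  show "all_have_predecessors A \<longleftrightarrow> all_have_predecessors B"
    unfolding all_have_predecessors_def img[symmetric] using left ex_pred by simp
qed

lemma order_isomorphic_cong_left: "r \<cong> r' \<Longrightarrow> r \<cong> s \<longleftrightarrow> r' \<cong> s"
  by (rule order_isomorphic_cong) simp_all

lemma absorption_condition_cong:
  assumes "A \<cong> A'" "L \<cong> L'" "R \<cong> R'"
  shows "absorption_condition A N I L R \<longleftrightarrow> absorption_condition A' N I L' R'"
  unfolding absorption_condition_def endpoint_properties_iso[OF assms(1)]
    order_isomorphic_empty_iff[OF assms(2)] order_isomorphic_empty_iff[OF assms(3)]
    order_isomorphic_cong_left[OF assms(2)] order_isomorphic_cong_left[OF assms(3)]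
    order_isomorphic_cong_left[OF order_sum_cong[OF assms(3,2)]] ..

section \<open>The eight conditions\<close>

text \<open>The disjunction of the eight conditions without their case distinction: either the
  merged class is available as a block, or each non-empty end is.\<close>

definition admissible_ends :: "nat set \<Rightarrow> (nat \<Rightarrow> 'i rel) \<Rightarrow> 'l rel \<Rightarrow> 'r rel \<Rightarrow> bool" where
  "admissible_ends N I L R \<longleftrightarrow> (\<exists>k\<in>N. R \<^bold>+ L \<cong> I k) \<or>
     (L = {} \<or> (\<exists>k\<in>N. L \<cong> I k)) \<and> (R = {} \<or> (\<exists>k\<in>N. R \<cong> I k))"

text \<open>Together with the definitions of the conditions, these facts about empty ends turn the
  comparison of the eight cases into propositional logic in five statements.\<close>

lemma end_type_facts:
  assumes "\<And>k. k \<in> N \<Longrightarrow> I k \<noteq> {}"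
  shows "L = {} \<Longrightarrow> \<not> (\<exists>k\<in>N. L \<cong> I k)" and "R = {} \<Longrightarrow> \<not> (\<exists>k\<in>N. R \<cong> I k)"
    and "L = {} \<Longrightarrow> (\<exists>k\<in>N. R \<^bold>+ L \<cong> I k) \<longleftrightarrow> (\<exists>k\<in>N. R \<cong> I k)"
    and "R = {} \<Longrightarrow> (\<exists>k\<in>N. R \<^bold>+ L \<cong> I k) \<longleftrightarrow> (\<exists>k\<in>N. L \<cong> I k)"
  using assms
  by (auto simp: order_isomorphic_cong_left[OF order_sum_empty_left]
      order_isomorphic_cong_left[OF order_sum_empty_right] dest: order_isomorphic_empty_iff)

lemma end_condition_ex1_iff:
  assumes "\<And>k. k \<in> N \<Longrightarrow> I k \<noteq> {}"
  shows "(\<exists>!t. end_condition t N I L R) \<longleftrightarrow> admissible_ends N I L R"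
proof -
  define a b c l r where "a \<longleftrightarrow> (\<exists>k\<in>N. R \<^bold>+ L \<cong> I k)" and "b \<longleftrightarrow> (\<exists>k\<in>N. L \<cong> I k)"
    and "c \<longleftrightarrow> (\<exists>k\<in>N. R \<cong> I k)" and "l \<longleftrightarrow> L = {}" and "r \<longleftrightarrow> R = {}"
  note defs = a_def b_def c_def l_def r_def
  have facts: "l \<Longrightarrow> \<not> b" "r \<Longrightarrow> \<not> c" "l \<Longrightarrow> a \<longleftrightarrow> c" "r \<Longrightarrow> a \<longleftrightarrow> b"
    unfolding defs by (rule end_type_facts[OF assms]; assumption)+
  have ends: "end_condition C1 N I L R \<longleftrightarrow> l \<and> r" "end_condition C2 N I L R \<longleftrightarrow> b \<and> r"
    "end_condition C3 N I L R \<longleftrightarrow> c \<and> l" "end_condition C4 N I L R \<longleftrightarrow> b \<and> c \<and> \<not> a"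
    "end_condition C5 N I L R \<longleftrightarrow> a \<and> \<not> b \<and> \<not> c" "end_condition C6 N I L R \<longleftrightarrow> a \<and> b \<and> \<not> c \<and> \<not> r"
    "end_condition C7 N I L R \<longleftrightarrow> a \<and> c \<and> \<not> b \<and> \<not> l" "end_condition C8 N I L R \<longleftrightarrow> a \<and> b \<and> c"
    unfolding defs by auto
  have unique: "t = t'" if "end_condition t N I L R" "end_condition t' N I L R" for t t'
    using that facts by (cases t; cases t'; simp add: ends del: end_condition.simps; blast)
  have "(\<exists>t. end_condition t N I L R) \<longleftrightarrow> a \<or> (l \<or> b) \<and> (r \<or> c)"
  proof
    assume "\<exists>t. end_condition t N I L R"
    then obtain t where "end_condition t N I L R" ..
    then show "a \<or> (l \<or> b) \<and> (r \<or> c)"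
      by (cases t; simp add: ends del: end_condition.simps; blast)
  next
    assume "a \<or> (l \<or> b) \<and> (r \<or> c)"
    then have "l \<and> r \<or> b \<and> r \<or> c \<and> l \<or> b \<and> c \<and> \<not> a \<or> a \<and> \<not> b \<and> \<not> c \<or> a \<and> b \<and> \<not> c \<and> \<not> r \<or>
        a \<and> c \<and> \<not> b \<and> \<not> l \<or> a \<and> b \<and> c"
      using facts by blast
    then show "\<exists>t. end_condition t N I L R" unfolding ends[symmetric] by blast
  qed
  then show ?thesis unfolding admissible_ends_def defs[symmetric] using unique by blast
qed

section \<open>Absorption for a given representation\<close>

text \<open>The pattern is a copy \<open>M\<close> of the shuffle. For \<open>absorption_iff\<close>
  the ends must be recognized as \<open>L\<close> and \<open>R\<close>, so they must not contain
  \<open>M\<close>: each is empty, isomorphic to a block, or a convex part of a block isomorphic to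
  \<open>R + L\<close>, and minimality applies.\<close>

lemma absorption_representation:
  assumes X: "Linear_order X" and rep: "shuffle_representation X N I L R"
    and ends: "admissible_ends N I L R" and A: "countable_order A" "A \<noteq> {}"
    and cX: "countable (Field X)"
  shows "A \<^bold>* X \<cong> X \<longleftrightarrow> absorption_condition A N I L R"
proof -
  have N: "index_set N" and I: "\<And>k. k \<in> N \<Longrightarrow> countable_order (I k) \<and> I k \<noteq> {}"
    and min: "minimal_collection N I" and XLR: "X \<cong> L \<^bold>+ shuffle N I \<^bold>+ R"
    using rep by (auto simp: shuffle_representation_def)
  have lin: "Linear_order (I k)" if "k \<in> N" for k using I[OF that] by (simp add: countable_order_def)
  obtain S :: "rat set" where S: "X \<cong> suborder S"
    using countable_order_rat_copy[of X] X cX by (auto simp: countable_order_def)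
  obtain A' :: "rat set" where A': "A \<cong> suborder A'"
    using A(1) by (rule countable_order_rat_copy)
  have "L \<^bold>+ shuffle N I \<^bold>+ R \<cong> suborder S"
    using order_isomorphic_sym[OF XLR] S by (rule order_isomorphic_trans)
  then obtain Lo S' where Lo: "S = Lo \<union> S'" "\<And>x y. x \<in> Lo \<Longrightarrow> y \<in> S' \<Longrightarrow> x < y" "L \<cong> suborder Lo"
    and S': "shuffle N I \<^bold>+ R \<cong> suborder S'"
    by (rule suborder_iso_order_sumE) blast
  from S' obtain M Ro where Ro: "S' = M \<union> Ro" "\<And>x y. x \<in> M \<Longrightarrow> y \<in> Ro \<Longrightarrow> x < y" "R \<cong> suborder Ro"
    and M: "shuffle N I \<cong> suborder M"
    by (rule suborder_iso_order_sumE) blast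
  obtain c where c: "dense_partition N c"
    and shuffle: "shuffle N I = replace_points (suborder UNIV) (\<lambda>q. I (c q))"
    using N by (rule shuffle_eq)
  have cN: "c q \<in> N" for q using c by (auto simp: dense_partition_def)
  have "replace_points (suborder UNIV) (\<lambda>q. I (c q)) \<cong> suborder M" using M shuffle by simp
  then obtain D where D: "M = (\<Union>i\<in>Field (suborder UNIV). D i)"
    "\<And>q. q \<in> Field (suborder UNIV) \<Longrightarrow> I (c q) \<cong> suborder (D q)"
    "\<And>p q x y. (p, q) \<in> suborder UNIV \<Longrightarrow> p \<noteq> q \<Longrightarrow> x \<in> D p \<Longrightarrow> y \<in> D q \<Longrightarrow> x < y"
    by (rule replace_points_iso_suborderE) (use lin cN in simp_all)
  interpret shuffled N c I D M
  proof
    fix q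
    show "I (c q) \<cong> suborder (D q)" using D(2) by simp
    then show "D q \<noteq> {}" using I[OF cN[of q]] order_isomorphic_empty_iff by fastforce
  next
    fix p q :: rat and x y assume "p < q" "x \<in> D p" "y \<in> D q"
    then show "x < y" by (intro D(3)[of p q]) simp_all
  qed (use c lin D(1) in auto)
  have small: "\<not> contains_copy M K" if "k \<in> N" "I k \<cong> suborder K" for k and K :: "rat set"
    using min that has_convex_copy_iff_contains_copy[OF that(2) M lin] by (auto simp: minimal_collection_def)
  have blocks: "\<not> contains_copy M (D q)" for q
    using small cN block_type by blast
  have empty: "\<not> contains_copy M ({} :: rat set)"
    using nonempty by (auto simp: contains_copy_def convex_in_def dest: order_isomorphic_empty_iff)
  have "\<not> contains_copy M Lo" if "L = {} \<or> (\<exists>k\<in>N. L \<cong> I k)"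
    using that
  proof
    assume "L = {}"
    then show ?thesis using empty order_isomorphic_empty_iff[OF Lo(3)] by simp
  next
    assume "\<exists>k\<in>N. L \<cong> I k"
    then obtain k where k: "k \<in> N" "L \<cong> I k" by blast
    have "I k \<cong> suborder Lo" using order_isomorphic_sym[OF k(2)] Lo(3) by (rule order_isomorphic_trans)
    then show ?thesis by (rule small[OF k(1)])
  qed
  moreover have "\<not> contains_copy M Ro" if "R = {} \<or> (\<exists>k\<in>N. R \<cong> I k)"
    using that
  proof
    assume "R = {}"
    then show ?thesis using empty order_isomorphic_empty_iff[OF Ro(3)] by simp
  next
    assume "\<exists>k\<in>N. R \<cong> I k"
    then obtain k where k: "k \<in> N" "R \<cong> I k" by blast
    have "I k \<cong> suborder Ro" using order_isomorphic_sym[OF k(2)] Ro(3) by (rule order_isomorphic_trans)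
    then show ?thesis by (rule small[OF k(1)])
  qed
  \<comment> \<open>Here the ends may fail to be blocks themselves; they inherit smallness from the
    block that they form together.\<close>
  moreover have "\<not> contains_copy M Lo \<and> \<not> contains_copy M Ro" if "\<exists>k\<in>N. R \<^bold>+ L \<cong> I k"
    using that
  proof
    fix k assume k: "k \<in> N" "R \<^bold>+ L \<cong> I k"
    obtain K :: "rat set" where K: "I k \<cong> suborder K"
      using I[OF k(1)] countable_order_rat_copy by blast
    have "R \<^bold>+ L \<cong> suborder K" using k(2) K by (rule order_isomorphic_trans)
    then obtain K1 K2 where K12: "K = K1 \<union> K2" "\<And>x y. x \<in> K1 \<Longrightarrow> y \<in> K2 \<Longrightarrow> x < y"
      "R \<cong> suborder K1" "L \<cong> suborder K2"
      by (rule suborder_iso_order_sumE) blast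
    have "convex_in K1 K" "convex_in K2 K"
      unfolding K12(1) using K12(2) by (auto intro!: convex_inI dest: leD)
    then have "\<not> contains_copy M K1" "\<not> contains_copy M K2"
      using small[OF k(1) K] contains_copy_mono by blast+
    moreover have "suborder Lo \<cong> suborder K2" "suborder Ro \<cong> suborder K1"
      using K12(3,4) Lo(3) Ro(3) order_isomorphic_sym order_isomorphic_trans by blast+
    ultimately show ?thesis using contains_copy_iso by blast
  qed
  ultimately have LR: "\<not> contains_copy M Lo" "\<not> contains_copy M Ro"
    using ends unfolding admissible_ends_def by argo+
  have S_eq: "S = Lo \<union> (M \<union> Ro)" using Lo(1) Ro(1) by simp
  have Lo_less: "\<And>x y. x \<in> Lo \<Longrightarrow> y \<in> M \<union> Ro \<Longrightarrow> x < y" using Lo(2) Ro(1) by blast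
  have parts: "lower_end M S = Lo" "upper_end M S = Ro" "middle M S = M" "contains_copy M S"
    by (rule lower_end_eq[OF S_eq _ _ LR blocks] upper_end_eq[OF S_eq _ _ LR blocks]
        middle_eq_M[OF S_eq _ _ LR blocks] contains_M[OF S_eq _ _ LR blocks];
        use Lo_less Ro(2) in auto)+
  \<comment> \<open>The shuffle is also viewed as an order with empty ends, to see that each of its
    blocks is a middle component of the pattern itself.\<close>
  have str': "M = {} \<union> (M \<union> {})" by simp
  have midM: "middle M M = M"
    by (rule middle_eq_M[OF str' _ _ empty empty blocks]) auto
  have compM: "component M M x = D q" if "x \<in> D q" for x q
    by (rule component_eq_block[OF str' _ _ empty empty blocks that]) auto
  have "suborder (A' \<times> S) \<cong> suborder S \<longleftrightarrow>
      absorption_condition (suborder A') N I (suborder (lower_end M S)) (suborder (upper_end M S))"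
  proof (rule absorption_iff)
    show "contains_copy M S" by (rule parts(4))
    show "A' \<noteq> {}" using A(2) order_isomorphic_empty_iff[OF A'] by simp
    show "index_set N" by fact
    show "Linear_order (I k)" if "k \<in> N" for k using that by (rule lin)
  next
    fix x assume "x \<in> middle M S"
    then have "x \<in> M" using parts(3) by simp
    then obtain q where q: "x \<in> D q" by (auto simp: M_eq)
    have "component M S x = D q"
      by (rule component_eq_block[OF S_eq _ _ LR blocks q]) (use Lo_less Ro(2) in auto)
    then show "\<exists>k\<in>N. I k \<cong> suborder (component M S x)" using block_type cN by metis
  next
    fix k assume "k \<in> N"
    then obtain q where q: "c q = k" using c unfolding dense_partition_def by (meson zero_less_one)
    obtain w where w: "w \<in> D q" using block_nonempty by blast
    then have "w \<in> middle M M" unfolding midM by (auto simp: M_eq)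
    moreover have "I k \<cong> suborder (component M M w)" using compM[OF w] block_type[of q] q by simp
    ultimately show "\<exists>w\<in>middle M M. I k \<cong> suborder (component M M w)" by blast
  qed auto
  moreover have "A \<^bold>* X \<cong> suborder (A' \<times> S)"
    using lex_product_cong[OF A' S X] by (simp add: lex_product_suborder)
  moreover have "absorption_condition A N I L R \<longleftrightarrow>
      absorption_condition (suborder A') N I (suborder Lo) (suborder Ro)"
    using A' Lo(3) Ro(3) by (rule absorption_condition_cong)
  ultimately show ?thesis
    unfolding parts
    using order_isomorphic_cong[OF _ S, of "A \<^bold>* X" "suborder (A' \<times> S)"] by blast
qed

section \<open>Dense orders with endpoints\<close>

lemma order_one_iso_suborder_iff: "\<^bold>1 \<cong> suborder S \<longleftrightarrow> (\<exists>a. S = {a})"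
proof
  have F: "Field \<^bold>1 = {()}" by (auto simp: order_one_def Field_def)
  {
    assume "\<^bold>1 \<cong> suborder S"
    then show "\<exists>a. S = {a}"
      by (rule order_isomorphicE) (auto simp: F bij_betw_def)
  next
    assume "\<exists>a. S = {a}"
    then obtain a where "S = {a}" ..
    then show "\<^bold>1 \<cong> suborder S"
      by (intro order_isomorphicI[of "\<lambda>_. a"]) (auto simp: F bij_betw_def order_one_def)
  }
qed

lemma countable_dense_iso_order_rat:
  fixes B :: "'a::linorder set"
  assumes "countable B" "B \<noteq> {}" "\<And>x y. x \<in> B \<Longrightarrow> y \<in> B \<Longrightarrow> x < y \<Longrightarrow> \<exists>z\<in>B. x < z \<and> z < y"
    "\<And>x. x \<in> B \<Longrightarrow> \<exists>y\<in>B. x < y" "\<And>x. x \<in> B \<Longrightarrow> \<exists>y\<in>B. y < x"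
  shows "\<^bold>Q \<cong> suborder B"
proof -
  have "fills_gaps (suborder B) (\<lambda>_. True)"
    by (rule fills_gaps_suborder) (use assms in auto)
  moreover have "fills_gaps (suborder (UNIV :: rat set)) (\<lambda>_. True)"
    by (rule fills_gaps_suborder) (auto intro: dense gt_ex lt_ex)
  ultimately have "\<exists>f. bij_betw f (Field (suborder (UNIV :: rat set))) (Field (suborder B)) \<and>
    (\<forall>a\<in>Field (suborder UNIV). \<forall>b\<in>Field (suborder UNIV).
       (a, b) \<in> suborder UNIV \<longleftrightarrow> (f a, f b) \<in> suborder B) \<and>
    (\<forall>a\<in>Field (suborder (UNIV :: rat set)). True)"
    by (intro back_and_forth) (use assms(1) in simp_all)
  then obtain f where f: "bij_betw f (Field (suborder (UNIV :: rat set))) (Field (suborder B))"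
    "\<forall>a\<in>Field (suborder UNIV). \<forall>b\<in>Field (suborder UNIV).
       (a, b) \<in> suborder UNIV \<longleftrightarrow> (f a, f b) \<in> suborder B"
    by (elim exE conjE)
  from f(1) show ?thesis
    unfolding order_rat_eq by (rule order_isomorphicI) (use f(2) in blast)
qed

lemma dense_with_endpoints_iff:
  assumes A: "countable_order A"
  shows "has_left_endpoint A \<and> has_right_endpoint A \<and> \<not> (\<exists>a b. is_successor A a b) \<longleftrightarrow>
    A \<cong> \<^bold>1 \<^bold>+ \<^bold>Q \<^bold>+ \<^bold>1 \<or> A \<cong> \<^bold>1"
proof -
  obtain S :: "rat set" where S: "A \<cong> suborder S" using A by (rule countable_order_rat_copy)
  have "has_left_endpoint (suborder S) \<and> has_right_endpoint (suborder S) \<and>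
      \<not> (\<exists>a b. is_successor (suborder S) a b) \<longleftrightarrow>
      \<^bold>1 \<^bold>+ \<^bold>Q \<^bold>+ \<^bold>1 \<cong> suborder S \<or> \<^bold>1 \<cong> suborder S" (is "?lhs \<longleftrightarrow> ?rhs")
  proof
    assume ?lhs
    then obtain a b where a: "a \<in> S" "\<And>x. x \<in> S \<Longrightarrow> a \<le> x" and b: "b \<in> S" "\<And>x. x \<in> S \<Longrightarrow> x \<le> b"
      and dense: "\<And>x y. x \<in> S \<Longrightarrow> y \<in> S \<Longrightarrow> x < y \<Longrightarrow> \<exists>z\<in>S. x < z \<and> z < y"
      by (auto simp: has_left_endpoint_def has_right_endpoint_def is_left_endpoint_suborder
          is_right_endpoint_suborder is_successor_suborder)
    show ?rhs
    proof (cases "a = b")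
      case True
      then have "S = {a}" using a b by (auto intro: order.antisym)
      then show ?thesis by (simp add: order_one_iso_suborder_iff)
    next
      case False
      then have "a < b" using a b by (simp add: order.strict_iff_order)
      define B where "B = S \<inter> {a<..<b}"
      have S_eq: "S = {a} \<union> (B \<union> {b})"
        using a b by (auto simp: B_def order.strict_iff_order)
      have "\<^bold>Q \<cong> suborder B"
      proof (rule countable_dense_iso_order_rat)
        show "B \<noteq> {}" using dense[OF a(1) b(1) \<open>a < b\<close>] by (auto simp: B_def)
        fix x assume x: "x \<in> B"
        show "\<exists>y\<in>B. x < y" using dense[of x b] x b(1) by (auto simp: B_def)
        show "\<exists>y\<in>B. y < x" using dense[of a x] x a(1) by (auto simp: B_def)
        fix y assume "y \<in> B" "x < y"
        then show "\<exists>z\<in>B. x < z \<and> z < y" using dense[of x y] x by (auto simp: B_def)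
      qed simp
      then have "\<^bold>Q \<^bold>+ \<^bold>1 \<cong> suborder B \<^bold>+ suborder {b}"
        by (rule order_sum_cong) (simp add: order_one_iso_suborder_iff)
      also have "\<dots> \<cong> suborder (B \<union> {b})" by (rule suborder_Un_iso) (simp add: B_def)
      finally have "\<^bold>1 \<^bold>+ \<^bold>Q \<^bold>+ \<^bold>1 \<cong> suborder {a} \<^bold>+ suborder (B \<union> {b})"
        by (intro order_sum_cong) (simp_all add: order_one_iso_suborder_iff)
      also have "\<dots> \<cong> suborder ({a} \<union> (B \<union> {b}))"
        by (rule suborder_Un_iso) (use \<open>a < b\<close> in \<open>auto simp: B_def\<close>)
      finally show ?thesis using S_eq by simp
    qed
  next
    assume ?rhs
    then show ?lhs
    proof
      assume "\<^bold>1 \<cong> suborder S"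
      then obtain a where "S = {a}" by (auto simp: order_one_iso_suborder_iff)
      then show ?lhs
        by (auto simp: has_left_endpoint_def has_right_endpoint_def is_left_endpoint_suborder
            is_right_endpoint_suborder is_successor_suborder)
    next
      assume "\<^bold>1 \<^bold>+ \<^bold>Q \<^bold>+ \<^bold>1 \<cong> suborder S"
      then obtain S1 S2 where S12: "S = S1 \<union> S2" "\<And>x y. x \<in> S1 \<Longrightarrow> y \<in> S2 \<Longrightarrow> x < y"
        "\<^bold>1 \<cong> suborder S1" "\<^bold>Q \<^bold>+ \<^bold>1 \<cong> suborder S2"
        by (rule suborder_iso_order_sumE) blast
      from S12(4) obtain B S4 where S34: "S2 = B \<union> S4" "\<And>x y. x \<in> B \<Longrightarrow> y \<in> S4 \<Longrightarrow> x < y"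
        "\<^bold>Q \<cong> suborder B" "\<^bold>1 \<cong> suborder S4"
        by (rule suborder_iso_order_sumE) blast
      obtain a b where ab: "S1 = {a}" "S4 = {b}"
        using S12(3) S34(4) by (auto simp: order_one_iso_suborder_iff)
      obtain f :: "rat \<Rightarrow> rat" where f: "strict_mono_on UNIV f" "f ` UNIV = B"
        using S34(3) unfolding order_rat_eq by (rule suborder_isoE)
      have mono: "f p < f q \<longleftrightarrow> p < q" for p q using strict_mono_on_less[OF f(1)] by simp
      have S_eq: "S = {a} \<union> range f \<union> {b}" using S12(1) S34(1) ab f(2) by blast
      have af: "a < f q" and fb: "f q < b" and "a < b" for q
        using S12(2) S34(1,2) ab f(2) by blast+
      have "\<exists>z\<in>S. x < z \<and> z < y" if xy: "x \<in> S" "y \<in> S" "x < y" for x y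
      proof -
        have "a \<le> x" "y \<le> b" using xy af fb \<open>a < b\<close> unfolding S_eq by (auto intro: less_imp_le)
        then have "x \<noteq> b" "y \<noteq> a" using xy(3) by auto
        then consider "x = a" "y = b" | q where "x = a" "y = f q" | p where "x = f p" "y = b"
          | p q where "x = f p" "y = f q"
          using xy(1,2) unfolding S_eq by blast
        then show ?thesis
        proof cases
          case 1
          then show ?thesis using af fb by (intro bexI[of _ "f 0"]) (simp_all add: S_eq)
        next
          case (2 q)
          then show ?thesis using af by (intro bexI[of _ "f (q - 1)"]) (simp_all add: S_eq mono)
        next
          case (3 p)
          then show ?thesis using fb by (intro bexI[of _ "f (p + 1)"]) (simp_all add: S_eq mono)
        next
          case (4 p q)
          then have "p < q" using xy(3) mono by simp
          then obtain r where "p < r" "r < q" using dense by blast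
          then show ?thesis using 4 by (intro bexI[of _ "f r"]) (simp_all add: S_eq mono)
        qed
      qed
      moreover have "is_left_endpoint (suborder S) a" "is_right_endpoint (suborder S) b"
        unfolding is_left_endpoint_suborder is_right_endpoint_suborder S_eq
        using af fb \<open>a < b\<close> by (auto intro: less_imp_le)
      ultimately show ?lhs
        by (auto simp: has_left_endpoint_def has_right_endpoint_def is_successor_suborder)
    qed
  qed
  then show ?thesis
    unfolding endpoint_properties_iso[OF S] order_isomorphic_cong_left[OF S]
    by (simp add: order_isomorphic_commute[of "suborder S"])
qed

section \<open>Existence of a representation\<close>

text \<open>The pattern is \<open>X\<close> itself, as a set \<open>S\<close> of rationals: the
  images of the fibres at two points of \<open>A\<close> are the two copies that doubling needs. The
  representation is read off from the components, and the condition on the ends from the given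
  \<open>A\<close>.\<close>

lemma left_absorbing_representation:
  fixes X :: "'x rel"
  assumes X: "countable_order X" and ne: "X \<noteq> {}" and absorbing: "left_absorbing X"
  shows "\<exists>N (I :: nat \<Rightarrow> nat rel) (L :: nat rel) (R :: nat rel).
    shuffle_representation X N I L R \<and> admissible_ends N I L R"
proof -
  have linX: "Linear_order X" and cX: "countable (Field X)" using X by (auto simp: countable_order_def)
  obtain A :: "'x rel" and a0 b0 where linA: "Linear_order A" and ab0: "a0 \<in> Field A" "b0 \<in> Field A" "a0 \<noteq> b0"
    and AX: "A \<^bold>* X \<cong> X"
    using absorbing by (auto simp: left_absorbing_def)
  have "countable (Field A)"
  proof -
    obtain x where x: "x \<in> Field X" using ne by (auto simp: Field_def)
    obtain f where f: "bij_betw f (Field (A \<^bold>* X)) (Field X)"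
      using AX by (rule order_isomorphicE)
    have F: "Field (A \<^bold>* X) = Field A \<times> Field X"
      unfolding lex_product_def using linX by (simp add: Field_replace_points)
    have "inj_on (\<lambda>a. f (a, x)) (Field A)"
      using f x unfolding F bij_betw_def inj_on_def by blast
    moreover have "(\<lambda>a. f (a, x)) ` Field A \<subseteq> Field X"
      using f x unfolding F bij_betw_def by blast
    ultimately show ?thesis using cX by (meson countable_image_inj_on countable_subset)
  qed
  then have "countable_order A" using linA by (simp add: countable_order_def)
  then obtain A' :: "rat set" where A': "A \<cong> suborder A'" by (rule countable_order_rat_copy)
  obtain S :: "rat set" where S: "X \<cong> suborder S" using X by (rule countable_order_rat_copy)
  have "suborder (A' \<times> S) \<cong> A \<^bold>* X"
    using order_isomorphic_sym[OF lex_product_cong[OF A' S linX]] by (simp add: lex_product_suborder)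
  then have iso: "suborder (A' \<times> S) \<cong> suborder S"
    by (rule order_isomorphic_trans[OF _ order_isomorphic_trans[OF AX S]])
  obtain a b where ab: "a \<in> A'" "b \<in> A'" "a < b"
  proof -
    obtain g where "bij_betw g (Field A) A'" using A' by (rule order_isomorphicE) simp
    then have "g a0 \<in> A'" "g b0 \<in> A'" "g a0 \<noteq> g b0"
      using ab0 by (auto simp: bij_betw_def inj_on_def)
    then show thesis using that by (metis linorder_neqE)
  qed
  have "S \<noteq> {}" using ne order_isomorphic_empty_iff[OF S] by simp
  interpret doubling S
  proof
    obtain f where f: "strict_mono_on (A' \<times> S) f" "f ` (A' \<times> S) = S" using iso by (rule suborder_isoE)
    define F where "F c = f ` ({c} \<times> S)" for c
    have F: "convex_in (F c) S" "suborder S \<cong> suborder (F c)" if "c \<in> A'" for c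
    proof -
      show "convex_in (F c) S"
        using convex_in_image[OF f(1) convex_in_fibre[OF that]] f(2) by (simp add: F_def)
      have "suborder ({c} \<times> S) \<cong> suborder (F c)"
        unfolding F_def by (rule suborder_image_iso, rule monotone_on_subset[OF f(1)]) (use that in blast)
      with suborder_fibre_iso show "suborder S \<cong> suborder (F c)" by (rule order_isomorphic_trans)
    qed
    have less: "\<forall>x\<in>F a. \<forall>y\<in>F b. x < y"
      unfolding F_def using ab by (auto intro!: strict_mono_onD[OF f(1)])
    show "\<exists>C D. convex_in C S \<and> convex_in D S \<and> (\<forall>x\<in>C. \<forall>y\<in>D. x < y) \<and>
        suborder S \<cong> suborder C \<and> suborder S \<cong> suborder D"
      using F[OF ab(1)] F[OF ab(2)] less by blast
  qed (rule \<open>S \<noteq> {}\<close>)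
  let ?M = "middle S S"
  obtain u v where uv: "u \<in> S" "v \<in> S" "separated S S u v"
    using contains_copy_refl by (rule separated_exists) blast
  \<comment> \<open>The points from \<open>z\<close> to \<open>z'\<close> are separated from both
    \<open>u\<close> and \<open>v\<close> and hence lie in the middle. As they contain a copy of
    \<open>S\<close>, so does the middle, and therefore the shuffle.\<close>
  obtain z where z: "z \<in> S" "separated S S u z" "separated S S z v"
    using uv(3) by (rule separated_dense)
  obtain z' where z': "z' \<in> S" "separated S S z z'" "separated S S z' v"
    using z(3) by (rule separated_dense)
  have zM: "z \<in> ?M" using middle_separated z uv by blast
  have copy_M: "contains_copy S ?M"
  proof (rule contains_copy_mono)
    show "contains_copy S (S \<inter> {z..z'})" using z'(2) by (simp add: separated_def)
    have "x \<in> ?M" if "x \<in> S" "z \<le> x" "x \<le> z'" for x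
      using that z z' uv separated_mono[of u u S S z x] separated_mono[of x z' S S v v]
      by (auto simp: middle_def)
    then show "convex_in (S \<inter> {z..z'}) ?M"
      by (intro convex_in_subset[OF convex_in_interval]) (auto simp: middle_def)
  qed
  \<comment> \<open>The enumeration runs over points of the middle and not over components, so a
    type may be listed repeatedly.\<close>
  have "\<exists>I :: nat \<Rightarrow> nat rel. \<forall>k. countable_order (I k) \<and>
      I k \<cong> suborder (component S S (from_nat_into ?M k))"
    by (rule choice) (metis countable_order_nat_copy countable_order_suborder countableI_type)
  then obtain I :: "nat \<Rightarrow> nat rel" where
    I: "\<And>k. countable_order (I k)" "\<And>k. I k \<cong> suborder (component S S (from_nat_into ?M k))"
    by blast
  have enum: "from_nat_into ?M k \<in> ?M" for k by (rule from_nat_into) (use zM in blast)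
  have enum_S: "from_nat_into ?M k \<in> S" for k using enum by (simp add: middle_def)
  have lin: "Linear_order (I k)" for k using I(1) by (simp add: countable_order_def)
  have types: "\<exists>k\<in>UNIV. I k \<cong> suborder (component S S x)" if "x \<in> ?M" for x
    using I(2) from_nat_into_surj[OF _ that] by (metis UNIV_I countableI_type)
  have occur: "\<exists>w\<in>?M. I k \<cong> suborder (component S S w)" for k using I(2) enum by blast
  have N: "index_set UNIV" by (simp add: index_set_def)
  note decomposition = shuffle_decomposition[OF contains_copy_refl _ N lin types occur]
  obtain L :: "nat rel" where L: "countable_order L" "L \<cong> suborder (lower_end S S)"
    using countable_order_nat_copy countable_order_suborder countableI_type by metis
  obtain R :: "nat rel" where R: "countable_order R" "R \<cong> suborder (upper_end S S)"
    using countable_order_nat_copy countable_order_suborder countableI_type by metis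
  have "X \<cong> suborder (lower_end S S) \<^bold>+ shuffle UNIV I \<^bold>+ suborder (upper_end S S)"
    using S by (rule order_isomorphic_trans) (rule decomposition(2), simp_all)
  also have "\<dots> \<cong> L \<^bold>+ shuffle UNIV I \<^bold>+ R"
    by (intro order_sum_cong order_isomorphic_refl order_isomorphic_sym[OF L(2)] order_isomorphic_sym[OF R(2)])
  finally have XLR: "X \<cong> L \<^bold>+ shuffle UNIV I \<^bold>+ R" .
  have shuffle: "shuffle UNIV I \<cong> suborder ?M" by (rule decomposition(1)) simp_all
  \<comment> \<open>A component containing the shuffle would contain a copy of \<open>S\<close>
    inside that shuffle.\<close>
  have "minimal_collection UNIV I"
    unfolding minimal_collection_def has_convex_copy_iff_contains_copy[OF I(2) shuffle lin]
    using contains_copy_trans[OF copy_M] component_no_copy by blast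
  moreover have "I k \<noteq> {}" for k
    using order_isomorphic_empty_iff[OF I(2)[of k]] component_self[OF enum_S[of k]] by auto
  ultimately have "shuffle_representation X UNIV I L R"
    unfolding shuffle_representation_def using N I(1) L(1) R(1) XLR by blast
  moreover have "admissible_ends UNIV I L R"
  proof -
    have "absorption_condition (suborder A') UNIV I (suborder (lower_end S S)) (suborder (upper_end S S))"
      using iso by (rule absorption_iff[THEN iffD1, rotated -1])
        (use ab N lin types occur in auto)
    then have cond: "absorption_condition (suborder A') UNIV I L R"
      using absorption_condition_cong[OF order_isomorphic_refl L(2) R(2)] by blast
    show ?thesis
    proof (cases "\<exists>c d. is_successor (suborder A') c d")
      case True
      then show ?thesis using cond unfolding absorption_condition_def admissible_ends_def by blast
    next
      case False
      \<comment> \<open>Without successor pairs, \<open>b\<close> is a non-first point without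
        predecessor and \<open>a\<close> a non-last point without successor, so both ends have to be
        empty or occur as blocks.\<close>
      have "\<not> is_left_endpoint (suborder A') b" "\<not> is_right_endpoint (suborder A') a"
        using ab by (auto simp: is_left_endpoint_suborder is_right_endpoint_suborder not_le)
      then have "\<not> all_have_predecessors (suborder A')" "\<not> all_have_successors (suborder A')"
        using ab False by (auto simp: all_have_predecessors_def all_have_successors_def)
      then show ?thesis using cond unfolding absorption_condition_def admissible_ends_def by blast
    qed
  qed
  ultimately show ?thesis by blast
qed

text \<open>Two test orders suffice. The two-point order creates only the class
  \<open>R + L\<close>; the rational interval from \<open>0\<close> to \<open>1\<close> has no
  successor pair and creates only copies of \<open>L\<close> and of \<open>R\<close>. If exactly one
  end is empty, \<open>R + L\<close> is isomorphic to the other, so the two-point order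
  applies.\<close>

lemma representation_left_absorbing:
  assumes X: "countable_order X" and ne: "X \<noteq> {}" and rep: "shuffle_representation X N I L R"
    and ends: "admissible_ends N I L R"
  shows "left_absorbing X"
proof -
  have linX: "Linear_order X" and cX: "countable (Field X)" using X by (auto simp: countable_order_def)
  have I: "\<And>k. k \<in> N \<Longrightarrow> I k \<noteq> {}" using rep by (simp add: shuffle_representation_def)
  have facts: "L = {} \<longrightarrow> ((\<exists>k\<in>N. R \<^bold>+ L \<cong> I k) \<longleftrightarrow> (\<exists>k\<in>N. R \<cong> I k))"
    "R = {} \<longrightarrow> ((\<exists>k\<in>N. R \<^bold>+ L \<cong> I k) \<longleftrightarrow> (\<exists>k\<in>N. L \<cong> I k))"
    by (rule impI, rule end_type_facts[OF I]; assumption)+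
  have "\<exists>A :: rat set. 0 \<in> A \<and> 1 \<in> A \<and> absorption_condition (suborder A) N I L R"
  proof (cases "(L = {} \<and> R = {}) \<or> (\<exists>k\<in>N. R \<^bold>+ L \<cong> I k)")
    case True
    let ?A = "suborder {0, 1 :: rat}"
    have "is_left_endpoint ?A 0" "is_right_endpoint ?A 1" "is_successor ?A 0 1"
      by (auto simp: is_left_endpoint_suborder is_right_endpoint_suborder is_successor_suborder)
    then have "has_left_endpoint ?A" "has_right_endpoint ?A" "all_have_successors ?A" "all_have_predecessors ?A"
      unfolding has_left_endpoint_def has_right_endpoint_def all_have_successors_def
        all_have_predecessors_def by (simp_all, blast+)
    then have "absorption_condition ?A N I L R"
      unfolding absorption_condition_def using True by blast
    then show ?thesis by (intro exI[of _ "{0, 1}"]) simp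
  next
    case False
    then have LR: "\<exists>k\<in>N. L \<cong> I k" "\<exists>k\<in>N. R \<cong> I k"
      using ends facts unfolding admissible_ends_def by argo+
    let ?A = "suborder {0..1 :: rat}"
    have "is_left_endpoint ?A 0" "is_right_endpoint ?A 1"
      by (auto simp: is_left_endpoint_suborder is_right_endpoint_suborder)
    then have "has_left_endpoint ?A" "has_right_endpoint ?A"
      unfolding has_left_endpoint_def has_right_endpoint_def by blast+
    moreover have "\<not> is_successor ?A a b" for a b
    proof
      assume "is_successor ?A a b"
      moreover from this obtain c where "a < c" "c < b"
        using dense[of a b] by (auto simp: is_successor_suborder)
      ultimately show False by (force simp: is_successor_suborder)
    qed
    ultimately have "absorption_condition ?A N I L R"
      unfolding absorption_condition_def using LR by blast
    then show ?thesis by (intro exI[of _ "{0..1}"]) simp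
  qed
  then obtain A :: "rat set" where A: "0 \<in> A" "1 \<in> A" "absorption_condition (suborder A) N I L R"
    by blast
  have "suborder A \<^bold>* X \<cong> X"
    using absorption_representation[OF linX rep ends countable_order_suborder _ cX, of A] A by auto
  then show ?thesis
    by (intro left_absorbingI[of "suborder A" 0 1]) (use A linX ne in simp_all)
qed

text \<open>In the first case the empty \<open>A\<close> has to be excluded, as its product with the
  non-empty \<open>X\<close> is empty; in the other cases the stated conditions exclude it. A
  representation is found on \<open>nat\<close>, while the second half covers representations on
  arbitrary types.\<close>

theorem theorem2:
  fixes X :: "'x rel"
  assumes "countable_order X" and "X \<noteq> {}"
  shows "(left_absorbing X \<longleftrightarrow>
            (\<exists>N (I :: nat \<Rightarrow> nat rel) (L :: nat rel) (R :: nat rel).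
               shuffle_representation X N I L R \<and> (\<exists>!t. end_condition t N I L R)))
       \<and> (\<forall>N (I :: nat \<Rightarrow> 'i rel) (L :: 'l rel) (R :: 'r rel) (A :: 'a rel).
            left_absorbing X \<and> shuffle_representation X N I L R \<and>
            (\<exists>!t. end_condition t N I L R) \<and> countable_order A \<longrightarrow>
              (end_condition C1 N I L R \<longrightarrow> (A \<noteq> {} \<longrightarrow> A \<^bold>* X \<cong> X))
            \<and> (end_condition C2 N I L R \<longrightarrow> (A \<^bold>* X \<cong> X \<longleftrightarrow> has_left_endpoint A))
            \<and> (end_condition C3 N I L R \<longrightarrow> (A \<^bold>* X \<cong> X \<longleftrightarrow> has_right_endpoint A))
            \<and> (end_condition C4 N I L R \<longrightarrow>
                 (A \<^bold>* X \<cong> X \<longleftrightarrow> A \<cong> \<^bold>1 \<^bold>+ \<^bold>Q \<^bold>+ \<^bold>1 \<or> A \<cong> \<^bold>1))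
            \<and> (end_condition C5 N I L R \<longrightarrow>
                 (A \<^bold>* X \<cong> X \<longleftrightarrow> has_left_endpoint A \<and> has_right_endpoint A \<and>
                   all_have_successors A \<and> all_have_predecessors A))
            \<and> (end_condition C6 N I L R \<longrightarrow>
                 (A \<^bold>* X \<cong> X \<longleftrightarrow> has_left_endpoint A \<and> has_right_endpoint A \<and>
                   all_have_successors A))
            \<and> (end_condition C7 N I L R \<longrightarrow>
                 (A \<^bold>* X \<cong> X \<longleftrightarrow> has_left_endpoint A \<and> has_right_endpoint A \<and>
                   all_have_predecessors A))
            \<and> (end_condition C8 N I L R \<longrightarrow>
                 (A \<^bold>* X \<cong> X \<longleftrightarrow> has_left_endpoint A \<and> has_right_endpoint A)))"
proof (rule conjI)
  have ex1: "(\<exists>!t. end_condition t N I L R) \<longleftrightarrow> admissible_ends N I L R"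
    if "shuffle_representation X N I L R" for N and I :: "nat \<Rightarrow> nat rel" and L R :: "nat rel"
    by (rule end_condition_ex1_iff) (use that in \<open>simp add: shuffle_representation_def\<close>)
  show "left_absorbing X \<longleftrightarrow>
      (\<exists>N (I :: nat \<Rightarrow> nat rel) (L :: nat rel) (R :: nat rel).
         shuffle_representation X N I L R \<and> (\<exists>!t. end_condition t N I L R))"
  proof
    assume "left_absorbing X"
    from left_absorbing_representation[OF assms this]
    show "\<exists>N (I :: nat \<Rightarrow> nat rel) (L :: nat rel) (R :: nat rel).
        shuffle_representation X N I L R \<and> (\<exists>!t. end_condition t N I L R)"
      using ex1 by meson
  next
    assume "\<exists>N (I :: nat \<Rightarrow> nat rel) (L :: nat rel) (R :: nat rel).
        shuffle_representation X N I L R \<and> (\<exists>!t. end_condition t N I L R)"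
    then obtain N I and L R :: "nat rel" where
      rep: "shuffle_representation X N (I :: nat \<Rightarrow> nat rel) L R" "\<exists>!t. end_condition t N I L R"
      by (elim exE conjE)
    show "left_absorbing X"
      by (rule representation_left_absorbing[OF assms rep(1)]) (use rep ex1 in simp)
  qed
next
  have X: "Linear_order X" "countable (Field X)" using assms(1) by (simp_all add: countable_order_def)
  show "\<forall>N (I :: nat \<Rightarrow> 'i rel) (L :: 'l rel) (R :: 'r rel) (A :: 'a rel).
      left_absorbing X \<and> shuffle_representation X N I L R \<and>
      (\<exists>!t. end_condition t N I L R) \<and> countable_order A \<longrightarrow>
        (end_condition C1 N I L R \<longrightarrow> (A \<noteq> {} \<longrightarrow> A \<^bold>* X \<cong> X))
      \<and> (end_condition C2 N I L R \<longrightarrow> (A \<^bold>* X \<cong> X \<longleftrightarrow> has_left_endpoint A))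
      \<and> (end_condition C3 N I L R \<longrightarrow> (A \<^bold>* X \<cong> X \<longleftrightarrow> has_right_endpoint A))
      \<and> (end_condition C4 N I L R \<longrightarrow>
           (A \<^bold>* X \<cong> X \<longleftrightarrow> A \<cong> \<^bold>1 \<^bold>+ \<^bold>Q \<^bold>+ \<^bold>1 \<or> A \<cong> \<^bold>1))
      \<and> (end_condition C5 N I L R \<longrightarrow>
           (A \<^bold>* X \<cong> X \<longleftrightarrow> has_left_endpoint A \<and> has_right_endpoint A \<and>
             all_have_successors A \<and> all_have_predecessors A))
      \<and> (end_condition C6 N I L R \<longrightarrow>
           (A \<^bold>* X \<cong> X \<longleftrightarrow> has_left_endpoint A \<and> has_right_endpoint A \<and>
             all_have_successors A))
      \<and> (end_condition C7 N I L R \<longrightarrow>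
           (A \<^bold>* X \<cong> X \<longleftrightarrow> has_left_endpoint A \<and> has_right_endpoint A \<and>
             all_have_predecessors A))
      \<and> (end_condition C8 N I L R \<longrightarrow>
           (A \<^bold>* X \<cong> X \<longleftrightarrow> has_left_endpoint A \<and> has_right_endpoint A))"
  proof (intro allI impI)
    fix N and I :: "nat \<Rightarrow> 'i rel" and L :: "'l rel" and R :: "'r rel" and A :: "'a rel"
    assume "left_absorbing X \<and> shuffle_representation X N I L R \<and>
      (\<exists>!t. end_condition t N I L R) \<and> countable_order A"
    then have rep: "shuffle_representation X N I L R" and t: "\<exists>!t. end_condition t N I L R"
      and A: "countable_order A"
      by blast+
    have I: "\<And>k. k \<in> N \<Longrightarrow> I k \<noteq> {}" using rep by (simp add: shuffle_representation_def)
    have ends: "admissible_ends N I L R" using t by (simp add: end_condition_ex1_iff[OF I])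
    have key: "A \<^bold>* X \<cong> X \<longleftrightarrow> A \<noteq> {} \<and> absorption_condition A N I L R"
    proof (cases "A = {}")
      case True
      then have "A \<^bold>* X = {}" by (simp add: lex_product_def replace_points_def)
      then show ?thesis using True order_isomorphic_empty_iff[of "A \<^bold>* X" X] assms(2) by blast
    next
      case False
      then show ?thesis using absorption_representation[OF X(1) rep ends A False X(2)] by simp
    qed
    \<comment> \<open>The eight conditions depend on these truth values alone. What remains is
      propositional, given \<open>facts\<close> and \<open>key\<close>.\<close>
    define a b c l r where "a \<longleftrightarrow> (\<exists>k\<in>N. R \<^bold>+ L \<cong> I k)" and "b \<longleftrightarrow> (\<exists>k\<in>N. L \<cong> I k)"
      and "c \<longleftrightarrow> (\<exists>k\<in>N. R \<cong> I k)" and "l \<longleftrightarrow> L = {}" and "r \<longleftrightarrow> R = {}"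
    note defs = a_def b_def c_def l_def r_def
    have facts: "l \<longrightarrow> \<not> b" "r \<longrightarrow> \<not> c" "l \<longrightarrow> (a \<longleftrightarrow> c)" "r \<longrightarrow> (a \<longleftrightarrow> b)"
      unfolding defs by (rule impI, rule end_type_facts[OF I]; assumption)+
    have nonempty: "has_left_endpoint A \<longrightarrow> A \<noteq> {}" "has_right_endpoint A \<longrightarrow> A \<noteq> {}"
      by (auto simp: has_left_endpoint_def has_right_endpoint_def is_left_endpoint_def is_right_endpoint_def)
    have ends: "end_condition C1 N I L R \<longleftrightarrow> l \<and> r" "end_condition C2 N I L R \<longleftrightarrow> b \<and> r"
      "end_condition C3 N I L R \<longleftrightarrow> c \<and> l" "end_condition C4 N I L R \<longleftrightarrow> b \<and> c \<and> \<not> a"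
      "end_condition C5 N I L R \<longleftrightarrow> a \<and> \<not> b \<and> \<not> c" "end_condition C6 N I L R \<longleftrightarrow> a \<and> b \<and> \<not> c \<and> \<not> r"
      "end_condition C7 N I L R \<longleftrightarrow> a \<and> c \<and> \<not> b \<and> \<not> l" "end_condition C8 N I L R \<longleftrightarrow> a \<and> b \<and> c"
      unfolding defs by auto
    show "(end_condition C1 N I L R \<longrightarrow> (A \<noteq> {} \<longrightarrow> A \<^bold>* X \<cong> X))
      \<and> (end_condition C2 N I L R \<longrightarrow> (A \<^bold>* X \<cong> X \<longleftrightarrow> has_left_endpoint A))
      \<and> (end_condition C3 N I L R \<longrightarrow> (A \<^bold>* X \<cong> X \<longleftrightarrow> has_right_endpoint A))
      \<and> (end_condition C4 N I L R \<longrightarrow>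
           (A \<^bold>* X \<cong> X \<longleftrightarrow> A \<cong> \<^bold>1 \<^bold>+ \<^bold>Q \<^bold>+ \<^bold>1 \<or> A \<cong> \<^bold>1))
      \<and> (end_condition C5 N I L R \<longrightarrow>
           (A \<^bold>* X \<cong> X \<longleftrightarrow> has_left_endpoint A \<and> has_right_endpoint A \<and>
             all_have_successors A \<and> all_have_predecessors A))
      \<and> (end_condition C6 N I L R \<longrightarrow>
           (A \<^bold>* X \<cong> X \<longleftrightarrow> has_left_endpoint A \<and> has_right_endpoint A \<and>
             all_have_successors A))
      \<and> (end_condition C7 N I L R \<longrightarrow>
           (A \<^bold>* X \<cong> X \<longleftrightarrow> has_left_endpoint A \<and> has_right_endpoint A \<and>
             all_have_predecessors A))
      \<and> (end_condition C8 N I L R \<longrightarrow>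
           (A \<^bold>* X \<cong> X \<longleftrightarrow> has_left_endpoint A \<and> has_right_endpoint A))"
      \<comment> \<open>In case \<open>C4\<close> the third clause rules out successor pairs, which
        \<open>dense_with_endpoints_iff\<close> relates to the two listed orders.\<close>
      unfolding key absorption_condition_def dense_with_endpoints_iff[OF A, symmetric] ends defs[symmetric]
      using facts nonempty by argo
  qed
qed

end
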